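(* Let $\alpha_1,\alpha_2,\alpha_3>0$ with $\alpha_1+\alpha_2+\alpha_3=\pi$ and let $0<c<2$. Then the hexagonal circle pattern $Z^c$ with intersection angles $\alpha_1,\alpha_2,\alpha_3$ is an immersion.
   Context: For pairwise distinct $z_1,z_2,z_3,z_4\in\mathbb C$ let $q(z_1,z_2,z_3,z_4)=\frac{(z_1-z_2)(z_3-z_4)}{(z_2-z_3)(z_4-z_1)}$. Let $Q=\{(k,l,m)\in\mathbb Z^3: k\ge0,\ l\ge0,\ m\le0\}$. A map $z:Q\to\mathbb C$, $(k,l,m)\mapsto z_{k,l,m}$, is a solution of the system if (i) for all $(k,l,m)$ such that all arguments lie in $Q$: $q(z_{k,l,m},z_{k,l+1,m},z_{k-1,l+1,m},z_{k-1,l,m})=e^{-2i\alpha_1}$, $q(z_{k,l,m},z_{k,l,m-1},z_{k,l+1,m-1},z_{k,l+1,m})=e^{-2i\alpha_2}$, $q(z_{k,l,m},z_{k+1,l,m},z_{k+1,l,m-1},z_{k,l,m-1})=e^{-2i\alpha_3}$; and (ii) for all $(k,l,m)\in Q$: $$c\,z_{k,l,m}=2k\frac{(z_{k+1,l,m}-z_{k,l,m})(z_{k,l,m}-z_{k-1,l,m})}{z_{k+1,l,m}-z_{k-1,l,m}}+2l\frac{(z_{k,l+1,m}-z_{k,l,m})(z_{k,l,m}-z_{k,l-1,m})}{z_{k,l+1,m}-z_{k,l-1,m}}+2m\frac{(z_{k,l,m+1}-z_{k,l,m})(z_{k,l,m}-z_{k,l,m-1})}{z_{k,l,m+1}-z_{k,l,m-1}},$$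 where a term whose coefficient $2k$, $2l$ or $2m$ vanishes is omitted. (Such a solution has $z_{0,0,0}=0$ and is uniquely determined by $z_{1,0,0},z_{0,1,0},z_{0,0,-1}$.) Let $H=\{(k,l,m)\in\mathbb Z^3:|k+l+m|\le1\}$ and $Q_H=Q\cap H$. The hexagonal circle pattern $Z^c$ is the solution $z:Q\to\mathbb C$ of the system with initial data $z_{1,0,0}=1$, $z_{0,1,0}=e^{ic(\alpha_2+\alpha_3)}$, $z_{0,0,-1}=e^{ic\alpha_3}$, restricted to $Q_H$ (the points $z_{k,l,m}$ with $k+l+m=0$ are circle centers, those with $k+l+m=\pm1$ are intersection points of circles). An elementary quadrilateral of $Q_H$ is a quadruple $(p,p+e_i,p+e_i+e_j,p+e_j)$ with $p\in\mathbb Z^3$, $1\le i<j\le 3$, all four points in $Q_H$ ($e_1,e_2,e_3$ the standard basis); its image is the quadrilateral with vertices $z_p,z_{p+e_i},z_{p+e_i+e_j},z_{p+e_j}$. A map $z:Q_H\to\mathbb C$ is an immersion if the interiors of the images of any two adjacent (edge-sharing) elementary quadrilaterals are disjoint. *)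

theory Defs
  imports "HOL-Complex_Analysis.Winding_Numbers"
begin

type_synonym pt = "int \<times> int \<times> int"

text \<open>The cross-ratio-type function q (meant for pairwise distinct arguments).\<close>
definition qfun :: "complex \<Rightarrow> complex \<Rightarrow> complex \<Rightarrow> complex \<Rightarrow> complex" where
  "qfun z1 z2 z3 z4 = ((z1 - z2) * (z3 - z4)) / ((z2 - z3) * (z4 - z1))"

text \<open>The equation q(z1,z2,z3,z4) = w, including that q is defined (distinct arguments).\<close>
definition q_eq :: "complex \<Rightarrow> complex \<Rightarrow> complex \<Rightarrow> complex \<Rightarrow> complex \<Rightarrow> bool" where
  "q_eq z1 z2 z3 z4 w \<longleftrightarrow> distinct [z1, z2, z3, z4] \<and> qfun z1 z2 z3 z4 = w"

definition inQ :: "pt \<Rightarrow> bool" where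
  "inQ p \<longleftrightarrow> (case p of (k, l, m) \<Rightarrow> k \<ge> 0 \<and> l \<ge> 0 \<and> m \<le> 0)"

text \<open>One term of the constraint (ii): coefficient 2n times the harmonic-mean-type
  expression built from the neighbours a (forward) and d (backward) of b.
  Omitted (= 0) when the coefficient vanishes.\<close>
definition cterm :: "int \<Rightarrow> complex \<Rightarrow> complex \<Rightarrow> complex \<Rightarrow> complex" where
  "cterm n a b d = (if n = 0 then 0 else of_int (2 * n) * ((a - b) * (b - d) / (a - d)))"

text \<open>A map z on Q (values outside Q are irrelevant) solving the system (i)+(ii).\<close>
definition is_solution :: "real \<Rightarrow> real \<Rightarrow> real \<Rightarrow> real \<Rightarrow> (pt \<Rightarrow> complex) \<Rightarrow> bool" where
  "is_solution a1 a2 a3 c z \<longleftrightarrow>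
     (\<forall>k l m.
        (inQ (k,l,m) \<and> inQ (k,l+1,m) \<and> inQ (k-1,l+1,m) \<and> inQ (k-1,l,m) \<longrightarrow>
           q_eq (z (k,l,m)) (z (k,l+1,m)) (z (k-1,l+1,m)) (z (k-1,l,m)) (cis (-2 * a1))) \<and>
        (inQ (k,l,m) \<and> inQ (k,l,m-1) \<and> inQ (k,l+1,m-1) \<and> inQ (k,l+1,m) \<longrightarrow>
           q_eq (z (k,l,m)) (z (k,l,m-1)) (z (k,l+1,m-1)) (z (k,l+1,m)) (cis (-2 * a2))) \<and>
        (inQ (k,l,m) \<and> inQ (k+1,l,m) \<and> inQ (k+1,l,m-1) \<and> inQ (k,l,m-1) \<longrightarrow>
           q_eq (z (k,l,m)) (z (k+1,l,m)) (z (k+1,l,m-1)) (z (k,l,m-1)) (cis (-2 * a3)))) \<and>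
     (\<forall>k l m. inQ (k,l,m) \<longrightarrow>
        (k \<noteq> 0 \<longrightarrow> z (k+1,l,m) \<noteq> z (k-1,l,m)) \<and>
        (l \<noteq> 0 \<longrightarrow> z (k,l+1,m) \<noteq> z (k,l-1,m)) \<and>
        (m \<noteq> 0 \<longrightarrow> z (k,l,m+1) \<noteq> z (k,l,m-1)) \<and>
        of_real c * z (k,l,m) =
          cterm k (z (k+1,l,m)) (z (k,l,m)) (z (k-1,l,m)) +
          cterm l (z (k,l+1,m)) (z (k,l,m)) (z (k,l-1,m)) +
          cterm m (z (k,l,m+1)) (z (k,l,m)) (z (k,l,m-1)))"

definition Zc_initial :: "real \<Rightarrow> real \<Rightarrow> real \<Rightarrow> real \<Rightarrow> (pt \<Rightarrow> complex) \<Rightarrow> bool" where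
  "Zc_initial a1 a2 a3 c z \<longleftrightarrow>
     z (1,0,0) = 1 \<and> z (0,1,0) = cis (c * (a2 + a3)) \<and> z (0,0,-1) = cis (c * a3)"

definition inH :: "pt \<Rightarrow> bool" where
  "inH p \<longleftrightarrow> (case p of (k, l, m) \<Rightarrow> \<bar>k + l + m\<bar> \<le> 1)"

definition inQH :: "pt \<Rightarrow> bool" where
  "inQH p \<longleftrightarrow> inQ p \<and> inH p"

definition padd :: "pt \<Rightarrow> pt \<Rightarrow> pt" where
  "padd p r = (case p of (a,b,c) \<Rightarrow> case r of (a',b',c') \<Rightarrow> (a+a', b+b', c+c'))"

definition ebas :: "nat \<Rightarrow> pt" where
  "ebas i = (if i = 1 then (1,0,0) else if i = 2 then (0,1,0) else (0,0,1))"

definition quad_verts :: "pt \<Rightarrow> nat \<Rightarrow> nat \<Rightarrow> pt list" where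
  "quad_verts p i j = [p, padd p (ebas i), padd (padd p (ebas i)) (ebas j), padd p (ebas j)]"

definition elem_quad :: "pt \<Rightarrow> nat \<Rightarrow> nat \<Rightarrow> bool" where
  "elem_quad p i j \<longleftrightarrow> 1 \<le> i \<and> i < j \<and> j \<le> 3 \<and> (\<forall>v \<in> set (quad_verts p i j). inQH v)"

definition quad_edges :: "pt list \<Rightarrow> pt set set" where
  "quad_edges vs = {{vs!0, vs!1}, {vs!1, vs!2}, {vs!2, vs!3}, {vs!3, vs!0}}"

definition quad_path :: "complex \<Rightarrow> complex \<Rightarrow> complex \<Rightarrow> complex \<Rightarrow> real \<Rightarrow> complex" where
  "quad_path a b c d = linepath a b +++ linepath b c +++ linepath c d +++ linepath d a"

text \<open>Interior of the (image) quadrilateral: points off the boundary enclosed by it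
  (nonzero winding number); for a simple quadrilateral this is its Jordan interior.\<close>
definition quad_interior :: "complex \<Rightarrow> complex \<Rightarrow> complex \<Rightarrow> complex \<Rightarrow> complex set" where
  "quad_interior a b c d =
     {w. w \<notin> path_image (quad_path a b c d) \<and> winding_number (quad_path a b c d) w \<noteq> 0}"

definition quad_image_interior :: "(pt \<Rightarrow> complex) \<Rightarrow> pt list \<Rightarrow> complex set" where
  "quad_image_interior z vs = quad_interior (z (vs!0)) (z (vs!1)) (z (vs!2)) (z (vs!3))"

definition immersion_QH :: "(pt \<Rightarrow> complex) \<Rightarrow> bool" where
  "immersion_QH z \<longleftrightarrow>
     (\<forall>p i j p' i' j'.
        elem_quad p i j \<and> elem_quad p' i' j' \<and> (p, i, j) \<noteq> (p', i', j') \<and>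
        quad_edges (quad_verts p i j) \<inter> quad_edges (quad_verts p' i' j') \<noteq> {} \<longrightarrow>
        quad_image_interior z (quad_verts p i j) \<inter> quad_image_interior z (quad_verts p' i' j') = {})"

end

theory Submission
  imports Defs
begin

text \<open>
  With n = -m the map z lives on the octant of triples of natural numbers. Write
  z(x + e_i) - z(x) = v_i w(x) w(x + e_i) with unit numbers v_i; then the cross-ratio equations become
  the Hirota relation for w, and a circle pattern is a solution w that is positive (a radius) at even
  points and unimodular at odd points. The constraint (ii) says that z is itself the sum on the
  right-hand side, and it propagates because this sum changes along every edge in a way that only
  involves the two faces at that edge.

  For a face with angle d the pattern on a quarter plane depends on one angle x at the origin. By the
  constraint it is positive everywhere as soon as it is positive on the diagonal, where it is governed
  by a discrete Painleve recursion; a shooting argument gives some x for which all diagonal angles stay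
  in (0, d), and the set of such x is closed in (0, d). Three-dimensional consistency makes these
  sets additive: good angles for d and d' sum up to a good angle for d + d'. Repeated halving of d, together with
  the first step of the recursion, which forces x / d to approach c / 2 for small d, shows that x = c d / 2 is good.
  The planes (1,3) and (3,2) then determine a positive solution on the whole octant.

  Finally, every kite around a centre lies in an angular sector of opening less than twice its
  intersection angle, so two kites sharing an edge lie in disjoint sectors.
\<close>

section \<open>The Hirota relation\<close>

text \<open>The two sides of the relation are the two ways along a quadrilateral with edges
  \<open>u w w1\<close>, \<open>v w1 w12\<close> and \<open>v w w2\<close>, \<open>u w2 w12\<close>;
  it says that the quadrilateral closes. The obstacle is the sign of the radii: face equations and
  constraint are rational, so the recursion may produce negative radii or vanishing denominators,
  and the initial data do not visibly prevent this. The parameter x is half the angle at the origin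
  between the images of the two axes of a quarter plane. Z^c multiplies the angles at the origin by
  c, so the prescribed initial data amount to x = c d / 2. Shooting yields some positive pattern
  without telling its x. Additivity supplies the missing information: two positive quarter planes
  with a common axis span an octant whose third coordinate plane is a quarter plane for d + d' and x
  + x'. A good angle for a tiny d is known up to a relative error of order d^2, and this error
  survives multiplication by 2^n unchanged, so any choice of good angles at the small scales leads
  to the same limit.\<close>

definition hir :: "complex \<Rightarrow> complex \<Rightarrow> complex \<Rightarrow> complex \<Rightarrow> complex \<Rightarrow> complex \<Rightarrow> bool" where
  "hir u v w w1 w2 w12 \<longleftrightarrow> w1 * (u * w + v * w12) = w2 * (v * w + u * w12)"

definition hstep :: "complex \<Rightarrow> complex \<Rightarrow> complex \<Rightarrow> complex \<Rightarrow> complex \<Rightarrow> complex" where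
  "hstep u v w w1 w2 = w * (v * w2 - u * w1) / (v * w1 - u * w2)"

text \<open>Weighted sums of \<open>rdiff\<close> are the scalar form of the constraint: they govern
  how weighted sums of \<open>hmean\<close> change along an edge.\<close>

definition rdiff :: "complex \<Rightarrow> complex \<Rightarrow> complex" where
  "rdiff p m = (p - m) / (p + m)"

text \<open>For edges \<open>v w p\<close> ahead of and \<open>v w m\<close> behind a point, the
  term \<open>(a - b)(b - d)/(a - d)\<close> of the constraint is \<open>v w\<close> times this
  value, half of the harmonic mean.\<close>

definition hmean :: "complex \<Rightarrow> complex \<Rightarrow> complex" where
  "hmean p m = p * m / (p + m)"

lemma hir_swap: "hir u v w w1 w2 w12 \<longleftrightarrow> hir v u w w2 w1 w12"
  unfolding hir_def by (auto simp: algebra_simps)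

lemma hstep_swap: "hstep u v w w1 w2 = hstep v u w w2 w1"
proof -
  have "w * (v * w2 - u * w1) = - (w * (u * w1 - v * w2))" "v * w1 - u * w2 = - (u * w2 - v * w1)"
    by (simp_all add: algebra_simps)
  then show ?thesis unfolding hstep_def by (metis minus_divide_divide)
qed

lemma hir_hstep_iff:
  assumes "v * w1 \<noteq> u * w2"
  shows "hir u v w w1 w2 w12 \<longleftrightarrow> w12 = hstep u v w w1 w2"
proof -
  have "v * w1 - u * w2 \<noteq> 0" using assms by simp
  then have "w12 = hstep u v w w1 w2 \<longleftrightarrow> w12 * (v * w1 - u * w2) = w * (v * w2 - u * w1)"
    unfolding hstep_def by (simp add: eq_divide_eq)
  then show ?thesis unfolding hir_def by (auto simp: algebra_simps)
qed

text \<open>A vanishing denominator of \<open>hstep\<close> forces its numerator to vanish too, and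
  both together give u^2 = v^2.\<close>

lemma hir_nondeg:
  assumes "hir u v w w1 w2 w12" "u\<^sup>2 \<noteq> v\<^sup>2" "w \<noteq> 0" "w1 \<noteq> 0" "u \<noteq> 0"
  shows "v * w1 \<noteq> u * w2"
proof
  assume e: "v * w1 = u * w2"
  then have "w * (v * w2 - u * w1) = 0" using assms(1) unfolding hir_def by algebra
  then have "v * w2 = u * w1" using assms(3) by simp
  then have "(u\<^sup>2 - v\<^sup>2) * w1 = 0" using e by algebra
  then show False using assms by simp
qed

text \<open>How the term of the transverse direction k changes along an edge of direction i:
  \<open>a\<close>, \<open>a'\<close> are the neighbours ahead of its endpoints, \<open>m\<close>,
  \<open>m'\<close> those behind. Clearing denominators leaves a combination of the relations of the
  two faces at the edge.\<close>

lemma edge_identity: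
  assumes up: "hir vi vk W W' a a'" and down: "hir vi vk m m' W W'"
    and nz: "a + m \<noteq> 0" "a' + m' \<noteq> 0"
  shows "2 * vk * (W' * hmean a' m' - W * hmean a m) = vi * W * W' * (rdiff a' m' + rdiff a m)"
proof -
  have "2 * vk * (W' * a' * m' * (a + m) - W * a * m * (a' + m')) =
     vi * W * W' * ((a' - m') * (a + m) + (a - m) * (a' + m'))"
    using up down unfolding hir_def by algebra
  with nz show ?thesis unfolding hmean_def rdiff_def
    by (simp add: divide_simps) (simp add: algebra_simps)
qed

lemma edge_identity_converse:
  assumes e: "2 * vk * (W' * hmean a' m' - W * hmean a m) = vi * W * W' * (rdiff a' m' + rdiff a m)"
    and down: "hir vi vk m m' W W'"
    and nz: "a + m \<noteq> 0" "a' + m' \<noteq> 0" "W \<noteq> 0" "W' \<noteq> 0" "m \<noteq> 0" "m' \<noteq> 0"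
  shows "hir vi vk W W' a a'"
proof -
  have "2 * vk * (W' * a' * m' * (a + m) - W * a * m * (a' + m')) =
     vi * W * W' * ((a' - m') * (a + m) + (a - m) * (a' + m'))"
    using e nz unfolding hmean_def rdiff_def
    by (simp add: divide_simps) (simp add: algebra_simps)
  then have "m * (W' * (vi * W + vk * a') - a * (vk * W + vi * a')) * m' = 0"
    using down unfolding hir_def by algebra
  with nz show ?thesis unfolding hir_def by simp
qed

text \<open>Three faces at a corner and one opposite face already determine all values, so the
  remaining faces become identities in \<open>w\<close>, \<open>w1\<close>, \<open>w2\<close>,
  \<open>w3\<close>.\<close>

lemma cube_consistency:
  assumes h12: "hir v1 v2 w w1 w2 w12" and h13: "hir v1 v3 w w1 w3 w13"
    and h23: "hir v2 v3 w w2 w3 w23" and top: "hir v1 v2 w3 w13 w23 w123"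
    and d12: "v2 * w1 \<noteq> v1 * w2" and d13: "v3 * w1 \<noteq> v1 * w3" and d23: "v3 * w2 \<noteq> v2 * w3"
    and dt: "v2 * w13 \<noteq> v1 * w23" and w: "w \<noteq> 0"
  shows "hir v1 v3 w2 w12 w23 w123"
proof -
  define N12 D12 where "N12 = v2 * w2 - v1 * w1" "D12 = v2 * w1 - v1 * w2"
  define N13 D13 where "N13 = v3 * w3 - v1 * w1" "D13 = v3 * w1 - v1 * w3"
  define N23 D23 where "N23 = v3 * w3 - v2 * w2" "D23 = v3 * w2 - v2 * w3"
  have nz: "D12 \<noteq> 0" "D13 \<noteq> 0" "D23 \<noteq> 0"
    using d12 d13 d23 by (simp_all add: N12_D12_def N13_D13_def N23_D23_def)
  have e: "w12 = w * N12 / D12" "w13 = w * N13 / D13" "w23 = w * N23 / D23"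
    using h12 h13 h23 d12 d13 d23
    by (simp_all add: hir_hstep_iff hstep_def N12_D12_def N13_D13_def N23_D23_def)
  have e123: "w123 = w3 * (v2 * w23 - v1 * w13) / (v2 * w13 - v1 * w23)"
    using top dt by (simp add: hir_hstep_iff hstep_def)
  define E where "E = v2 * N13 * D23 - v1 * N23 * D13"
  define F where "F = v2 * N23 * D13 - v1 * N13 * D23"
  have E1: "v2 * w13 - v1 * w23 = w * E / (D13 * D23)"
    using nz by (simp add: e E_def divide_simps) (simp add: algebra_simps)
  have F1: "v2 * w23 - v1 * w13 = w * F / (D13 * D23)"
    using nz by (simp add: e F_def divide_simps) (simp add: algebra_simps)
  have E: "E \<noteq> 0" using E1 dt by auto
  have w123: "w123 * E = w3 * F" using e123 E1 F1 E w nz by (simp add: field_simps)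
  \<comment> \<open>The claim with all denominators cleared and multiplied by \<open>E\<close>;
    \<open>w3 * F\<close> stands for \<open>w123 * E\<close>.\<close>
  have "N12 * D23 * (v1 * w2 * E + v3 * w3 * F) = N23 * D12 * (v3 * w2 * E + v1 * w3 * F)"
    unfolding E_def F_def N12_D12_def N13_D13_def N23_D23_def by algebra
  then have "N12 * D23 * (v1 * w2 + v3 * w123) * E = N23 * D12 * (v3 * w2 + v1 * w123) * E"
    using w123 by algebra
  then have "N12 * D23 * (v1 * w2 + v3 * w123) = N23 * D12 * (v3 * w2 + v1 * w123)"
    using E by simp
  then show ?thesis unfolding hir_def e using nz
    by (simp add: divide_simps) (simp add: algebra_simps)
qed

lemma cube_consistency':
  assumes h12: "hir v1 v2 w w1 w2 w12" and h13: "hir v1 v3 w w1 w3 w13"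
    and h23: "hir v2 v3 w w2 w3 w23" and top: "hir v1 v2 w3 w13 w23 w123"
    and d12: "v2 * w1 \<noteq> v1 * w2" and d13: "v3 * w1 \<noteq> v1 * w3" and d23: "v3 * w2 \<noteq> v2 * w3"
    and dt: "v2 * w13 \<noteq> v1 * w23" and w: "w \<noteq> 0"
  shows "hir v2 v3 w1 w12 w13 w123"
  using cube_consistency[of v2 v1 w w2 w1 w12 v3 w3 w23 w13 w123] assms hir_swap by metis

section \<open>Radii at even points, unimodular values at odd points\<close>

definition circ_val :: "nat \<Rightarrow> complex \<Rightarrow> bool" where
  "circ_val n z \<longleftrightarrow> (if even n then \<exists>r>0. z = of_real r else norm z = 1)"

lemma circ_val_even: "even n \<Longrightarrow> circ_val n z \<Longrightarrow> \<exists>r>0. z = of_real r"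
  by (simp add: circ_val_def)

lemma circ_val_odd: "odd n \<Longrightarrow> circ_val n z \<longleftrightarrow> norm z = 1"
  by (simp add: circ_val_def)

lemma circ_val_nz: "circ_val n z \<Longrightarrow> z \<noteq> 0"
  by (auto simp: circ_val_def split: if_splits)

lemma circ_val_parity: "even m = even n \<Longrightarrow> circ_val m z \<longleftrightarrow> circ_val n z"
  by (simp add: circ_val_def)

lemma circ_val_even_add:
  assumes "even n" "circ_val n z" "circ_val n z'"
  shows "z + z' \<noteq> 0"
proof -
  obtain r r' where "r > 0" "r' > 0" "z = of_real r" "z' = of_real r'"
    using assms circ_val_even by metis
  then have "z + z' = of_real (r + r')" "r + r' > 0" by auto
  then show ?thesis by (metis less_irrefl of_real_eq_0_iff)
qed

lemma cnj_unit: "norm z = 1 \<Longrightarrow> cnj z = 1 / z"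
  using complex_norm_square[of z] by (auto simp: divide_simps mult.commute)

text \<open>For positive radii \<open>w1\<close>, \<open>w2\<close> the numerator of
  \<open>hstep\<close> is, up to a unimodular factor, the conjugate of its denominator, so
  unimodular values reproduce themselves.\<close>

lemma hstep_odd:
  assumes "circ_val 1 w" "circ_val 0 w1" "circ_val 0 w2" "norm u = 1" "norm v = 1" "u \<noteq> v"
  shows "v * w1 \<noteq> u * w2" "circ_val 1 (hstep u v w w1 w2)"
proof -
  obtain r1 r2 where r: "r1 > 0" "r2 > 0" "w1 = of_real r1" "w2 = of_real r2"
    using assms circ_val_even by (metis even_zero)
  have uv: "u \<noteq> 0" "v \<noteq> 0" "cnj u = 1 / u" "cnj v = 1 / v"
    using assms by (auto simp: cnj_unit)
  show nz: "v * w1 \<noteq> u * w2"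
  proof
    assume e: "v * w1 = u * w2"
    then have "norm (v * w1) = norm (u * w2)" by simp
    then have "r1 = r2" using assms r by (simp add: norm_mult)
    then show False using e r assms by auto
  qed
  have "norm (v * w2 - u * w1) = norm (cnj (v * w2 - u * w1) * (u * v))"
    using assms by (simp add: norm_mult del: complex_cnj_diff)
  also have "cnj (v * w2 - u * w1) * (u * v) = - (v * w1 - u * w2)"
    using uv r by (simp add: algebra_simps)
  finally have "norm (v * w2 - u * w1) = norm (v * w1 - u * w2)" by (metis norm_minus_cancel)
  then show "circ_val 1 (hstep u v w w1 w2)"
    using nz assms(1) by (simp add: circ_val_odd hstep_def norm_mult norm_divide)
qed

text \<open>\<open>q\<close>, \<open>Y\<close>, \<open>\<rho>\<close> and \<open>m\<close>,
  \<open>r\<close>, \<open>p\<close> are consecutive points on two parallel lines. If the outer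
  values of one line cancel, so do those of the other; thus a sum of radii, being positive, protects
  a sum of unimodular values.\<close>

lemma sum_nonzero:
  assumes "hir u v Y \<rho> r p" "hir u v q Y m r" "Y \<noteq> 0" "r \<noteq> 0" "q + \<rho> \<noteq> 0" "u\<^sup>2 \<noteq> v\<^sup>2"
  shows "p + m \<noteq> 0"
proof
  assume "p + m = 0"
  then have "Y * r * (q + \<rho>) * (v\<^sup>2 - u\<^sup>2) = 0"
    using assms(1,2) unfolding hir_def by algebra
  then show False using assms by auto
qed

lemma cis_sq_diff: "(cis b)\<^sup>2 - (cis a)\<^sup>2 = 2 * \<i> * cis a * cis b * of_real (sin (b - a))"
proof -
  have s: "2 * \<i> * of_real (sin (b - a)) = cis (b - a) - cis (a - b)"
    by (auto simp: complex_eq_iff sin_diff cos_diff)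
  have "2 * \<i> * cis a * cis b * of_real (sin (b - a)) = cis a * cis b * (2 * \<i> * of_real (sin (b - a)))"
    by simp
  also have "\<dots> = cis a * cis b * cis (b - a) - cis a * cis b * cis (a - b)"
    unfolding s by (rule right_diff_distrib)
  finally show ?thesis by (simp add: cis_mult power2_eq_square)
qed

lemma cis_sq_ne: "0 < b - a \<Longrightarrow> b - a < pi \<Longrightarrow> (cis a)\<^sup>2 \<noteq> (cis b)\<^sup>2"
  using cis_sq_diff[of b a] sin_gt_zero[of "b - a"] by auto

text \<open>Three faces meet at a centre of radius \<open>r\<close>. When \<open>p\<close> and
  \<open>q\<close>, the radii opposite to it in the planes (1,3) and (3,2), are positive, the one
  opposite in the plane (1,2) is \<open>r\<close> times a quotient of two sums of positive
  terms.\<close>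

lemma star_positive:
  assumes h13: "hir (cis a1) (cis a3) r W1 W3 p" and h32: "hir (cis a3) (cis a2) r W3 W2 q"
    and r: "circ_val 0 r" and p: "circ_val 0 p" and q: "circ_val 0 q"
    and W1: "W1 \<noteq> 0"
    and a: "a1 < a3" "a3 < a2" "a2 - a1 < pi"
  shows "cis a2 * W1 \<noteq> cis a1 * W2" "circ_val 0 (hstep (cis a1) (cis a2) r W1 W2)"
proof -
  obtain x y z where xyz: "x > 0" "y > 0" "z > 0" "r = of_real x" "p = of_real y" "q = of_real z"
    using r p q circ_val_even by (metis even_zero)
  define v1 v2 v3 where v: "v1 = cis a1" "v2 = cis a2" "v3 = cis a3"
  define s12 s13 s32 where s: "s12 = sin (a2 - a1)" "s13 = sin (a3 - a1)" "s32 = sin (a2 - a3)"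
  have sp: "s12 > 0" "s13 > 0" "s32 > 0" using a unfolding s by (auto intro!: sin_gt_zero)
  \<comment> \<open>\<open>M\<close> is the denominator of \<open>W2 / W1\<close> after elimination
    of \<open>W3\<close>; \<open>K\<close> is the nonreal factor common to numerator and denominator
    of \<open>hstep\<close>.\<close>
  define M where "M = (v3 * r + v1 * p) * (v2 * r + v3 * q)"
  define K where "K = 2 * \<i> * v1 * v2 * v3 * W1"
  have K: "K \<noteq> 0" using W1 by (simp add: K_def v)
  have d: "v2\<^sup>2 - v1\<^sup>2 = 2 * \<i> * v1 * v2 * of_real s12" "v3\<^sup>2 - v1\<^sup>2 = 2 * \<i> * v1 * v3 * of_real s13"
    "v2\<^sup>2 - v3\<^sup>2 = 2 * \<i> * v3 * v2 * of_real s32"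
    unfolding v s by (rule cis_sq_diff)+
  have "(v2 * W1 - v1 * W2) * M = W1 * r * (r * v3 * (v2\<^sup>2 - v1\<^sup>2) + q * v2 * (v3\<^sup>2 - v1\<^sup>2) + p * v1 * (v2\<^sup>2 - v3\<^sup>2))"
    using h13 h32 unfolding hir_def M_def v[symmetric] by algebra
  then have D: "(v2 * W1 - v1 * W2) * M = K * of_real (x * (x * s12 + z * s13 + y * s32))"
    unfolding d K_def xyz by (simp add: algebra_simps)
  have "(v2 * W2 - v1 * W1) * M = W1 * (r * q * v1 * (v2\<^sup>2 - v3\<^sup>2) + r * p * v2 * (v3\<^sup>2 - v1\<^sup>2) + p * q * v3 * (v2\<^sup>2 - v1\<^sup>2))"
    using h13 h32 unfolding hir_def M_def v[symmetric] by algebra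
  then have N: "(v2 * W2 - v1 * W1) * M = K * of_real (x * z * s32 + x * y * s13 + y * z * s12)"
    unfolding d K_def xyz by (simp add: algebra_simps)
  have dpos: "x * (x * s12 + z * s13 + y * s32) > 0" and npos: "x * z * s32 + x * y * s13 + y * z * s12 > 0"
    using xyz sp by (auto intro!: add_pos_pos mult_pos_pos)
  then have "(v2 * W1 - v1 * W2) * M \<noteq> 0"
    unfolding D using K by (metis less_irrefl mult_eq_0_iff of_real_eq_0_iff)
  then have nz: "v2 * W1 - v1 * W2 \<noteq> 0" "M \<noteq> 0" by auto
  then show "cis a2 * W1 \<noteq> cis a1 * W2" using v by simp
  have "(v2 * W2 - v1 * W1) / (v2 * W1 - v1 * W2) = ((v2 * W2 - v1 * W1) * M) / ((v2 * W1 - v1 * W2) * M)"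
    using nz by simp
  also have "\<dots> = of_real ((x * z * s32 + x * y * s13 + y * z * s12) / (x * (x * s12 + z * s13 + y * s32)))"
    unfolding D N using K by simp
  finally have "hstep v1 v2 r W1 W2 = of_real (x * ((x * z * s32 + x * y * s13 + y * z * s12) / (x * (x * s12 + z * s13 + y * s32))))"
    unfolding hstep_def xyz times_divide_eq_right[symmetric] of_real_mult by simp
  then show "circ_val 0 (hstep (cis a1) (cis a2) r W1 W2)"
    unfolding v circ_val_def using xyz dpos npos by (metis divide_pos_pos even_zero mult_pos_pos)
qed

section \<open>Quarter planes\<close>

text \<open>The quarter plane with given axis values. A vanishing denominator makes
  \<open>hstep\<close> return 0, so the face equation itself still requires proof.\<close>

fun fill :: "complex \<Rightarrow> complex \<Rightarrow> (nat \<Rightarrow> complex) \<Rightarrow> (nat \<Rightarrow> complex) \<Rightarrow> nat \<Rightarrow> nat \<Rightarrow> complex" where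
  "fill u v f g a 0 = f a"
| "fill u v f g 0 (Suc b) = g (Suc b)"
| "fill u v f g (Suc a) (Suc b) =
     hstep u v (fill u v f g a b) (fill u v f g (Suc a) b) (fill u v f g a (Suc b))"

lemma nat2_induct [case_names left right step]:
  assumes "\<And>a. P a 0" "\<And>b. P 0 (Suc b)"
    "\<And>a b. P a b \<Longrightarrow> P (Suc a) b \<Longrightarrow> P a (Suc b) \<Longrightarrow> P (Suc a) (Suc b)"
  shows "P a (b :: nat)"
proof (induction a arbitrary: b)
  case 0
  then show ?case using assms(1,2) by (cases b) auto
next
  case (Suc a)
  show ?case by (induction b) (use assms Suc in auto)
qed

lemma fill_0_left: "f 0 = g 0 \<Longrightarrow> fill u v f g 0 b = g b"
  by (cases b) auto

lemma hstep_scale: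
  assumes "l \<noteq> 0" "e \<noteq> 0"
  shows "hstep (l * u) (l * v) (x * w) (e * w1) (e * w2) = x * hstep u v w w1 w2"
proof -
  have "hstep (l * u) (l * v) (x * w) (e * w1) (e * w2) =
    ((l * e) * (x * (w * (v * w2 - u * w1)))) / ((l * e) * (v * w1 - u * w2))"
    unfolding hstep_def by (simp add: algebra_simps)
  also have "\<dots> = x * (w * (v * w2 - u * w1)) / (v * w1 - u * w2)"
    using assms by (subst mult_divide_mult_cancel_left) auto
  finally show ?thesis unfolding hstep_def by simp
qed

text \<open>A common rotation of the directions and a common factor at the odd points leave the even
  values alone; this freedom normalises the patterns.\<close>

lemma fill_gauge:
  assumes "l \<noteq> 0" "e \<noteq> 0" "f 0 = g 0"
  shows "fill (l * u) (l * v) (\<lambda>n. (if even n then 1 else e) * f n) (\<lambda>n. (if even n then 1 else e) * g n) a b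
       = (if even (a + b) then 1 else e) * fill u v f g a b"
proof (induction a b rule: nat2_induct)
  case (step a b)
  show ?case
    unfolding fill.simps step
    using hstep_scale[OF assms(1), of "if even (Suc a + b) then 1 else e" u v "if even (a + b) then 1 else e"] assms(2)
    by simp
qed (auto simp: assms)

lemma fill_cnj:
  assumes "f 0 = g 0"
  shows "fill (cnj v) (cnj u) (\<lambda>n. cnj (g n)) (\<lambda>n. cnj (f n)) b a = cnj (fill u v f g a b)"
proof (induction a b rule: nat2_induct)
  case (step a b)
  have "cnj (hstep u v w w1 w2) = hstep (cnj v) (cnj u) (cnj w) (cnj w2) (cnj w1)" for w w1 w2
    by (subst hstep_swap) (simp add: hstep_def)
  then show ?case using step by simp
qed (auto simp: assms fill_0_left)

text \<open>The quotient of consecutive radii solves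
  \<open>(2m + 1)(R' - R)/(R' + R) = c - 1\<close>, the constraint at the odd point 2m + 1 of an
  axis.\<close>

primrec axis_radius :: "real \<Rightarrow> nat \<Rightarrow> real" where
  "axis_radius c 0 = 1"
| "axis_radius c (Suc m) = axis_radius c m * (2 * real m + c) / (2 * real m + 2 - c)"

text \<open>The odd values are constant because the constraint at an even point of the axis makes
  its two neighbours equal.\<close>

definition axis_val :: "real \<Rightarrow> complex \<Rightarrow> nat \<Rightarrow> complex" where
  "axis_val c e n = (if even n then of_real (axis_radius c (n div 2)) else e)"

lemma axis_val_0 [simp]: "axis_val c e 0 = 1"
  by (simp add: axis_val_def)

lemma axis_val_1 [simp]: "axis_val c e (Suc 0) = e"
  by (simp add: axis_val_def)

lemma axis_radius_pos: "0 < c \<Longrightarrow> c < 2 \<Longrightarrow> axis_radius c m > 0"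
  by (induction m) (auto intro!: divide_pos_pos mult_pos_pos)

lemma axis_circ_val: "0 < c \<Longrightarrow> c < 2 \<Longrightarrow> norm e = 1 \<Longrightarrow> circ_val n (axis_val c e n)"
  unfolding circ_val_def axis_val_def using axis_radius_pos by auto

lemma axis_constraint:
  assumes "0 < c" "c < 2"
  shows "of_nat (Suc n) * rdiff (axis_val c e (Suc (Suc n))) (axis_val c e n) = (if even (Suc n) then 0 else of_real (c - 1))"
proof (cases "even n")
  case True
  then obtain m where n: "n = 2 * m" by blast
  define R where "R = axis_radius c m"
  have R: "R > 0" using assms axis_radius_pos R_def by simp
  have d: "2 * real m + 2 - c > 0" using assms by simp
  have "axis_val c e (Suc (Suc n)) = of_real (R * (2 * real m + c) / (2 * real m + 2 - c))" "axis_val c e n = of_real R"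
    by (simp_all add: axis_val_def n R_def)
  then have "of_nat (Suc n) * rdiff (axis_val c e (Suc (Suc n))) (axis_val c e n) =
     of_real (real (Suc n) * ((R * (2 * real m + c) / (2 * real m + 2 - c) - R) / (R * (2 * real m + c) / (2 * real m + 2 - c) + R)))"
    unfolding rdiff_def by simp
  also have "real (Suc n) * ((R * (2 * real m + c) / (2 * real m + 2 - c) - R) / (R * (2 * real m + c) / (2 * real m + 2 - c) + R)) = c - 1"
  proof -
    have a: "R * (2 * real m + c) / (2 * real m + 2 - c) - R = R * (2 * (c - 1)) / (2 * real m + 2 - c)"
      "R * (2 * real m + c) / (2 * real m + 2 - c) + R = R * (2 * real (Suc n)) / (2 * real m + 2 - c)"
      using d n by (auto simp: divide_simps) (auto simp: algebra_simps)
    have "real (Suc n) > 0" by simp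
    then show ?thesis unfolding a using d R by (auto simp: divide_simps) (auto simp: algebra_simps)
  qed
  finally show ?thesis using True by simp
next
  case False
  then show ?thesis by (simp add: axis_val_def rdiff_def)
qed

text \<open>The term whose direction is that of the edge. The summand 1 on the right arises because
  its coefficient grows from \<open>a\<close> to \<open>Suc a\<close> along the edge; the condition
  on \<open>m\<close> is void at \<open>a = 0\<close>, where there is no point behind.\<close>

lemma edge_identity_same:
  assumes "q + w \<noteq> 0" "a \<noteq> 0 \<Longrightarrow> w1 + m \<noteq> 0"
  shows "2 * u * (of_nat (Suc a) * w1 * hmean q w - of_nat a * w * hmean w1 m) =
     u * w * w1 * (of_nat (Suc a) * rdiff q w + of_nat a * rdiff w1 m + 1)"
proof -
  have q: "2 * hmean q w = w * (rdiff q w + 1)"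
    using assms(1) unfolding hmean_def rdiff_def by (simp add: divide_simps)
  have m: "of_nat a * (2 * hmean w1 m) = of_nat a * (w1 * (1 - rdiff w1 m))"
  proof (cases "a = 0")
    case False
    then have "2 * hmean w1 m = w1 * (1 - rdiff w1 m)"
      using assms(2) unfolding hmean_def rdiff_def by (simp add: divide_simps)
    then show ?thesis by simp
  qed auto
  have "2 * u * (of_nat (Suc a) * w1 * hmean q w - of_nat a * w * hmean w1 m) =
    u * (of_nat (Suc a) * w1 * (2 * hmean q w) - w * (of_nat a * (2 * hmean w1 m)))"
    by (simp add: algebra_simps)
  also have "\<dots> = u * w * w1 * (of_nat (Suc a) * (rdiff q w + 1) - of_nat a * (1 - rdiff w1 m))"
    unfolding q m by (simp add: algebra_simps)
  finally show ?thesis by (simp add: algebra_simps)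
qed

text \<open>Adding the increments along the two ways around a face and subtracting the Hirota
  relation leaves a nonzero multiple of \<open>gij - g\<close>: the constraint passes from three
  corners to the fourth.\<close>

lemma face_closing:
  fixes c :: complex
  assumes "Zi - Z = u * w * wi * (gi + g + 1)" "Zj - Z = v * w * wj * (gj + g + 1)"
    and "Zij - Zi = v * wi * wij * (gij + gi + 1)" "Zij - Zj = u * wj * wij * (gij + gj + 1)"
    and "hir u v w wi wj wij" "g + gi + 1 = c" "gj = gi" "v * wi \<noteq> u * wj" "wij \<noteq> 0"
  shows "gij = g"
proof -
  have g: "gi = c - g - 1" "gj = c - g - 1" using assms(6,7) by (auto simp: algebra_simps)
  have "(v * wi - u * wj) * wij * (gij - g) = 0"
    using assms(1-5) unfolding g hir_def by algebra
  then show ?thesis using assms by simp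
qed

section \<open>The constraint on a quarter plane\<close>

definition con2 :: "(nat \<Rightarrow> nat \<Rightarrow> complex) \<Rightarrow> nat \<Rightarrow> nat \<Rightarrow> complex" where
  "con2 w a b = of_nat a * rdiff (w (Suc a) b) (w (a - 1) b)
              + of_nat b * rdiff (w a (Suc b)) (w a (b - 1))"

text \<open>The right-hand side of the constraint (ii), hence c times the position. It changes along
  an edge by c times that edge once \<open>con2\<close> is 0 at even and c - 1 at odd points. At
  index 0 the truncated \<open>a - 1\<close> is multiplied by 0.\<close>

definition pos2 :: "complex \<Rightarrow> complex \<Rightarrow> (nat \<Rightarrow> nat \<Rightarrow> complex) \<Rightarrow> nat \<Rightarrow> nat \<Rightarrow> complex" where
  "pos2 u v w a b = 2 * (of_nat a * u * w a b * hmean (w (Suc a) b) (w (a - 1) b)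
                       + of_nat b * v * w a b * hmean (w a (Suc b)) (w a (b - 1)))"

text \<open>Positivity is assumed only up to the antidiagonal \<open>N\<close>, so that it can be
  extended by one antidiagonal of radii at a time.\<close>

locale pattern2 =
  fixes c :: real and u v :: complex and w :: "nat \<Rightarrow> nat \<Rightarrow> complex" and N :: nat and e1 e2 :: complex
  assumes c: "0 < c" "c < 2" and u: "norm u = 1" and v: "norm v = 1" and uv: "u\<^sup>2 \<noteq> v\<^sup>2"
    and e1: "norm e1 = 1" and e2: "norm e2 = 1" and N: "even N"
    and ax1: "w a 0 = axis_val c e1 a" and ax2: "w 0 b = axis_val c e2 b"
    and step: "w (Suc a) (Suc b) = hstep u v (w a b) (w (Suc a) b) (w a (Suc b))"
    and pos: "even (a + b) \<Longrightarrow> a + b \<le> N \<Longrightarrow> circ_val 0 (w a b)"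
begin

lemma swapped: "pattern2 c v u (\<lambda>a b. w b a) N e2 e1"
proof
  show "w (Suc b) (Suc a) = hstep v u (w b a) (w b (Suc a)) (w (Suc b) a)" for a b
    unfolding step by (rule hstep_swap)
  show "even (a + b) \<Longrightarrow> a + b \<le> N \<Longrightarrow> circ_val 0 (w b a)" for a b
    using pos[of b a] by (simp add: add.commute)
  show "v\<^sup>2 \<noteq> u\<^sup>2" using uv by simp
qed (fact c u v e1 e2 N ax1 ax2)+

lemma u_ne_v: "u \<noteq> v"
  using uv by auto

lemma u_nz: "u \<noteq> 0"
  using u by auto

lemma val_ax1: "circ_val a (w a 0)" and val_ax2: "circ_val b (w 0 b)"
  unfolding ax1 ax2 using axis_circ_val c e1 e2 by auto

lemma val: "a + b \<le> Suc N \<Longrightarrow> circ_val (a + b) (w a b)"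
proof (induction a b rule: nat2_induct)
  case (step a b)
  show ?case
  proof (cases "even (a + b)")
    case True
    then have "Suc a + Suc b \<le> N" using step.prems N by presburger
    then show ?thesis using pos[of "Suc a" "Suc b"] True circ_val_parity[of "Suc a + Suc b" 0] by simp
  next
    case False
    have "circ_val 1 (w a b)" using step False circ_val_parity[of "a + b" 1] by simp
    moreover have "circ_val 0 (w (Suc a) b)" "circ_val 0 (w a (Suc b))"
      using step False by (auto intro!: pos)
    ultimately have "circ_val 1 (w (Suc a) (Suc b))"
      unfolding pattern2.step[OF pattern2_axioms] using hstep_odd u v u_ne_v by metis
    then show ?thesis using False circ_val_parity[of "Suc a + Suc b" 1] by simp
  qed
qed (use val_ax1 val_ax2 in auto)

lemma nz: "a + b \<le> Suc N \<Longrightarrow> w a b \<noteq> 0"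
  using val circ_val_nz by blast

text \<open>A zero denominator would give the value 0 at the far corner, so a nonzero value there
  certifies the face equation. At odd base points \<open>hstep_odd\<close> does the same.\<close>

lemma face_if_nz:
  assumes "a + b \<le> N" "even (a + b) \<Longrightarrow> w (Suc a) (Suc b) \<noteq> 0"
  shows "v * w (Suc a) b \<noteq> u * w a (Suc b)"
    and "hir u v (w a b) (w (Suc a) b) (w a (Suc b)) (w (Suc a) (Suc b))"
proof -
  show 1: "v * w (Suc a) b \<noteq> u * w a (Suc b)"
  proof (cases "even (a + b)")
    case True
    then have "hstep u v (w a b) (w (Suc a) b) (w a (Suc b)) \<noteq> 0" using assms step by metis
    then show ?thesis unfolding hstep_def by auto
  next
    case False
    then have "Suc (a + b) \<le> N" using assms(1) N by presburger
    then have "circ_val 0 (w (Suc a) b)" "circ_val 0 (w a (Suc b))" "circ_val 1 (w a b)"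
      using False pos val[of a b] circ_val_parity[of "a + b" 1] by auto
    then show ?thesis using hstep_odd u v u_ne_v by metis
  qed
  show "hir u v (w a b) (w (Suc a) b) (w a (Suc b)) (w (Suc a) (Suc b))"
    unfolding hir_hstep_iff[OF 1] by (rule step)
qed

lemma face:
  assumes "a + b < N"
  shows "v * w (Suc a) b \<noteq> u * w a (Suc b)"
    and "hir u v (w a b) (w (Suc a) b) (w a (Suc b)) (w (Suc a) (Suc b))"
proof -
  have "even (a + b) \<Longrightarrow> w (Suc a) (Suc b) \<noteq> 0"
    using nz[of "Suc a" "Suc b"] assms by simp
  then show "v * w (Suc a) b \<noteq> u * w a (Suc b)"
    "hir u v (w a b) (w (Suc a) b) (w a (Suc b)) (w (Suc a) (Suc b))"
    using face_if_nz assms by auto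
qed

text \<open>Radii have a positive sum. At odd points the claim descends by
  \<open>sum_nonzero\<close> to the row below, whose values are radii; in row 0 both values equal
  \<open>e1\<close>.\<close>

lemma sum_nz:
  assumes "Suc a + b \<le> N"
  shows "w (Suc (Suc a)) b + w a b \<noteq> 0"
proof (cases "even (a + b)")
  case True
  then have "Suc (Suc a) + b \<le> N" using assms N by presburger
  then show ?thesis using True by (intro circ_val_even_add[of 0] pos) auto
next
  case False
  show ?thesis
  proof (cases b)
    case 0
    have "w (Suc (Suc a)) 0 + w a 0 = 2 * e1" using False 0 by (simp add: ax1 axis_val_def)
    then show ?thesis using e1 0 by auto
  next
    case (Suc b')
    show ?thesis unfolding Suc
    proof (rule sum_nonzero)
      show "hir u v (w (Suc a) b') (w (Suc (Suc a)) b') (w (Suc a) (Suc b')) (w (Suc (Suc a)) (Suc b'))"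
        "hir u v (w a b') (w (Suc a) b') (w a (Suc b')) (w (Suc a) (Suc b'))"
        using assms Suc face by auto
      show "w (Suc a) b' \<noteq> 0" "w (Suc a) (Suc b') \<noteq> 0" using assms Suc nz by auto
      show "w a b' + w (Suc (Suc a)) b' \<noteq> 0"
        using False Suc assms by (intro circ_val_even_add[of 0] pos) auto
    qed (rule uv)
  qed
qed

text \<open>The outer face and the outer sum enter as hypotheses, so that the identity can be used
  at the frontier, one step beyond the range of \<open>face\<close>.\<close>

lemma cross_edge:
  assumes "a + b \<le> N" "b \<noteq> 0 \<Longrightarrow> hir u v (w a b) (w (Suc a) b) (w a (Suc b)) (w (Suc a) (Suc b))"
    and "b \<noteq> 0 \<Longrightarrow> w (Suc a) (Suc b) + w (Suc a) (b - 1) \<noteq> 0"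
  shows "2 * v * (of_nat b * w (Suc a) b * hmean (w (Suc a) (Suc b)) (w (Suc a) (b - 1))
         - of_nat b * w a b * hmean (w a (Suc b)) (w a (b - 1)))
     = u * w a b * w (Suc a) b * (of_nat b * rdiff (w (Suc a) (Suc b)) (w (Suc a) (b - 1))
         + of_nat b * rdiff (w a (Suc b)) (w a (b - 1)))"
proof (cases b)
  case (Suc b')
  interpret sw: pattern2 c v u "\<lambda>a b. w b a" N e2 e1 by (rule swapped)
  have "2 * v * (w (Suc a) b * hmean (w (Suc a) (Suc b)) (w (Suc a) b')
         - w a b * hmean (w a (Suc b)) (w a b'))
     = u * w a b * w (Suc a) b * (rdiff (w (Suc a) (Suc b)) (w (Suc a) b')
         + rdiff (w a (Suc b)) (w a b'))"
  proof (rule edge_identity)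
    show "hir u v (w a b) (w (Suc a) b) (w a (Suc b)) (w (Suc a) (Suc b))" using assms Suc by simp
    show "hir u v (w a b') (w (Suc a) b') (w a b) (w (Suc a) b)" using assms Suc face by simp
    show "w a (Suc b) + w a b' \<noteq> 0" using sw.sum_nz[of b' a] assms Suc by simp
    show "w (Suc a) (Suc b) + w (Suc a) b' \<noteq> 0" using assms Suc by simp
  qed
  then show ?thesis unfolding Suc by (simp add: algebra_simps del: of_nat_Suc)
qed simp

lemma edge:
  assumes "Suc a + b \<le> N"
  shows "pos2 u v w (Suc a) b - pos2 u v w a b = u * w a b * w (Suc a) b * (con2 w (Suc a) b + con2 w a b + 1)"
proof -
  interpret sw: pattern2 c v u "\<lambda>a b. w b a" N e2 e1 by (rule swapped)
  have "2 * v * (of_nat b * w (Suc a) b * hmean (w (Suc a) (Suc b)) (w (Suc a) (b - 1))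
         - of_nat b * w a b * hmean (w a (Suc b)) (w a (b - 1)))
     = u * w a b * w (Suc a) b * (of_nat b * rdiff (w (Suc a) (Suc b)) (w (Suc a) (b - 1))
         + of_nat b * rdiff (w a (Suc b)) (w a (b - 1)))"
  proof (rule cross_edge)
    assume "b \<noteq> 0"
    then show "w (Suc a) (Suc b) + w (Suc a) (b - 1) \<noteq> 0"
      using sw.sum_nz[of "b - 1" "Suc a"] assms by simp
  qed (use assms face in auto)
  moreover have "2 * u * (of_nat (Suc a) * w (Suc a) b * hmean (w (Suc (Suc a)) b) (w a b)
      - of_nat a * w a b * hmean (w (Suc a) b) (w (a - 1) b))
    = u * w a b * w (Suc a) b * (of_nat (Suc a) * rdiff (w (Suc (Suc a)) b) (w a b)
      + of_nat a * rdiff (w (Suc a) b) (w (a - 1) b) + 1)"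
  proof (rule edge_identity_same)
    assume "a \<noteq> 0"
    then show "w (Suc a) b + w (a - 1) b \<noteq> 0" using sum_nz[of "a - 1" b] assms by simp
  qed (use assms sum_nz in auto)
  ultimately show ?thesis unfolding pos2_def con2_def by (simp add: algebra_simps)
qed

end

lemma con2_swap: "con2 (\<lambda>a b. w b a) b a = con2 w a b"
  by (simp add: con2_def)

lemma pos2_swap: "pos2 v u (\<lambda>a b. w b a) b a = pos2 u v w a b"
  by (simp add: pos2_def)

context pattern2
begin

lemma edge':
  assumes "a + Suc b \<le> N"
  shows "pos2 u v w a (Suc b) - pos2 u v w a b = v * w a b * w a (Suc b) * (con2 w a (Suc b) + con2 w a b + 1)"
proof -
  interpret sw: pattern2 c v u "\<lambda>a b. w b a" N e2 e1 by (rule swapped)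
  show ?thesis using sw.edge[of b a] assms by (simp add: con2_swap[of w] pos2_swap[of v u w])
qed

lemma constraint_axis: "con2 w a 0 = (if even a then 0 else of_real (c - 1))"
  by (cases a) (use axis_constraint[OF c] in \<open>auto simp: con2_def ax1 simp del: of_nat_Suc\<close>)

lemma constraint: "a + b \<le> N \<Longrightarrow> con2 w a b = (if even (a + b) then 0 else of_real (c - 1))"
proof (induction a b rule: nat2_induct)
  case (left a)
  then show ?case using constraint_axis by simp
next
  case (right b)
  interpret sw: pattern2 c v u "\<lambda>a b. w b a" N e2 e1 by (rule swapped)
  show ?case using sw.constraint_axis[of "Suc b"] con2_swap[of w "Suc b" 0] by simp
next
  case (step a b)
  have "con2 w (Suc a) (Suc b) = con2 w a b"
  proof (rule face_closing)
    show "con2 w a b + con2 w (Suc a) b + 1 = of_real c" "con2 w a (Suc b) = con2 w (Suc a) b"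
      using step by auto
    show "pos2 u v w (Suc a) b - pos2 u v w a b = u * w a b * w (Suc a) b * (con2 w (Suc a) b + con2 w a b + 1)"
      "pos2 u v w (Suc a) (Suc b) - pos2 u v w a (Suc b) = u * w a (Suc b) * w (Suc a) (Suc b) * (con2 w (Suc a) (Suc b) + con2 w a (Suc b) + 1)"
      using step.prems by (auto intro!: edge)
    show "pos2 u v w a (Suc b) - pos2 u v w a b = v * w a b * w a (Suc b) * (con2 w a (Suc b) + con2 w a b + 1)"
      "pos2 u v w (Suc a) (Suc b) - pos2 u v w (Suc a) b = v * w (Suc a) b * w (Suc a) (Suc b) * (con2 w (Suc a) (Suc b) + con2 w (Suc a) b + 1)"
      using step.prems by (auto intro!: edge')
    show "v * w (Suc a) b \<noteq> u * w a (Suc b)" "hir u v (w a b) (w (Suc a) b) (w a (Suc b)) (w (Suc a) (Suc b))"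
      using face step.prems by auto
    show "w (Suc a) (Suc b) \<noteq> 0" using nz step.prems by auto
  qed
  then show ?case using step by simp
qed

lemma pos2_edge:
  assumes "Suc a + b \<le> N"
  shows "pos2 u v w (Suc a) b - pos2 u v w a b = of_real c * u * w a b * w (Suc a) b"
  using edge[OF assms] constraint[of a b] constraint[of "Suc a" b] assms by (simp add: algebra_simps)

lemma pos2_edge':
  assumes "a + Suc b \<le> N"
  shows "pos2 u v w a (Suc b) - pos2 u v w a b = of_real c * v * w a b * w a (Suc b)"
  using edge'[OF assms] constraint[of a b] constraint[of a "Suc b"] assms by (simp add: algebra_simps)

end

section \<open>Extending positivity to the next antidiagonal of radii\<close>

lemma rdiff_circ_val:
  assumes "circ_val 0 p" "circ_val 0 m"
  obtains t where "\<bar>t\<bar> < 1" "rdiff p m = of_real t"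
proof -
  obtain x y where xy: "x > 0" "y > 0" "p = of_real x" "m = of_real y"
    using assms circ_val_even by (metis even_zero)
  have "\<bar>(x - y) / (x + y)\<bar> < 1" using xy by (simp add: divide_simps abs_if)
  moreover have "rdiff p m = of_real ((x - y) / (x + y))" using xy by (simp add: rdiff_def)
  ultimately show ?thesis using that by blast
qed

lemma ex_rdiff:
  assumes "circ_val 0 m" "\<bar>t\<bar> < 1"
  obtains r where "circ_val 0 r" "rdiff r m = of_real t"
proof -
  obtain y where y: "y > 0" "m = of_real y"
    using assms circ_val_even by (metis even_zero)
  define x where "x = y * (1 + t) / (1 - t)"
  have t: "1 - t > 0" "1 + t > 0" using assms(2) by auto
  have x: "x > 0" unfolding x_def using y t by auto
  have "x - y = 2 * t * y / (1 - t)" "x + y = 2 * y / (1 - t)"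
    unfolding x_def using t by (auto simp: divide_simps) (auto simp: algebra_simps)
  then have "(x - y) / (x + y) = t" using t y by simp
  then have "rdiff (of_real x) m = of_real t" unfolding rdiff_def y by (metis of_real_add of_real_diff of_real_divide)
  moreover have "circ_val 0 (of_real x)" using x by (auto simp: circ_val_def)
  ultimately show ?thesis using that by blast
qed

context pattern2
begin

text \<open>
  Solving the face equation might give a radius of the wrong sign or none at all. So the candidate
  radius is read off from the constraint, which makes it positive because b < a, and the converse of
  the edge identity shows that it also solves the face equation.
\<close>

lemma extend_off_diagonal:
  assumes N: "Suc a + b = N" and ab: "b < a" and known: "circ_val 0 (w (Suc a) (Suc (Suc b)))"
  shows "circ_val 0 (w (Suc (Suc a)) (Suc b))"
proof -
  interpret sw: pattern2 c v u "\<lambda>a b. w b a" N e2 e1 by (rule swapped)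
  have ev: "even (Suc a + b)" using N pattern2.N[OF pattern2_axioms] by simp
  define wP where "wP = w (Suc a) (Suc b)"
  have vP: "circ_val 1 wP"
    unfolding wP_def using val[of "Suc a" "Suc b"] N ev circ_val_parity[of "Suc a + Suc b" 1] by simp
  have pi: "circ_val 0 (w (Suc a) b)" and pj: "circ_val 0 (w a (Suc b))"
    using ev N by (auto intro!: pos)
  obtain t2 where t2: "\<bar>t2\<bar> < 1" "rdiff (w (Suc a) (Suc (Suc b))) (w (Suc a) b) = of_real t2"
    using rdiff_circ_val[OF known pi] by blast
  \<comment> \<open>Solves \<open>Suc a * t + Suc b * t2 = c - 1\<close>, the constraint at the odd
    point (a + 1, b + 1). A radius with this relative difference is positive exactly when |t| <
    1.\<close>
  define t where "t = (c - 1 - real (Suc b) * t2) / real (Suc a)"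
  have "\<bar>c - 1 - real (Suc b) * t2\<bar> \<le> \<bar>c - 1\<bar> + \<bar>real (Suc b) * t2\<bar>" by (rule abs_triangle_ineq4)
  also have "\<dots> = \<bar>c - 1\<bar> + real (Suc b) * \<bar>t2\<bar>" by (simp add: abs_mult)
  also have "\<dots> < 1 + real (Suc b) * 1" using c t2 by (intro add_strict_mono mult_strict_left_mono) auto
  also have "\<dots> \<le> real (Suc a)" using ab by simp
  finally have "\<bar>t\<bar> < 1" unfolding t_def by simp
  then obtain r where r: "circ_val 0 r" "rdiff r (w a (Suc b)) = of_real t"
    using ex_rdiff[OF pj] by blast
  define gP where "gP = of_nat (Suc a) * rdiff r (w a (Suc b))
    + of_nat (Suc b) * rdiff (w (Suc a) (Suc (Suc b))) (w (Suc a) b)"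
  have "gP = of_real (real (Suc a) * t + real (Suc b) * t2)"
    unfolding gP_def r t2 by simp
  also have "real (Suc a) * t + real (Suc b) * t2 = c - 1" unfolding t_def by simp
  finally have gP: "gP = of_real (c - 1)" .
  define zP where "zP = 2 * (of_nat (Suc a) * u * wP * hmean r (w a (Suc b))
    + of_nat (Suc b) * v * wP * hmean (w (Suc a) (Suc (Suc b))) (w (Suc a) b))"
  have g0: "con2 w a (Suc b) = 0" "con2 w (Suc a) b = 0"
    using constraint[of a "Suc b"] constraint[of "Suc a" b] N ev by auto
  have "2 * u * (of_nat (Suc a) * wP * hmean r (w a (Suc b))
      - of_nat a * w a (Suc b) * hmean wP (w (a - 1) (Suc b)))
    = u * w a (Suc b) * wP * (of_nat (Suc a) * rdiff r (w a (Suc b)) + of_nat a * rdiff wP (w (a - 1) (Suc b)) + 1)"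
  proof (rule edge_identity_same)
    show "r + w a (Suc b) \<noteq> 0" using circ_val_even_add[of 0] r pj by simp
    show "a \<noteq> 0 \<Longrightarrow> wP + w (a - 1) (Suc b) \<noteq> 0"
      using sum_nz[of "a - 1" "Suc b"] N by (simp add: wP_def)
  qed
  moreover have "2 * v * (of_nat (Suc b) * wP * hmean (w (Suc a) (Suc (Suc b))) (w (Suc a) (Suc b - 1))
         - of_nat (Suc b) * w a (Suc b) * hmean (w a (Suc (Suc b))) (w a (Suc b - 1)))
     = u * w a (Suc b) * wP * (of_nat (Suc b) * rdiff (w (Suc a) (Suc (Suc b))) (w (Suc a) (Suc b - 1))
         + of_nat (Suc b) * rdiff (w a (Suc (Suc b))) (w a (Suc b - 1)))"
    unfolding wP_def
  proof (rule cross_edge)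
    show "a + Suc b \<le> N" using N by simp
    show "hir u v (w a (Suc b)) (w (Suc a) (Suc b)) (w a (Suc (Suc b))) (w (Suc a) (Suc (Suc b)))"
      using circ_val_nz[OF known] N by (intro face_if_nz) auto
    show "w (Suc a) (Suc (Suc b)) + w (Suc a) (Suc b - 1) \<noteq> 0"
      using circ_val_even_add[of 0] known pi by simp
  qed
  ultimately have "zP - pos2 u v w a (Suc b) = u * w a (Suc b) * wP * (gP + con2 w a (Suc b) + 1)"
    unfolding zP_def gP_def pos2_def con2_def by (simp add: algebra_simps wP_def)
  then have z1: "zP - pos2 u v w a (Suc b) = of_real c * u * w a (Suc b) * wP"
    unfolding g0 gP by simp
  have main: "hir u v (w a b) (w (Suc a) b) (w a (Suc b)) wP"
    unfolding wP_def using N by (intro face) auto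
  have "pos2 u v w a (Suc b) - pos2 u v w a b = of_real c * v * w a b * w a (Suc b)"
    "pos2 u v w (Suc a) b - pos2 u v w a b = of_real c * u * w a b * w (Suc a) b"
    using N by (auto intro!: pos2_edge pos2_edge')
  \<comment> \<open>Closing the face based at (a, b) carries the increment of the candidate position
    \<open>zP\<close> from one neighbour over to the other.\<close>
  with z1 main have "zP - pos2 u v w (Suc a) b = of_real c * v * w (Suc a) b * wP"
    unfolding hir_def by algebra
  then have "zP - pos2 u v w (Suc a) b = v * w (Suc a) b * wP * (gP + con2 w (Suc a) b + 1)"
    unfolding gP g0 by simp
  moreover have "2 * v * (of_nat (Suc b) * wP * hmean (w (Suc a) (Suc (Suc b))) (w (Suc a) b)
      - of_nat b * w (Suc a) b * hmean wP (w (Suc a) (b - 1)))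
    = v * w (Suc a) b * wP * (of_nat (Suc b) * rdiff (w (Suc a) (Suc (Suc b))) (w (Suc a) b)
      + of_nat b * rdiff wP (w (Suc a) (b - 1)) + 1)"
  proof (rule edge_identity_same)
    show "w (Suc a) (Suc (Suc b)) + w (Suc a) b \<noteq> 0"
      using circ_val_even_add[of 0] known pi by simp
    show "b \<noteq> 0 \<Longrightarrow> wP + w (Suc a) (b - 1) \<noteq> 0"
      using sw.sum_nz[of "b - 1" "Suc a"] N by (simp add: wP_def)
  qed
  ultimately have "of_nat (Suc a) * (2 * u * (wP * hmean r (w a (Suc b)) - w (Suc a) b * hmean (w (Suc (Suc a)) b) (w a b)))
    = of_nat (Suc a) * (v * w (Suc a) b * wP * (rdiff r (w a (Suc b)) + rdiff (w (Suc (Suc a)) b) (w a b)))"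
    unfolding zP_def gP_def pos2_def con2_def by (simp add: algebra_simps wP_def)
  then have eq: "2 * u * (wP * hmean r (w a (Suc b)) - w (Suc a) b * hmean (w (Suc (Suc a)) b) (w a b))
    = v * w (Suc a) b * wP * (rdiff r (w a (Suc b)) + rdiff (w (Suc (Suc a)) b) (w a b))"
    by (metis mult_cancel_left of_nat_eq_0_iff nat.simps(3))
  \<comment> \<open>After removal of the same-direction term, \<open>eq\<close> is the transverse
    identity for the edge from (a + 1, b) to (a + 1, b + 1); the face below it is known, so the face
    above it holds with \<open>r\<close>.\<close>
  have "hir v u (w (Suc a) b) wP (w (Suc (Suc a)) b) r"
  proof (rule edge_identity_converse[OF eq])
    show "hir v u (w a b) (w a (Suc b)) (w (Suc a) b) wP" using main hir_swap by metis
    show "w (Suc (Suc a)) b + w a b \<noteq> 0" using sum_nz[of a b] N by simp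
    show "r + w a (Suc b) \<noteq> 0" using circ_val_even_add[of 0] r pj by simp
    show "w (Suc a) b \<noteq> 0" "wP \<noteq> 0" "w a b \<noteq> 0" "w a (Suc b) \<noteq> 0"
      using nz N by (auto simp: wP_def)
  qed
  then have h: "hir u v (w (Suc a) b) (w (Suc (Suc a)) b) wP r" using hir_swap by metis
  moreover have "v * w (Suc (Suc a)) b \<noteq> u * wP"
    using h by (rule hir_nondeg) (use uv u_nz nz N in auto)
  ultimately have "r = w (Suc (Suc a)) (Suc b)"
    unfolding step[of "Suc a" b] by (simp add: hir_hstep_iff wP_def)
  then show ?thesis using r by simp
qed

text \<open>Positivity walks along the antidiagonal from the diagonal towards the axis, where it is
  known anyway.\<close>

lemma extend_half:
  assumes N: "N = 2 * k" and diag: "circ_val 0 (w (Suc k) (Suc k))" and d: "d \<le> Suc k"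
  shows "circ_val 0 (w (Suc k + d) (Suc k - d))"
  using d
proof (induction d)
  case (Suc d)
  show ?case
  proof (cases "d = k")
    case True
    then show ?thesis using val_ax1[of "Suc k + Suc d"] circ_val_parity[of "Suc k + Suc d" 0] by simp
  next
    case False
    define b where "b = k - Suc d"
    have b: "Suc k - d = Suc (Suc b)" "Suc k - Suc d = Suc b" "k = Suc (b + d)"
      using Suc.prems False by (auto simp: b_def)
    have "circ_val 0 (w (Suc (Suc (k + d))) (Suc b))"
      by (rule extend_off_diagonal) (use N b Suc in auto)
    then show ?thesis using b by simp
  qed
qed (use diag in simp)

lemma extend:
  assumes N: "N = 2 * k" and diag: "circ_val 0 (w (Suc k) (Suc k))"
  shows "pattern2 c u v w (2 * Suc k) e1 e2"
proof -
  interpret sw: pattern2 c v u "\<lambda>a b. w b a" N e2 e1 by (rule swapped)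
  have "circ_val 0 (w a b)" if "even (a + b)" "a + b \<le> 2 * Suc k" for a b
  proof (cases "a + b \<le> N")
    case True
    then show ?thesis using pos that by simp
  next
    case False
    then have ab: "a + b = 2 * Suc k" using that N by presburger
    show ?thesis
    proof (cases "b \<le> a")
      case True
      then have "a = Suc k + (Suc k - b)" "b = Suc k - (Suc k - b)" using ab by auto
      then show ?thesis using extend_half[OF N diag, of "Suc k - b"] by simp
    next
      case False
      then have "b = Suc k + (Suc k - a)" "a = Suc k - (Suc k - a)" using ab by auto
      then show ?thesis using sw.extend_half[OF N diag, of "Suc k - a"] by simp
    qed
  qed
  then show ?thesis
    using c u v uv e1 e2 ax1 ax2 step by unfold_locales auto
qed

end

section \<open>The recursion on the diagonal\<close>

text \<open>With U = cis s the hypothesis reads Q = cos((s + B)/2) / cos((s - B)/2), that is,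
  tan(s/2) tan(B/2) = (1 - Q)/(1 + Q). Positivity of Q rules out s = pi, where tan(s/2) has no
  value.\<close>

lemma half_angle:
  assumes U: "norm U = 1" and B: "0 < B" "B < pi" and nz: "U + cis B \<noteq> 0"
    and Q: "2 * Re (1 / (U + cis B)) = Q" "Q > 0"
  shows "U = cis (2 * arctan ((1 - Q) / ((1 + Q) * tan (B / 2))))"
proof -
  define s where "s = Arg U"
  have s: "U = cis s" "- pi < s" "s \<le> pi"
    using U Arg_bounded[of U] cis_Arg[of U] unfolding s_def by (force simp: sgn_div_norm)+
  define C where "C = cos ((s - B) / 2)"
  have sum: "U + cis B = of_real (2 * C) * cis ((s + B) / 2)"
    unfolding s C_def by (simp add: complex_eq_iff cos_plus_cos sin_plus_sin)
  then have C: "C \<noteq> 0" using nz by auto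
  have "1 / (U + cis B) = of_real (1 / (2 * C)) * cis (- ((s + B) / 2))"
    unfolding sum using C by (simp add: cis_inverse[symmetric] divide_simps del: cis_inverse)
  then have "Re (1 / (U + cis B)) = cos ((s + B) / 2) / (2 * C)"
    by simp
  then have QC: "Q * C = cos ((s + B) / 2)" using Q C by (auto simp: field_simps)
  have e: "(s - B) / 2 = s / 2 - B / 2" "(s + B) / 2 = s / 2 + B / 2" by (simp_all add: field_simps)
  have QC: "Q * (cos (s / 2) * cos (B / 2) + sin (s / 2) * sin (B / 2)) = cos (s / 2) * cos (B / 2) - sin (s / 2) * sin (B / 2)"
    using QC unfolding C_def e by (simp add: cos_diff cos_add)
  have cB: "cos (B / 2) > 0" "sin (B / 2) > 0" using B by (auto intro!: cos_gt_zero sin_gt_zero)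
  have "s \<noteq> pi"
  proof
    assume "s = pi"
    then have "Q * sin (B / 2) = - sin (B / 2)" using QC by simp
    then show False using cB Q(2) by (metis mult_pos_pos neg_0_less_iff_less less_asym)
  qed
  then have hs: "- pi / 2 < s / 2" "s / 2 < pi / 2" using s by auto
  then have cs: "cos (s / 2) > 0" by (auto intro: cos_gt_zero_pi)
  have "(1 + Q) * (sin (s / 2) * sin (B / 2)) = (1 - Q) * (cos (s / 2) * cos (B / 2))"
    using QC by (simp add: algebra_simps)
  then have "tan (s / 2) = (1 - Q) / ((1 + Q) * tan (B / 2))"
    unfolding tan_def using cs cB Q(2) by (simp add: divide_simps) (simp add: algebra_simps)
  then have "arctan ((1 - Q) / ((1 + Q) * tan (B / 2))) = s / 2"
    using arctan_tan[of "s / 2"] hs by simp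
  then have "2 * arctan ((1 - Q) / ((1 + Q) * tan (B / 2))) = s" by simp
  then show ?thesis using s(1) by metis
qed

text \<open>The state consists of the half-angle A at the origin-side end of the kite along the
  diagonal and of the distance G of that centre from the origin in units of its radius. The kite
  gives the next G, the constraint at the next centre the next A.\<close>

primrec diag_state :: "real \<Rightarrow> real \<Rightarrow> real \<Rightarrow> nat \<Rightarrow> real \<times> real" where
  "diag_state c d x 0 = (x, 0)"
| "diag_state c d x (Suc k) =
    (let A = fst (diag_state c d x k); G = snd (diag_state c d x k);
         G' = (G * sin (d - A) + sin d) / sin A
     in (2 * arctan ((2 * real (Suc k) - c * G') / ((2 * real (Suc k) + c * G') * tan ((d - A) / 2))), G'))"

definition dang :: "real \<Rightarrow> real \<Rightarrow> nat \<Rightarrow> real \<Rightarrow> real" where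
  "dang c d k x = fst (diag_state c d x k)"

definition dpos :: "real \<Rightarrow> real \<Rightarrow> nat \<Rightarrow> real \<Rightarrow> real" where
  "dpos c d k x = snd (diag_state c d x k)"

lemma dang_0 [simp]: "dang c d 0 x = x" and dpos_0 [simp]: "dpos c d 0 x = 0"
  by (simp_all add: dang_def dpos_def)

lemma dpos_Suc: "dpos c d (Suc k) x =
    (dpos c d k x * sin (d - dang c d k x) + sin d) / sin (dang c d k x)"
  by (simp add: dang_def dpos_def Let_def)

lemma dang_Suc: "dang c d (Suc k) x = 2 * arctan ((2 * real (Suc k) - c * dpos c d (Suc k) x)
    / ((2 * real (Suc k) + c * dpos c d (Suc k) x) * tan ((d - dang c d k x) / 2)))"
  by (simp add: dang_def dpos_def Let_def)

text \<open>Normalised to be symmetric in the real axis: the first points on the two axes lie at cis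
  (- x) and cis x.\<close>

definition wdiag :: "real \<Rightarrow> real \<Rightarrow> real \<Rightarrow> nat \<Rightarrow> nat \<Rightarrow> complex" where
  "wdiag c d x = fill (cis (- d / 2)) (cis (d / 2)) (axis_val c (cis (d / 2 - x))) (axis_val c (cis (x - d / 2)))"

lemma wdiag_cnj: "wdiag c d x b a = cnj (wdiag c d x a b)"
proof -
  have "(\<lambda>n. cnj (axis_val c e n)) = axis_val c (cnj e)" for e by (auto simp: axis_val_def)
  then show ?thesis
    unfolding wdiag_def
    by (subst fill_cnj[symmetric]) (auto simp: cis_cnj)
qed

lemma pattern2_wdiag:
  assumes "0 < c" "c < 2" "0 < d" "d < pi" "even N"
    "\<And>a b. even (a + b) \<Longrightarrow> a + b \<le> N \<Longrightarrow> circ_val 0 (wdiag c d x a b)"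
  shows "pattern2 c (cis (- d / 2)) (cis (d / 2)) (wdiag c d x) N (cis (d / 2 - x)) (cis (x - d / 2))"
proof
  show "(cis (- d / 2))\<^sup>2 \<noteq> (cis (d / 2))\<^sup>2"
    by (rule cis_sq_ne) (use assms in auto)
qed (use assms in \<open>auto simp: wdiag_def fill_0_left\<close>)

lemma dpos_nonneg:
  assumes "0 < d" "d < pi" "\<And>j. j < k \<Longrightarrow> 0 < dang c d j x \<and> dang c d j x < d"
  shows "0 \<le> dpos c d k x"
  using assms(3)
proof (induction k)
  case (Suc k)
  have "0 < dang c d k x" "dang c d k x < d" using Suc.prems by auto
  then have "sin (dang c d k x) > 0" "sin (d - dang c d k x) > 0" "sin d > 0"
    using assms(1,2) by (auto intro!: sin_gt_zero)
  then show ?case using Suc unfolding dpos_Suc by (auto intro!: divide_nonneg_pos add_nonneg_nonneg)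
qed simp

lemma cis_mult_eqD: "cis a * z = cis b \<Longrightarrow> z = cis (b - a)"
  by (metis cis_divide cis_neq_zero nonzero_mult_div_cancel_left)

text \<open>The kite between consecutive diagonal centres has half-angles A and d - A there; its
  half-width is r sin A as well as r' sin (d - A).\<close>

lemma diagonal_step:
  assumes c: "0 < c" "c < 2" and d: "0 < d" "d < pi"
    and P: "pattern2 c (cis (- d / 2)) (cis (d / 2)) (wdiag c d x) (2 * k) (cis (d / 2 - x)) (cis (x - d / 2))"
    and U: "cis (d / 2) * wdiag c d x k (Suc k) = cis A"
    and r: "wdiag c d x k k = of_real r"
  shows "wdiag c d x (Suc k) (Suc k) = of_real (r * sin A / sin (d - A))"
    and "0 < A \<Longrightarrow> A < d \<Longrightarrow> circ_val 0 (wdiag c d x (Suc k) (Suc k))"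
proof -
  interpret pattern2 c "cis (- d / 2)" "cis (d / 2)" "wdiag c d x" "2 * k" "cis (d / 2 - x)" "cis (x - d / 2)"
    by (rule P)
  define W1 W2 where "W1 = wdiag c d x (Suc k) k" "W2 = wdiag c d x k (Suc k)"
  have W2: "W2 = cis (A - d / 2)"
    unfolding W1_W2_def by (rule cis_mult_eqD[OF U])
  have W1: "W1 = cis (d / 2 - A)"
    unfolding W1_W2_def(1) wdiag_cnj[of c d x "Suc k" k] W1_W2_def(2)[symmetric] W2 by (simp add: cis_cnj)
  have a: "cis (d / 2) * W1 = cis (d - A)" "cis (- d / 2) * W2 = cis (A - d)"
    "cis (d / 2) * W2 = cis A" "cis (- d / 2) * W1 = cis (- A)"
    unfolding W1 W2 cis_mult by (rule arg_cong[of _ _ cis], linarith)+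
  have s: "cis t - cis (- t) = 2 * \<i> * of_real (sin t)" for t
    by (simp add: complex_eq_iff)
  have "A - d = - (d - A)" by simp
  then have "wdiag c d x (Suc k) (Suc k) = of_real r * (2 * \<i> * of_real (sin A)) / (2 * \<i> * of_real (sin (d - A)))"
    unfolding step hstep_def r W1_W2_def[symmetric] a s[symmetric] by simp
  also have "\<dots> = of_real (r * sin A / sin (d - A))" by simp
  finally show e: "wdiag c d x (Suc k) (Suc k) = of_real (r * sin A / sin (d - A))" .
  have "r > 0" using pos[of k k] unfolding r circ_val_def by (auto simp: of_real_eq_iff)
  moreover have "sin A > 0" "sin (d - A) > 0" if "0 < A" "A < d" using that d by (auto intro!: sin_gt_zero)
  ultimately show "circ_val 0 (wdiag c d x (Suc k) (Suc k))" if "0 < A" "A < d"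
    unfolding e circ_val_def using that by (auto intro!: exI[of _ "r * sin A / sin (d - A)"])
qed

text \<open>The position follows along two edges of the kite. At the next centre the symmetry makes
  the two terms of the constraint conjugate, so it prescribes the real part of 1 / (U' + cis B), to
  which \<open>half_angle\<close> applies.\<close>

lemma diagonal_angle:
  assumes c: "0 < c" "c < 2" and d: "0 < d" "d < pi"
    and P: "pattern2 c (cis (- d / 2)) (cis (d / 2)) (wdiag c d x) (2 * Suc k) (cis (d / 2 - x)) (cis (x - d / 2))"
    and U: "cis (d / 2) * wdiag c d x k (Suc k) = cis A"
    and r: "wdiag c d x k k = of_real r"
    and Z: "pos2 (cis (- d / 2)) (cis (d / 2)) (wdiag c d x) k k = of_real (c * r * G)"
    and A: "0 < A" "A < d" and G: "0 \<le> G"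
    and G': "G' = (G * sin (d - A) + sin d) / sin A"
  shows "pos2 (cis (- d / 2)) (cis (d / 2)) (wdiag c d x) (Suc k) (Suc k) = of_real (c * (r * sin A / sin (d - A)) * G')"
    and "cis (d / 2) * wdiag c d x (Suc k) (Suc (Suc k)) =
      cis (2 * arctan ((2 * real (Suc k) - c * G') / ((2 * real (Suc k) + c * G') * tan ((d - A) / 2))))"
proof -
  interpret pattern2 c "cis (- d / 2)" "cis (d / 2)" "wdiag c d x" "2 * Suc k" "cis (d / 2 - x)" "cis (x - d / 2)"
    by (rule P)
  define B where "B = d - A"
  define r' where "r' = r * sin A / sin B"
  define u' v' where "u' = cis (- d / 2)" "v' = cis (d / 2)"
  define w where "w = wdiag c d x"
  have sg: "sin A > 0" "sin B > 0" "sin d > 0" using A d by (auto simp: B_def intro!: sin_gt_zero)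
  have "r > 0" using pos[of k k] unfolding r circ_val_def by (auto simp: of_real_eq_iff)
  then have r': "r' > 0" unfolding r'_def using sg by auto
  have G'pos: "G' > 0" unfolding G' using sg G by (auto simp: B_def intro!: divide_pos_pos add_nonneg_pos)
  have P': "pattern2 c u' v' w (2 * k) (cis (d / 2 - x)) (cis (x - d / 2))"
    unfolding u'_v'_def w_def by (rule pattern2_wdiag) (use c d pos in auto)
  have r1: "w (Suc k) (Suc k) = of_real r'"
    unfolding r'_def B_def w_def by (rule diagonal_step(1)[OF c d P'[unfolded u'_v'_def w_def] U r])
  have W2: "w k (Suc k) = cis (A - d / 2)"
    unfolding w_def by (rule cis_mult_eqD[OF U])
  have W1: "w (Suc k) k = cis (d / 2 - A)"
    unfolding w_def wdiag_cnj[of c d x "Suc k" k] W2[unfolded w_def] by (simp add: cis_cnj)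
  have e1: "u' * w (Suc k) k = cis (- A)" "v' * w (Suc k) k = cis B"
    unfolding W1 u'_v'_def cis_mult B_def by (rule arg_cong[of _ _ cis], linarith)+
  have "pos2 u' v' w (Suc k) (Suc k) = pos2 u' v' w k k
      + of_real c * (u' * w (Suc k) k) * w k k + of_real c * (v' * w (Suc k) k) * w (Suc k) (Suc k)"
    using pos2_edge[of k k] pos2_edge'[of "Suc k" k] unfolding u'_v'_def[symmetric] w_def[symmetric]
    by (simp add: algebra_simps)
  also have "\<dots> = of_real c * (of_real (r * G) + cis (- A) * of_real r + cis B * of_real r')"
    unfolding e1 r1 r[folded w_def] Z[folded u'_v'_def w_def] by (simp add: algebra_simps)
  \<comment> \<open>The imaginary parts cancel since r sin A = r' sin B; the real parts give the
    recursion for \<open>G'\<close>.\<close>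
  also have "of_real (r * G) + cis (- A) * of_real r + cis B * of_real r' = of_real (r' * G')"
  proof -
    have "sin d = sin (A + B)" by (simp add: B_def)
    then have "r' * G' = r * G + r * cos A + r' * cos B"
      unfolding G' r'_def B_def[symmetric] using sg
      by (simp add: sin_add divide_simps) (simp add: algebra_simps)
    moreover have "r' * sin B = r * sin A" unfolding r'_def using sg by simp
    ultimately show ?thesis by (simp add: complex_eq_iff algebra_simps)
  qed
  finally have Z1: "pos2 u' v' w (Suc k) (Suc k) = of_real (c * r' * G')" by simp
  then show "pos2 (cis (- d / 2)) (cis (d / 2)) (wdiag c d x) (Suc k) (Suc k) = of_real (c * (r * sin A / sin (d - A)) * G')"
    unfolding u'_v'_def w_def r'_def B_def .
  define p m where "p = w (Suc (Suc k)) (Suc k)" "m = w k (Suc k)"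
  have pm: "p + m \<noteq> 0" using sum_nz[of k "Suc k"] by (simp add: p_m_def w_def)
  define U' where "U' = v' * w (Suc k) (Suc (Suc k))"
  have "norm (w (Suc k) (Suc (Suc k))) = 1"
    using val[of "Suc k" "Suc (Suc k)"] unfolding w_def by (simp add: circ_val_odd)
  then have nU: "norm U' = 1" unfolding U'_def u'_v'_def by (simp add: norm_mult)
  have cU: "cnj U' = 1 / U'" using nU by (rule cnj_unit)
  have cp: "cnj p = w (Suc k) (Suc (Suc k))" "cnj m = w (Suc k) k"
    unfolding p_m_def w_def by (rule wdiag_cnj[symmetric])+
  have up: "u' * p = cnj U'"
    unfolding U'_def cp(1)[symmetric] u'_v'_def by (simp add: cis_cnj)
  have um: "u' * m = cis (- B)"
    unfolding p_m_def W2 u'_v'_def cis_mult B_def by (rule arg_cong[of _ _ cis], linarith)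
  have u0: "u' \<noteq> 0" by (simp add: u'_v'_def)
  have sm: "cnj U' + cis (- B) = u' * (p + m)" using up um by (simp add: algebra_simps)
  then have "cnj (U' + cis B) \<noteq> 0" using pm u0 by (simp add: cis_cnj)
  then have nzU: "U' + cis B \<noteq> 0" by (metis complex_cnj_zero)
  have U0: "U' \<noteq> 0" using nU by auto
  have "u' * hmean p m = (u' * p) * (u' * m) / (u' * (p + m))"
    using u0 pm by (simp add: hmean_def)
  also have "\<dots> = cnj U' * cis (- B) / (cnj U' + cis (- B))" unfolding up um sm[symmetric] ..
  also have "cnj U' + cis (- B) = (U' + cis B) * (cnj U' * cis (- B))"
    unfolding cU using U0 by (simp add: field_simps cis_mult)
  finally have h1: "u' * hmean p m = 1 / (U' + cis B)"
    using U0 by simp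
  have "v' * hmean (cnj p) (cnj m) = cnj (u' * hmean p m)"
    unfolding hmean_def u'_v'_def by (simp add: cis_cnj)
  then have "u' * hmean p m + v' * hmean (cnj p) (cnj m) = of_real (2 * Re (1 / (U' + cis B)))"
    unfolding h1 by (simp only: complex_add_cnj)
  moreover have "pos2 u' v' w (Suc k) (Suc k)
      = of_real (2 * real (Suc k) * r') * (u' * hmean p m + v' * hmean (cnj p) (cnj m))"
    unfolding pos2_def r1 cp by (simp add: p_m_def algebra_simps)
  ultimately have "of_real (c * r' * G') = (of_real (2 * real (Suc k) * r' * (2 * Re (1 / (U' + cis B)))) :: complex)"
    unfolding Z1 by simp
  then have "c * r' * G' = 2 * real (Suc k) * r' * (2 * Re (1 / (U' + cis B)))"
    by (simp only: of_real_eq_iff)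
  then have Q: "2 * Re (1 / (U' + cis B)) = c * G' / (2 * real (Suc k))"
    using r' by (auto simp: eq_divide_eq mult.commute mult.left_commute)
  have n: "2 * real (Suc k) > 0" by simp
  have "U' = cis (2 * arctan ((1 - c * G' / (2 * real (Suc k))) / ((1 + c * G' / (2 * real (Suc k))) * tan (B / 2))))"
    by (rule half_angle[OF nU _ _ nzU Q]) (use A d c G'pos in \<open>auto simp: B_def intro!: divide_pos_pos\<close>)
  also have "(1 - c * G' / (2 * real (Suc k))) / ((1 + c * G' / (2 * real (Suc k))) * tan (B / 2))
     = (2 * real (Suc k) - c * G') / ((2 * real (Suc k) + c * G') * tan (B / 2))"
  proof -
    have "1 - c * G' / (2 * real (Suc k)) = (2 * real (Suc k) - c * G') / (2 * real (Suc k))"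
      "1 + c * G' / (2 * real (Suc k)) = (2 * real (Suc k) + c * G') / (2 * real (Suc k))"
      using n by (auto simp: divide_simps)
    then show ?thesis using n by simp
  qed
  finally show "cis (d / 2) * wdiag c d x (Suc k) (Suc (Suc k)) =
      cis (2 * arctan ((2 * real (Suc k) - c * G') / ((2 * real (Suc k) + c * G') * tan ((d - A) / 2))))"
    unfolding U'_def u'_v'_def w_def B_def .
qed

section \<open>Good angles\<close>

definition good_angles :: "real \<Rightarrow> real \<Rightarrow> real set" where
  "good_angles c d = {x. \<forall>k. 0 < dang c d k x \<and> dang c d k x < d}"

lemma good_anglesD: "x \<in> good_angles c d \<Longrightarrow> 0 < x \<and> x < d"
  unfolding good_angles_def by (metis (mono_tags) dang_0 mem_Collect_eq)

text \<open>Only angles before step k are assumed to be in range, so the pattern is tied to the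
  recursion before the k-th angle has been located.\<close>

lemma diagonal_invariant:
  assumes c: "0 < c" "c < 2" and d: "0 < d" "d < pi"
    and A: "\<And>j. j < k \<Longrightarrow> 0 < dang c d j x \<and> dang c d j x < d"
  shows "pattern2 c (cis (- d / 2)) (cis (d / 2)) (wdiag c d x) (2 * k) (cis (d / 2 - x)) (cis (x - d / 2)) \<and>
    cis (d / 2) * wdiag c d x k (Suc k) = cis (dang c d k x) \<and>
    (\<exists>r. wdiag c d x k k = of_real r \<and>
         pos2 (cis (- d / 2)) (cis (d / 2)) (wdiag c d x) k k = of_real (c * r * dpos c d k x))"
  using A
proof (induction k)
  case 0
  have "pattern2 c (cis (- d / 2)) (cis (d / 2)) (wdiag c d x) 0 (cis (d / 2 - x)) (cis (x - d / 2))"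
    by (rule pattern2_wdiag) (use c d in \<open>auto simp: wdiag_def circ_val_def\<close>)
  then show ?case
    by (auto simp: wdiag_def pos2_def cis_mult intro!: exI[of _ 1])
next
  case (Suc k)
  define A G where "A = dang c d k x" "G = dpos c d k x"
  have Ad: "0 < A" "A < d" using Suc.prems unfolding A_G_def by auto
  have G: "0 \<le> G" unfolding A_G_def by (rule dpos_nonneg[OF d]) (use Suc.prems in auto)
  from Suc obtain r where
    P: "pattern2 c (cis (- d / 2)) (cis (d / 2)) (wdiag c d x) (2 * k) (cis (d / 2 - x)) (cis (x - d / 2))"
    and U: "cis (d / 2) * wdiag c d x k (Suc k) = cis A" and r: "wdiag c d x k k = of_real r"
    and Z: "pos2 (cis (- d / 2)) (cis (d / 2)) (wdiag c d x) k k = of_real (c * r * G)"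
    unfolding A_G_def by fastforce
  have P': "pattern2 c (cis (- d / 2)) (cis (d / 2)) (wdiag c d x) (2 * Suc k) (cis (d / 2 - x)) (cis (x - d / 2))"
    by (rule pattern2.extend[OF P refl diagonal_step(2)[OF c d P U r Ad]])
  have r': "wdiag c d x (Suc k) (Suc k) = of_real (r * sin A / sin (d - A))"
    by (rule diagonal_step(1)[OF c d P U r])
  have G': "dpos c d (Suc k) x = (G * sin (d - A) + sin d) / sin A"
    unfolding A_G_def by (rule dpos_Suc)
  note D = diagonal_angle[OF c d P' U r Z Ad G G']
  show ?case using P' r' D(1) D(2)[unfolded A_G_def dang_Suc[symmetric]] by blast
qed

lemma good_angles_positive:
  assumes c: "0 < c" "c < 2" and d: "0 < d" "d < pi" and x: "x \<in> good_angles c d" and ab: "even (a + b)"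
  shows "circ_val 0 (wdiag c d x a b)"
proof -
  have "pattern2 c (cis (- d / 2)) (cis (d / 2)) (wdiag c d x) (2 * (a + b)) (cis (d / 2 - x)) (cis (x - d / 2))"
    using diagonal_invariant[OF c d, of "a + b" x] x unfolding good_angles_def by blast
  then show ?thesis using ab pattern2.pos[of _ _ _ _ _ _ _ a b] by fastforce
qed

text \<open>
  An angle below d - pi would also give a positive radius on the diagonal; this branch is excluded
  by the radius next to the diagonal.
\<close>

lemma positive_good_angles:
  assumes c: "0 < c" "c < 2" and d: "0 < d" "d < pi" and x: "0 < x" "x < d"
    and pos: "\<And>a b. even (a + b) \<Longrightarrow> circ_val 0 (wdiag c d x a b)"
  shows "x \<in> good_angles c d"
proof -
  have "0 < dang c d k x \<and> dang c d k x < d" for k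
  proof (induction k rule: less_induct)
    case (less k)
    show ?case
    proof (cases k)
      case 0
      then show ?thesis using x by simp
    next
      case (Suc k')
      define A A' where "A = dang c d k' x" "A' = dang c d k x"
      have A: "0 < A" "A < d" using less[of k'] Suc by (auto simp: A_A'_def)
      have A': "- pi < A'" "A' < pi"
        unfolding A_A'_def Suc dang_Suc
        using arctan_lbound[of "(2 * real (Suc k') - c * dpos c d (Suc k') x) / ((2 * real (Suc k') + c * dpos c d (Suc k') x) * tan ((d - dang c d k' x) / 2))"]
          arctan_ubound[of "(2 * real (Suc k') - c * dpos c d (Suc k') x) / ((2 * real (Suc k') + c * dpos c d (Suc k') x) * tan ((d - dang c d k' x) / 2))"]
        by linarith+
      have P: "pattern2 c (cis (- d / 2)) (cis (d / 2)) (wdiag c d x) N (cis (d / 2 - x)) (cis (x - d / 2))" if "even N" for N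
        by (rule pattern2_wdiag) (use c d pos that in auto)
      have U': "cis (d / 2) * wdiag c d x k (Suc k) = cis A'"
        using diagonal_invariant[OF c d less] by (simp add: A_A'_def)
      have U: "cis (d / 2) * wdiag c d x k' k = cis A"
        using diagonal_invariant[OF c d less, of k'] Suc by (simp add: A_A'_def)
      obtain r where r: "r > 0" "wdiag c d x k k = of_real r" using pos[of k k] by (auto simp: circ_val_def)
      have "wdiag c d x (Suc k) (Suc k) = of_real (r * sin A' / sin (d - A'))"
        by (rule diagonal_step(1)[OF c d P[of "2 * k"] U' r(2)]) simp
      moreover obtain r'' where "r'' > 0" "wdiag c d x (Suc k) (Suc k) = of_real r''"
        using pos[of "Suc k" "Suc k"] by (auto simp: circ_val_def)
      ultimately have "r * sin A' / sin (d - A') > 0" by (metis of_real_eq_iff)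
      then have "r * (sin A' / sin (d - A')) > 0" by simp
      then have sgn: "sin A' / sin (d - A') > 0" using r(1) zero_less_mult_pos by blast
      have "0 < A'"
      proof (rule ccontr)
        assume n: "\<not> 0 < A'"
        have "A' \<noteq> 0" using sgn by auto
        then have "A' < 0" using n by simp
        then have "sin A' < 0" using sin_gt_zero[of "- A'"] A' by simp
        then have s: "sin (d - A') < 0" using sgn by (simp add: zero_less_divide_iff)
        have dA: "d - A' > pi"
          using s sin_ge_zero[of "d - A'"] \<open>A' < 0\<close> d by force
        obtain r1 where r1: "r1 > 0" "wdiag c d x (Suc k) k' = of_real r1"
          using pos[of "Suc k" k'] Suc by (auto simp: circ_val_def)
        define W W' where "W = wdiag c d x k k'" "W' = wdiag c d x (Suc k) k"
        \<comment> \<open>The face next to the diagonal reads r1 cos((d + A - A')/2) = r cos((d - A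
          + A')/2). With A' < 0 and d - A' > pi the right side is positive while the left cosine is
          not.\<close>
        have "hir (cis (- d / 2)) (cis (d / 2)) W (of_real r1) (of_real r) W'"
          using pattern2.face(2)[OF P[of "2 * Suc k"], of k k'] Suc unfolding W_W'_def r1(2)[symmetric] r(2)[symmetric] by simp
        then have h: "of_real r1 * (cis (- d / 2) * W + cis (d / 2) * W') = of_real r * (cis (d / 2) * W + cis (- d / 2) * W')"
          unfolding hir_def .
        have W: "W = cis (d / 2 - A)"
          unfolding W_W'_def wdiag_cnj[of c d x k k'] cis_mult_eqD[OF U] by (simp add: cis_cnj)
        have W': "W' = cis (d / 2 - A')"
          unfolding W_W'_def wdiag_cnj[of c d x "Suc k" k] cis_mult_eqD[OF U'] by (simp add: cis_cnj)
        have sum: "cis s + cis t = of_real (2 * cos ((s - t) / 2)) * cis ((s + t) / 2)" for s t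
          by (simp add: complex_eq_iff cos_plus_cos sin_plus_sin)
        have a1: "(- d / 2 + (d / 2 - A) - (d / 2 + (d / 2 - A'))) / 2 = - ((d + A - A') / 2)"
          "(d / 2 + (d / 2 - A) - (- d / 2 + (d / 2 - A'))) / 2 = (d - A + A') / 2"
          "(- d / 2 + (d / 2 - A) + (d / 2 + (d / 2 - A'))) / 2 = (d - A - A') / 2"
          "(d / 2 + (d / 2 - A) + (- d / 2 + (d / 2 - A'))) / 2 = (d - A - A') / 2"
          by (simp_all add: field_simps)
        have "of_real (r1 * (2 * cos ((d + A - A') / 2))) * cis ((d - A - A') / 2)
          = of_real (r * (2 * cos ((d - A + A') / 2))) * cis ((d - A - A') / 2)"
          using h unfolding W W' cis_mult sum a1 cos_minus by simp
        then have "of_real (r1 * (2 * cos ((d + A - A') / 2))) = (of_real (r * (2 * cos ((d - A + A') / 2))) :: complex)"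
          by simp
        then have e: "r1 * (2 * cos ((d + A - A') / 2)) = r * (2 * cos ((d - A + A') / 2))"
          by (simp only: of_real_eq_iff)
        have "cos ((d - A + A') / 2) > 0" using A A' d \<open>A' < 0\<close> by (intro cos_gt_zero_pi) auto
        then have "r1 * (2 * cos ((d + A - A') / 2)) > 0" unfolding e using r by simp
        then have "cos ((d + A - A') / 2) > 0" using r1 by (simp add: zero_less_mult_iff)
        moreover have "cos (pi - (d + A - A') / 2) \<ge> 0"
        proof -
          have "d + A - A' < 3 * pi" "d + A - A' > pi" using A A' d dA by linarith+
          then show ?thesis by (intro cos_ge_zero) (auto simp: field_simps)
        qed
        ultimately show False by simp
      qed
      then have "sin A' > 0" using A' by (intro sin_gt_zero)
      then have s: "sin (d - A') > 0" using sgn by (simp add: zero_less_divide_iff)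
      have "A' < d"
      proof (rule ccontr)
        assume "\<not> A' < d"
        then have "sin (A' - d) \<ge> 0" using A' d by (intro sin_ge_zero) auto
        moreover have "sin (A' - d) = - sin (d - A')" using sin_minus[of "d - A'"] by simp
        ultimately show False using s by simp
      qed
      then show ?thesis using \<open>0 < A'\<close> by (simp add: A_A'_def)
    qed
  qed
  then show ?thesis by (simp add: good_angles_def)
qed

section \<open>Shooting: orbits leaving through 0 or through d\<close>

definition in_range :: "real \<Rightarrow> real \<Rightarrow> nat \<Rightarrow> real \<Rightarrow> bool" where
  "in_range c d k x \<longleftrightarrow> (\<forall>j<k. 0 < dang c d j x \<and> dang c d j x < d)"

lemma in_range_Suc: "in_range c d (Suc k) x \<longleftrightarrow> in_range c d k x \<and> 0 < dang c d k x \<and> dang c d k x < d"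
  by (auto simp: in_range_def less_Suc_eq)

lemma half_tan_pos: "0 < t \<Longrightarrow> t < pi \<Longrightarrow> tan (t / 2) > 0"
  by (intro tan_gt_zero) auto

lemma diag_continuous:
  assumes c: "0 < c" and d: "0 < d" "d < pi" and "in_range c d k x"
  shows "isCont (dang c d k) x \<and> isCont (dpos c d k) x"
  using assms(4)
proof (induction k)
  case (Suc k)
  have A: "0 < dang c d k x" "dang c d k x < d" using Suc.prems by (auto simp: in_range_Suc)
  have IH: "isCont (dang c d k) x" "isCont (dpos c d k) x" using Suc by (auto simp: in_range_Suc)
  have s: "sin (dang c d k x) \<noteq> 0" using sin_gt_zero[of "dang c d k x"] A d by auto
  have e: "dpos c d (Suc k) = (\<lambda>x. (dpos c d k x * sin (d - dang c d k x) + sin d) / sin (dang c d k x))"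
    by (rule ext) (rule dpos_Suc)
  have P: "isCont (dpos c d (Suc k)) x"
    unfolding e using IH s by (intro continuous_intros) auto
  have t: "tan ((d - dang c d k x) / 2) > 0" using A d by (intro half_tan_pos) auto
  have G: "dpos c d (Suc k) x \<ge> 0" using dpos_nonneg[OF d] Suc.prems by (auto simp: in_range_def)
  have "c * dpos c d (Suc k) x \<ge> 0" using G c by simp
  then have den: "(2 * real (Suc k) + c * dpos c d (Suc k) x) * tan ((d - dang c d k x) / 2) \<noteq> 0"
    using t by (simp add: add_nonneg_eq_0_iff del: of_nat_Suc)
  have cs: "cos ((d - dang c d k x) / 2) \<noteq> 0" using t by (auto simp: tan_def)
  have e: "dang c d (Suc k) = (\<lambda>x. 2 * arctan ((2 * real (Suc k) - c * dpos c d (Suc k) x)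
    / ((2 * real (Suc k) + c * dpos c d (Suc k) x) * tan ((d - dang c d k x) / 2))))"
    by (rule ext) (rule dang_Suc)
  have "isCont (dang c d (Suc k)) x"
    unfolding e using IH P den cs by (intro continuous_intros isCont_tan') auto
  then show ?case using P by simp
next
  case 0
  have "dang c d 0 = (\<lambda>x. x)" "dpos c d 0 = (\<lambda>x. 0)" by (auto simp: fun_eq_iff)
  then show ?case by simp
qed


text \<open>
  An orbit hitting 0 or d overshoots in the next step, so leaving through either end is an
  open condition on the initial angle.
\<close>

lemma exit_low:
  assumes c: "0 < c" and d: "0 < d" "d < pi" and x: "in_range c d k x" "dang c d k x = 0"
  shows "\<forall>\<^sub>F y in nhds x. in_range c d k y \<longrightarrow> 0 < dang c d k y \<longrightarrow> dang c d k y < d \<longrightarrow> dang c d (Suc k) y < 0"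
proof -
  \<comment> \<open>Negativity of the numerator in \<open>dang_Suc\<close>, multiplied by the sine
    of the angle; in this form the condition stays continuous where the angle is 0.\<close>
  define f where "f y = c * (dpos c d k y * sin (d - dang c d k y) + sin d) - 2 * real (Suc k) * sin (dang c d k y)" for y
  have "isCont f x" unfolding f_def
    using diag_continuous[OF c d x(1)] by (intro continuous_intros) auto
  moreover have "f x > 0"
  proof -
    have "dpos c d k x \<ge> 0" using dpos_nonneg[OF d] x by (auto simp: in_range_def)
    moreover have "sin d > 0" using d by (intro sin_gt_zero)
    ultimately show ?thesis unfolding f_def x(2) using c by (simp add: add_nonneg_pos)
  qed
  ultimately have "\<forall>\<^sub>F y in nhds x. f y > 0"
    unfolding isCont_def tendsto_at_iff_tendsto_nhds by (rule order_tendstoD(1))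
  then show ?thesis
  proof eventually_elim
    case (elim y)
    show ?case
    proof (intro impI)
      assume r: "in_range c d k y" and A: "0 < dang c d k y" "dang c d k y < d"
      have s: "sin (dang c d k y) > 0" using A d by (intro sin_gt_zero) auto
      have t: "tan ((d - dang c d k y) / 2) > 0" using A d by (intro half_tan_pos) auto
      have G: "dpos c d (Suc k) y \<ge> 0" using dpos_nonneg[OF d, of "Suc k"] r A by (auto simp: in_range_def less_Suc_eq)
      have "2 * real (Suc k) < c * dpos c d (Suc k) y"
        using elim s unfolding f_def dpos_Suc by (simp add: field_simps)
      moreover have "(2 * real (Suc k) + c * dpos c d (Suc k) y) * tan ((d - dang c d k y) / 2) > 0"
        using t G c by (intro mult_pos_pos add_pos_nonneg) auto
      ultimately show "dang c d (Suc k) y < 0"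
        unfolding dang_Suc by (simp add: divide_neg_pos)
    qed
  qed
qed

lemma exit_high:
  assumes c: "0 < c" "c < 2" and d: "0 < d" "d < pi" and x: "in_range c d k x" "dang c d k x = d"
  shows "\<forall>\<^sub>F y in nhds x. in_range c d k y \<longrightarrow> 0 < dang c d k y \<longrightarrow> dang c d k y < d \<longrightarrow> dang c d (Suc k) y > d"
proof -
  define g where "g y = (dpos c d k y * sin (d - dang c d k y) + sin d) / sin (dang c d k y)" for y
  \<comment> \<open>The condition that the argument of \<open>arctan\<close> exceeds tan(d/2),
    cleared of a denominator that vanishes at angle d. There \<open>g\<close> equals 1, so
    positivity comes down to c < 2(k + 1).\<close>
  define f where "f y = 2 * real (Suc k) - c * g y
    - tan ((d - dang c d k y) / 2) * tan (d / 2) * (2 * real (Suc k) + c * g y)" for y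
  have sd: "sin d > 0" using d by (intro sin_gt_zero)
  have "isCont f x" unfolding f_def g_def
    using diag_continuous[OF c(1) d x(1)] sd x(2) by (intro continuous_intros isCont_tan') auto
  moreover have "f x > 0"
    unfolding f_def g_def x(2) using c sd by simp
  ultimately have "\<forall>\<^sub>F y in nhds x. f y > 0"
    unfolding isCont_def tendsto_at_iff_tendsto_nhds by (rule order_tendstoD(1))
  then show ?thesis
  proof eventually_elim
    case (elim y)
    show ?case
    proof (intro impI)
      assume r: "in_range c d k y" and A: "0 < dang c d k y" "dang c d k y < d"
      have t: "tan ((d - dang c d k y) / 2) > 0" using A d by (intro half_tan_pos) auto
      have G: "dpos c d (Suc k) y \<ge> 0" using dpos_nonneg[OF d, of "Suc k"] r A by (auto simp: in_range_def less_Suc_eq)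
      have g: "g y = dpos c d (Suc k) y" unfolding g_def dpos_Suc ..
      have "(2 * real (Suc k) + c * dpos c d (Suc k) y) * tan ((d - dang c d k y) / 2) > 0"
        using t G c by (intro mult_pos_pos add_pos_nonneg) auto
      then have "tan (d / 2) < (2 * real (Suc k) - c * dpos c d (Suc k) y)
          / ((2 * real (Suc k) + c * dpos c d (Suc k) y) * tan ((d - dang c d k y) / 2))"
        using elim unfolding f_def g by (simp add: pos_less_divide_eq algebra_simps)
      then have "arctan (tan (d / 2)) < arctan ((2 * real (Suc k) - c * dpos c d (Suc k) y)
          / ((2 * real (Suc k) + c * dpos c d (Suc k) y) * tan ((d - dang c d k y) / 2)))"
        by (simp only: arctan_less_iff)
      moreover have "arctan (tan (d / 2)) = d / 2" using d by (intro arctan_tan) auto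
      ultimately show "dang c d (Suc k) y > d" unfolding dang_Suc by simp
    qed
  qed
qed

lemma eventually_in_range:
  assumes c: "0 < c" and d: "0 < d" "d < pi"
  shows "in_range c d k x \<Longrightarrow> \<forall>\<^sub>F y in nhds x. in_range c d k y"
proof (induction k)
  case (Suc k)
  then have r: "in_range c d k x" "0 < dang c d k x" "dang c d k x < d" by (auto simp: in_range_Suc)
  have "isCont (dang c d k) x" using diag_continuous[OF c d r(1)] by simp
  then have t: "(dang c d k \<longlongrightarrow> dang c d k x) (nhds x)"
    unfolding isCont_def tendsto_at_iff_tendsto_nhds .
  show ?case
    unfolding in_range_Suc using Suc.IH[OF r(1)] order_tendstoD[OF t] r by (intro eventually_conj) auto
qed (simp add: in_range_def[abs_def])

definition exits_low :: "real \<Rightarrow> real \<Rightarrow> real set" where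
  "exits_low c d = {x \<in> {0<..<d}. \<exists>k. in_range c d k x \<and> dang c d k x \<le> 0}"

definition exits_high :: "real \<Rightarrow> real \<Rightarrow> real set" where
  "exits_high c d = {x \<in> {0<..<d}. \<exists>k. in_range c d k x \<and> dang c d k x \<ge> d}"

lemma tendsto_dang:
  assumes "0 < c" "0 < d" "d < pi" "in_range c d k x"
  shows "(dang c d k \<longlongrightarrow> dang c d k x) (nhds x)"
  using diag_continuous[OF assms] unfolding isCont_def tendsto_at_iff_tendsto_nhds by simp

lemma open_exits_low:
  assumes c: "0 < c" and d: "0 < d" "d < pi"
  shows "open (exits_low c d)"
proof (subst open_subopen, intro ballI)
  fix x assume x: "x \<in> exits_low c d"
  then obtain k where k: "in_range c d k x" "dang c d k x \<le> 0" and x': "x \<in> {0<..<d}"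
    by (auto simp: exits_low_def)
  have dom: "\<forall>\<^sub>F y in nhds x. y \<in> {0<..<d}" using x' by (intro eventually_nhds_in_open) auto
  have "\<forall>\<^sub>F y in nhds x. y \<in> exits_low c d"
  proof (cases "dang c d k x < 0")
    case True
    show ?thesis
      using dom eventually_in_range[OF c d k(1)] order_tendstoD(2)[OF tendsto_dang[OF c d k(1)] True]
    proof eventually_elim
      case (elim y)
      then show ?case unfolding exits_low_def by (auto intro!: exI[of _ k])
    qed
  next
    case False
    then have z: "dang c d k x = 0" using k by simp
    have "\<forall>\<^sub>F y in nhds x. dang c d k y < d"
      using order_tendstoD(2)[OF tendsto_dang[OF c d k(1)], of d] z d by simp
    with dom eventually_in_range[OF c d k(1)] exit_low[OF c d k(1) z]
    show ?thesis
    proof eventually_elim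
      case (elim y)
      show ?case
      proof (cases "dang c d k y \<le> 0")
        case True
        then show ?thesis using elim unfolding exits_low_def by blast
      next
        case False
        then have "in_range c d (Suc k) y" "dang c d (Suc k) y \<le> 0"
          using elim by (auto simp: in_range_Suc)
        then show ?thesis using elim unfolding exits_low_def by blast
      qed
    qed
  qed
  then show "\<exists>T. open T \<and> x \<in> T \<and> T \<subseteq> exits_low c d"
    unfolding eventually_nhds by auto
qed

lemma open_exits_high:
  assumes c: "0 < c" "c < 2" and d: "0 < d" "d < pi"
  shows "open (exits_high c d)"
proof (subst open_subopen, intro ballI)
  fix x assume x: "x \<in> exits_high c d"
  then obtain k where k: "in_range c d k x" "dang c d k x \<ge> d" and x': "x \<in> {0<..<d}"
    by (auto simp: exits_high_def)
  have dom: "\<forall>\<^sub>F y in nhds x. y \<in> {0<..<d}" using x' by (intro eventually_nhds_in_open) auto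
  have "\<forall>\<^sub>F y in nhds x. y \<in> exits_high c d"
  proof (cases "dang c d k x > d")
    case True
    show ?thesis
      using dom eventually_in_range[OF c(1) d k(1)] order_tendstoD(1)[OF tendsto_dang[OF c(1) d k(1)] True]
    proof eventually_elim
      case (elim y)
      then show ?case unfolding exits_high_def by (auto intro!: exI[of _ k])
    qed
  next
    case False
    then have z: "dang c d k x = d" using k by simp
    have "\<forall>\<^sub>F y in nhds x. dang c d k y > 0"
      using order_tendstoD(1)[OF tendsto_dang[OF c(1) d k(1)], of 0] z d by simp
    with dom eventually_in_range[OF c(1) d k(1)] exit_high[OF c d k(1) z]
    show ?thesis
    proof eventually_elim
      case (elim y)
      show ?case
      proof (cases "dang c d k y \<ge> d")
        case True
        then show ?thesis using elim unfolding exits_high_def by blast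
      next
        case False
        then have "in_range c d (Suc k) y" "dang c d (Suc k) y \<ge> d"
          using elim by (auto simp: in_range_Suc)
        then show ?thesis using elim unfolding exits_high_def by blast
      qed
    qed
  qed
  then show "\<exists>T. open T \<and> x \<in> T \<and> T \<subseteq> exits_high c d"
    unfolding eventually_nhds by auto
qed

lemma exits_disjoint: "0 < d \<Longrightarrow> exits_low c d \<inter> exits_high c d = {}"
proof (rule ccontr)
  assume d: "0 < d" and "exits_low c d \<inter> exits_high c d \<noteq> {}"
  then obtain x j k where r: "in_range c d j x" "in_range c d k x" and jk: "dang c d j x \<le> 0" "dang c d k x \<ge> d"
    unfolding exits_low_def exits_high_def by blast
  consider "j < k" | "k < j" | "j = k" by linarith
  then show False
  proof cases
    case 1
    then have "0 < dang c d j x" using r(2) unfolding in_range_def by blast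
    then show False using jk by simp
  next
    case 2
    then have "dang c d k x < d" using r(1) unfolding in_range_def by blast
    then show False using jk by simp
  qed (use jk d in simp)
qed

lemma exits_cover: "{0<..<d} - good_angles c d = exits_low c d \<union> exits_high c d"
proof
  show "{0<..<d} - good_angles c d \<subseteq> exits_low c d \<union> exits_high c d"
  proof
    fix x assume x: "x \<in> {0<..<d} - good_angles c d"
    then have ex: "\<exists>k. \<not> (0 < dang c d k x \<and> dang c d k x < d)" by (auto simp: good_angles_def)
    define k where "k = (LEAST k. \<not> (0 < dang c d k x \<and> dang c d k x < d))"
    have "\<not> (0 < dang c d k x \<and> dang c d k x < d)" unfolding k_def by (rule LeastI_ex[OF ex])
    moreover have "in_range c d k x" unfolding in_range_def k_def using not_less_Least by blast
    ultimately show "x \<in> exits_low c d \<union> exits_high c d"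
      using x not_less unfolding exits_low_def exits_high_def by blast
  qed
  have "x \<notin> good_angles c d" if "dang c d k x \<le> 0 \<or> d \<le> dang c d k x" for x k
    using that not_less unfolding good_angles_def by blast
  then show "exits_low c d \<union> exits_high c d \<subseteq> {0<..<d} - good_angles c d"
    unfolding exits_low_def exits_high_def by blast
qed

text \<open>Without good angles the connected interval would split into two disjoint open sets, both
  nonempty.\<close>

lemma ex_good_angle:
  assumes c: "0 < c" "c < 2" and d: "0 < d" "d < pi"
  shows "good_angles c d \<noteq> {}"
proof
  assume empty: "good_angles c d = {}"
  have low: "exits_low c d \<noteq> {}"
  proof -
    \<comment> \<open>The exit lemma is applied at the excluded endpoint itself: being in range
      before step 0 is vacuous, and the starting angle 0 counts as a hit.\<close>
    have "\<forall>\<^sub>F y in nhds 0. 0 < y \<longrightarrow> y < d \<longrightarrow> dang c d 1 y < 0"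
      using exit_low[OF c(1) d, of 0 0] by (simp add: in_range_def)
    then obtain e where e: "e > 0" "\<And>y. dist y 0 < e \<Longrightarrow> 0 < y \<Longrightarrow> y < d \<Longrightarrow> dang c d 1 y < 0"
      unfolding eventually_nhds_metric by blast
    define y where "y = min d e / 2"
    have y: "dist y 0 < e" "0 < y" "y < d" using e(1) d by (auto simp: y_def)
    then have "in_range c d 1 y" "dang c d 1 y \<le> 0" "y \<in> {0<..<d}"
      using e(2)[OF y] by (simp_all add: in_range_def)
    then show ?thesis unfolding exits_low_def by blast
  qed
  have high: "exits_high c d \<noteq> {}"
  proof -
    have "\<forall>\<^sub>F y in nhds d. 0 < y \<longrightarrow> y < d \<longrightarrow> dang c d 1 y > d"
      using exit_high[OF c d, of 0 d] by (simp add: in_range_def)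
    then obtain e where e: "e > 0" "\<And>y. dist y d < e \<Longrightarrow> 0 < y \<Longrightarrow> y < d \<Longrightarrow> dang c d 1 y > d"
      unfolding eventually_nhds_metric by blast
    define y where "y = d - min d e / 2"
    have y: "dist y d < e" "0 < y" "y < d" using e(1) d by (auto simp: y_def dist_real_def)
    then have "in_range c d 1 y" "dang c d 1 y \<ge> d" "y \<in> {0<..<d}"
      using e(2)[OF y] by (simp_all add: in_range_def)
    then show ?thesis unfolding exits_high_def by blast
  qed
  have cover: "{0<..<d} = exits_low c d \<union> exits_high c d" using exits_cover[of d c] empty by simp
  have "connected {0<..<d}" by (rule connected_Ioo)
  from connectedD[OF this open_exits_low[OF c(1) d] open_exits_high[OF c d]]
  show False using cover low high exits_disjoint[OF d(1), of c] by auto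
qed

lemma good_angles_limit:
  assumes c: "0 < c" "c < 2" and d: "0 < d" "d < pi"
    and X: "\<And>n. X n \<in> good_angles c d" "X \<longlonglongrightarrow> L" and L: "0 < L" "L < d"
  shows "L \<in> good_angles c d"
proof (rule ccontr)
  assume "L \<notin> good_angles c d"
  then have "L \<in> exits_low c d \<union> exits_high c d"
    using L unfolding exits_cover[symmetric] by simp
  moreover have "open (exits_low c d \<union> exits_high c d)"
    by (intro open_Un open_exits_low open_exits_high c d)
  ultimately have "\<forall>\<^sub>F n in sequentially. X n \<in> exits_low c d \<union> exits_high c d"
    by (rule topological_tendstoD[OF X(2), rotated])
  then obtain n where "X n \<in> exits_low c d \<union> exits_high c d"
    unfolding eventually_sequentially by (meson order_refl)
  then show False using X(1)[of n] unfolding exits_cover[symmetric] by simp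
qed

text \<open>The inequalities unfold 0 < A and A < d for the angle A after one step, where
  \<open>dpos\<close> is sin d / sin x. In the second one tan((d - x)/2) is enlarged to tan(d/2), so
  that x occurs only through sin x.\<close>

lemma good_angle_bounds:
  assumes c: "0 < c" "c < 2" and d: "0 < d" "d < pi" and x: "x \<in> good_angles c d"
  shows "c * sin d < 2 * sin x" "2 * sin x - c * sin d < (tan (d / 2))\<^sup>2 * (2 * sin x + c * sin d)"
proof -
  have xd: "0 < x" "x < d" using x good_anglesD by auto
  have D: "0 < dang c d 1 x" "dang c d 1 x < d" using x by (auto simp: good_angles_def)
  have s: "sin x > 0" "sin d > 0" using xd d by (auto intro!: sin_gt_zero)
  have t: "tan ((d - x) / 2) > 0" "tan (d / 2) > 0" "tan ((d - x) / 2) < tan (d / 2)"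
    using xd d by (auto intro!: half_tan_pos tan_monotone)
  define q where "q = (2 * sin x - c * sin d) / ((2 * sin x + c * sin d) * tan ((d - x) / 2))"
  have den: "(2 * sin x + c * sin d) > 0" using s c by (auto intro!: add_pos_pos)
  have "q = (2 - c * (sin d / sin x)) / ((2 + c * (sin d / sin x)) * tan ((d - x) / 2))"
  proof -
    have "2 - c * (sin d / sin x) = (2 * sin x - c * sin d) / sin x" "2 + c * (sin d / sin x) = (2 * sin x + c * sin d) / sin x"
      using s by (auto simp: field_simps)
    then show ?thesis unfolding q_def using s by simp
  qed
  then have A: "dang c d 1 x = 2 * arctan q"
    using dang_Suc[of c d 0 x] dpos_Suc[of c d 0 x] by simp
  then have "q > 0" using D by simp
  moreover have dt: "(2 * sin x + c * sin d) * tan ((d - x) / 2) > 0" using den t by simp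
  ultimately show "c * sin d < 2 * sin x" unfolding q_def
    by (metis diff_gt_0_iff_gt less_asym' zero_less_divide_iff)
  have "arctan q < d / 2" using A D by simp
  then have "tan (arctan q) < tan (d / 2)" using d arctan_lbound[of q] by (intro tan_monotone) auto
  then have "q < tan (d / 2)" by (simp add: tan_arctan)
  then have "2 * sin x - c * sin d < tan (d / 2) * ((2 * sin x + c * sin d) * tan ((d - x) / 2))"
    unfolding q_def using den t by (simp add: pos_divide_less_eq)
  also have "\<dots> < tan (d / 2) * ((2 * sin x + c * sin d) * tan (d / 2))"
    using t den by (intro mult_strict_left_mono) auto
  finally show "2 * sin x - c * sin d < (tan (d / 2))\<^sup>2 * (2 * sin x + c * sin d)"
    by (simp add: power2_eq_square algebra_simps)
qed

section \<open>Three directions\<close>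

definition con3 :: "(nat \<Rightarrow> nat \<Rightarrow> nat \<Rightarrow> complex) \<Rightarrow> nat \<Rightarrow> nat \<Rightarrow> nat \<Rightarrow> complex" where
  "con3 w k l n = of_nat k * rdiff (w (Suc k) l n) (w (k - 1) l n)
     + of_nat l * rdiff (w k (Suc l) n) (w k (l - 1) n)
     + of_nat n * rdiff (w k l (Suc n)) (w k l (n - 1))"

definition pos3 :: "complex \<Rightarrow> complex \<Rightarrow> complex \<Rightarrow> (nat \<Rightarrow> nat \<Rightarrow> nat \<Rightarrow> complex) \<Rightarrow> nat \<Rightarrow> nat \<Rightarrow> nat \<Rightarrow> complex" where
  "pos3 v1 v2 v3 w k l n = 2 * (of_nat k * v1 * w k l n * hmean (w (Suc k) l n) (w (k - 1) l n)
     + of_nat l * v2 * w k l n * hmean (w k (Suc l) n) (w k (l - 1) n)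
     + of_nat n * v3 * w k l n * hmean (w k l (Suc n)) (w k l (n - 1)))"

lemma edge_identity_cross:
  assumes "b \<noteq> 0 \<Longrightarrow> hir u v W W' a a'" "b \<noteq> 0 \<Longrightarrow> hir u v m m' W W'"
    "b \<noteq> 0 \<Longrightarrow> a + m \<noteq> 0" "b \<noteq> 0 \<Longrightarrow> a' + m' \<noteq> 0"
  shows "2 * v * (of_nat b * W' * hmean a' m' - of_nat b * W * hmean a m)
     = u * W * W' * (of_nat b * rdiff a' m' + of_nat b * rdiff a m)"
proof (cases "b = 0")
  case False
  then have "2 * v * (W' * hmean a' m' - W * hmean a m) = u * W * W' * (rdiff a' m' + rdiff a m)"
    using edge_identity assms by blast
  then have "of_nat b * (2 * v * (W' * hmean a' m' - W * hmean a m)) = of_nat b * (u * W * W' * (rdiff a' m' + rdiff a m))"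
    by simp
  then show ?thesis by (simp add: algebra_simps)
qed simp

text \<open>Just what the edge identities use, without positivity or a choice of axis values;
  permuting the coordinates then turns \<open>edge1\<close> into the other two directions.\<close>

locale lattice3 =
  fixes v1 v2 v3 :: complex and w :: "nat \<Rightarrow> nat \<Rightarrow> nat \<Rightarrow> complex"
  assumes face12: "hir v1 v2 (w k l n) (w (Suc k) l n) (w k (Suc l) n) (w (Suc k) (Suc l) n)"
    and face13: "hir v1 v3 (w k l n) (w (Suc k) l n) (w k l (Suc n)) (w (Suc k) l (Suc n))"
    and face23: "hir v2 v3 (w k l n) (w k (Suc l) n) (w k l (Suc n)) (w k (Suc l) (Suc n))"
    and sum1: "w (Suc (Suc k)) l n + w k l n \<noteq> 0"
    and sum2: "w k (Suc (Suc l)) n + w k l n \<noteq> 0"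
    and sum3: "w k l (Suc (Suc n)) + w k l n \<noteq> 0"
begin

lemma edge1: "pos3 v1 v2 v3 w (Suc k) l n - pos3 v1 v2 v3 w k l n
    = v1 * w k l n * w (Suc k) l n * (con3 w (Suc k) l n + con3 w k l n + 1)"
proof -
  have "2 * v1 * (of_nat (Suc k) * w (Suc k) l n * hmean (w (Suc (Suc k)) l n) (w k l n)
      - of_nat k * w k l n * hmean (w (Suc k) l n) (w (k - 1) l n))
    = v1 * w k l n * w (Suc k) l n * (of_nat (Suc k) * rdiff (w (Suc (Suc k)) l n) (w k l n)
      + of_nat k * rdiff (w (Suc k) l n) (w (k - 1) l n) + 1)"
    using sum1[of k l n] sum1[of "k - 1" l n] by (intro edge_identity_same) auto
  moreover have "2 * v2 * (of_nat l * w (Suc k) l n * hmean (w (Suc k) (Suc l) n) (w (Suc k) (l - 1) n)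
      - of_nat l * w k l n * hmean (w k (Suc l) n) (w k (l - 1) n))
    = v1 * w k l n * w (Suc k) l n * (of_nat l * rdiff (w (Suc k) (Suc l) n) (w (Suc k) (l - 1) n)
      + of_nat l * rdiff (w k (Suc l) n) (w k (l - 1) n))"
    using face12[of k l n] face12[of k "l - 1" n] sum2[of k "l - 1" n] sum2[of "Suc k" "l - 1" n]
    by (intro edge_identity_cross) auto
  moreover have "2 * v3 * (of_nat n * w (Suc k) l n * hmean (w (Suc k) l (Suc n)) (w (Suc k) l (n - 1))
      - of_nat n * w k l n * hmean (w k l (Suc n)) (w k l (n - 1)))
    = v1 * w k l n * w (Suc k) l n * (of_nat n * rdiff (w (Suc k) l (Suc n)) (w (Suc k) l (n - 1))
      + of_nat n * rdiff (w k l (Suc n)) (w k l (n - 1)))"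
    using face13[of k l n] face13[of k l "n - 1"] sum3[of k l "n - 1"] sum3[of "Suc k" l "n - 1"]
    by (intro edge_identity_cross) auto
  ultimately show ?thesis unfolding pos3_def con3_def by (simp add: algebra_simps)
qed

lemma swap12: "lattice3 v2 v1 v3 (\<lambda>l k n. w k l n)"
  by unfold_locales (rule face12[THEN hir_swap[THEN iffD1]] face13 face23 sum1 sum2 sum3)+

lemma swap13: "lattice3 v3 v2 v1 (\<lambda>n l k. w k l n)"
  by unfold_locales (rule face12[THEN hir_swap[THEN iffD1]] face13[THEN hir_swap[THEN iffD1]]
      face23[THEN hir_swap[THEN iffD1]] sum1 sum2 sum3)+

lemma edge2: "pos3 v1 v2 v3 w k (Suc l) n - pos3 v1 v2 v3 w k l n
    = v2 * w k l n * w k (Suc l) n * (con3 w k (Suc l) n + con3 w k l n + 1)"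
  using lattice3.edge1[OF swap12, of l k n] unfolding pos3_def con3_def by (simp add: algebra_simps)

lemma edge3: "pos3 v1 v2 v3 w k l (Suc n) - pos3 v1 v2 v3 w k l n
    = v3 * w k l n * w k l (Suc n) * (con3 w k l (Suc n) + con3 w k l n + 1)"
  using lattice3.edge1[OF swap13, of n l k] unfolding pos3_def con3_def by (simp add: algebra_simps)

end

section \<open>Two neighbouring quarter planes spanning an octant\<close>

lemma axis_gauge: "(\<lambda>n. (if even n then 1 else e) * axis_val c e' n) = axis_val c (e * e')"
  by (auto simp: axis_val_def)

lemma plane_gauge:
  "fill (l * cis (- d / 2)) (l * cis (d / 2)) (axis_val c (e * cis (d / 2 - x))) (axis_val c (e * cis (x - d / 2))) a b
   = (if even (a + b) then 1 else e) * wdiag c d x a b" if "l \<noteq> 0" "e \<noteq> 0"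
  using fill_gauge[OF that, of "axis_val c (cis (d / 2 - x))" "axis_val c (cis (x - d / 2))"]
  unfolding axis_gauge wdiag_def by simp

text \<open>Direction 3 lies between the other two, at angle t1 from direction 1 and t2 from
  direction 2. The odd values \<open>e1\<close>, \<open>e3\<close>, \<open>e2\<close> put the first
  points of the axes at arguments - 2 x1, 0 and 2 x2.\<close>

locale sector3 =
  fixes c t1 t2 x1 x2 :: real
  assumes c: "0 < c" "c < 2" and t: "0 < t1" "0 < t2" "t1 + t2 < pi"
    and x1: "x1 \<in> good_angles c t1" and x2: "x2 \<in> good_angles c t2"
begin

abbreviation "v1 \<equiv> cis (- t1)"
abbreviation "v2 \<equiv> cis t2"
abbreviation "v3 \<equiv> cis 0"
abbreviation "e1 \<equiv> cis (t1 - 2 * x1)"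
abbreviation "e2 \<equiv> cis (2 * x2 - t2)"
abbreviation "e3 \<equiv> cis 0"

definition plane13 :: "nat \<Rightarrow> nat \<Rightarrow> complex" where
  "plane13 = fill v1 v3 (axis_val c e1) (axis_val c e3)"

definition plane32 :: "nat \<Rightarrow> nat \<Rightarrow> complex" where
  "plane32 = fill v3 v2 (axis_val c e3) (axis_val c e2)"

text \<open>Each layer n is filled from its traces on the two given planes, so the definition speaks
  only of faces in directions 1 and 2. All other faces must come from the consistency of the
  cubes.\<close>

definition w :: "nat \<Rightarrow> nat \<Rightarrow> nat \<Rightarrow> complex" where
  "w k l n = fill v1 v2 (\<lambda>k. plane13 k n) (\<lambda>l. plane32 n l) k l"

lemma plane13_gauge: "plane13 a b = (if even (a + b) then 1 else cis (t1 / 2 - x1)) * wdiag c t1 x1 a b"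
proof -
  have "cis (- t1 / 2) * cis (- t1 / 2) = v1" "cis (- t1 / 2) * cis (t1 / 2) = v3"
    "cis (t1 / 2 - x1) * cis (t1 / 2 - x1) = e1" "cis (t1 / 2 - x1) * cis (x1 - t1 / 2) = e3"
    unfolding cis_mult by (rule arg_cong[of _ _ cis], linarith)+
  then show ?thesis
    unfolding plane13_def using plane_gauge[of "cis (- t1 / 2)" "cis (t1 / 2 - x1)" t1 c x1 a b] by simp
qed

lemma plane32_gauge: "plane32 a b = (if even (a + b) then 1 else cis (x2 - t2 / 2)) * wdiag c t2 x2 a b"
proof -
  have "cis (t2 / 2) * cis (- t2 / 2) = v3" "cis (t2 / 2) * cis (t2 / 2) = v2"
    "cis (x2 - t2 / 2) * cis (t2 / 2 - x2) = e3" "cis (x2 - t2 / 2) * cis (x2 - t2 / 2) = e2"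
    unfolding cis_mult by (rule arg_cong[of _ _ cis], linarith)+
  then show ?thesis
    unfolding plane32_def using plane_gauge[of "cis (t2 / 2)" "cis (x2 - t2 / 2)" t2 c x2 a b] by simp
qed

lemma v_sq: "v1\<^sup>2 \<noteq> v3\<^sup>2" "v3\<^sup>2 \<noteq> v2\<^sup>2" "v1\<^sup>2 \<noteq> v2\<^sup>2"
  by (rule cis_sq_ne; use t in simp)+

lemma pattern13:
  assumes "even N"
  shows "pattern2 c v1 v3 plane13 N e1 e3"
proof -
  have p: "circ_val 0 (plane13 a b)" if "even (a + b)" for a b
    using good_angles_positive[OF c _ _ x1 that] t that unfolding plane13_gauge by simp
  show ?thesis
    by unfold_locales (use c v_sq p assms in \<open>auto simp: plane13_def fill_0_left\<close>)
qed

lemma pattern32: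
  assumes "even N"
  shows "pattern2 c v3 v2 plane32 N e3 e2"
proof -
  have p: "circ_val 0 (plane32 a b)" if "even (a + b)" for a b
    using good_angles_positive[OF c _ _ x2 that] t that unfolding plane32_gauge by simp
  show ?thesis
    by unfold_locales (use c v_sq p assms in \<open>auto simp: plane32_def fill_0_left\<close>)
qed

lemma plane_common: "plane13 0 n = plane32 n 0"
  by (simp add: plane13_def plane32_def fill_0_left)

lemma w_l0 [simp]: "w k 0 n = plane13 k n"
  by (simp add: w_def)

lemma w_k0 [simp]: "w 0 l n = plane32 n l"
  by (simp add: w_def fill_0_left plane_common)

lemma w_step: "w (Suc k) (Suc l) n = hstep v1 v2 (w k l n) (w (Suc k) l n) (w k (Suc l) n)"
  by (simp add: w_def)

text \<open>Everything is quantified over n inside the induction because positivity at layer n draws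
  on radii at layer n + 1. Faces are indexed by a corner ahead, whence the guards at index
  0.\<close>

lemma w_main:
  "(\<forall>n. circ_val (k + l + n) (w k l n)) \<and>
   (k \<noteq> 0 \<longrightarrow> (\<forall>n. hir v1 v3 (w (k - 1) l n) (w k l n) (w (k - 1) l (Suc n)) (w k l (Suc n)))) \<and>
   (l \<noteq> 0 \<longrightarrow> (\<forall>n. hir v2 v3 (w k (l - 1) n) (w k l n) (w k (l - 1) (Suc n)) (w k l (Suc n)))) \<and>
   (k \<noteq> 0 \<longrightarrow> l \<noteq> 0 \<longrightarrow> (\<forall>n. hir v1 v2 (w (k - 1) (l - 1) n) (w k (l - 1) n) (w (k - 1) l n) (w k l n)))"
proof (induction k l rule: nat2_induct)
  case (left k)
  have "circ_val (k + n) (plane13 k n)" for n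
    by (rule pattern2.val[OF pattern13[of "2 * (k + n)"]]) auto
  moreover have "hir v1 v3 (plane13 (k - 1) n) (plane13 k n) (plane13 (k - 1) (Suc n)) (plane13 k (Suc n))" if "k \<noteq> 0" for n
    using pattern2.face(2)[OF pattern13[of "2 * (k + n)"], of "k - 1" n] that by auto
  ultimately show ?case by simp
next
  case (right l)
  have "circ_val (n + Suc l) (plane32 n (Suc l))" for n
    by (rule pattern2.val[OF pattern32[of "2 * (n + Suc l)"]]) auto
  moreover have "hir v2 v3 (plane32 n l) (plane32 n (Suc l)) (plane32 (Suc n) l) (plane32 (Suc n) (Suc l))" for n
    by (rule pattern2.face(2)[OF pattern32[of "2 * (n + Suc l)"], THEN hir_swap[THEN iffD1]]) auto
  ultimately show ?case by (simp add: add.commute)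
next
  case (step k l)
  have vX: "circ_val (k + l + n) (w k l n)" and v10: "circ_val (Suc (k + l + n)) (w (Suc k) l n)"
    and v01: "circ_val (Suc (k + l + n)) (w k (Suc l) n)"
    and h13: "hir v1 v3 (w k l n) (w (Suc k) l n) (w k l (Suc n)) (w (Suc k) l (Suc n))"
    and h23: "hir v2 v3 (w k l n) (w k (Suc l) n) (w k l (Suc n)) (w k (Suc l) (Suc n))" for n
    using step(1) conjunct1[OF step(2)] conjunct1[OF step(3)] conjunct1[OF conjunct2[OF step(2)]]
      conjunct1[OF conjunct2[OF conjunct2[OF step(3)]]] by simp_all
  \<comment> \<open>If the base point is a centre, the three faces around it form the star of
    \<open>star_positive\<close>; otherwise the moduli agree by \<open>hstep_odd\<close>.\<close>
  have new: "v2 * w (Suc k) l n \<noteq> v1 * w k (Suc l) n \<and> circ_val (k + l + n) (w (Suc k) (Suc l) n)" for n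
  proof (cases "even (k + l + n)")
    case True
    have p: "circ_val 0 (w k l n)" "circ_val 0 (w (Suc k) l (Suc n))" "circ_val 0 (w k (Suc l) (Suc n))"
      using vX[of n] v10[of "Suc n"] v01[of "Suc n"] True circ_val_parity[of "k + l + n" 0]
        circ_val_parity[of "Suc (k + l + Suc n)" 0] by auto
    have "hir v3 v2 (w k l n) (w k l (Suc n)) (w k (Suc l) n) (w k (Suc l) (Suc n))" by (rule h23[THEN hir_swap[THEN iffD1]])
    from star_positive[OF h13[of n] this p(1) p(2) p(3) circ_val_nz[OF v10[of n]]]
    have "v2 * w (Suc k) l n \<noteq> v1 * w k (Suc l) n" "circ_val 0 (w (Suc k) (Suc l) n)"
      unfolding w_step using t by auto
    then show ?thesis using True circ_val_parity[of "k + l + n" 0] by simp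
  next
    case False
    have p: "circ_val 1 (w k l n)" "circ_val 0 (w (Suc k) l n)" "circ_val 0 (w k (Suc l) n)"
      using vX[of n] v10[of n] v01[of n] False circ_val_parity[of "k + l + n" 1]
        circ_val_parity[of "Suc (k + l + n)" 0] by auto
    have "v1 \<noteq> v2" using v_sq by auto
    from hstep_odd[OF p _ _ this]
    show ?thesis unfolding w_step using False circ_val_parity[of "k + l + n" 1] by simp
  qed
  have h12: "hir v1 v2 (w k l n) (w (Suc k) l n) (w k (Suc l) n) (w (Suc k) (Suc l) n)" for n
    using new[of n] by (simp add: hir_hstep_iff w_step)
  have nzs: "w k l n \<noteq> 0" "w (Suc k) l n \<noteq> 0" "w k (Suc l) n \<noteq> 0" for n
    using circ_val_nz vX v10 v01 by blast+
  have d13: "v3 * w (Suc k) l n \<noteq> v1 * w k l (Suc n)" for n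
    by (rule hir_nondeg[OF h13 v_sq(1)]) (use nzs in auto)
  have d23: "v3 * w k (Suc l) n \<noteq> v2 * w k l (Suc n)" for n
    by (rule hir_nondeg[OF h23 v_sq(2)[symmetric]]) (use nzs in auto)
  have cube: "hir v1 v3 (w k (Suc l) n) (w (Suc k) (Suc l) n) (w k (Suc l) (Suc n)) (w (Suc k) (Suc l) (Suc n))"
    "hir v2 v3 (w (Suc k) l n) (w (Suc k) (Suc l) n) (w (Suc k) l (Suc n)) (w (Suc k) (Suc l) (Suc n))" for n
    by (rule cube_consistency[OF h12 h13 h23 h12 _ d13 d23 _ nzs(1)], use new in blast, use new in blast)
      (rule cube_consistency'[OF h12 h13 h23 h12 _ d13 d23 _ nzs(1)], use new in blast, use new in blast)
  have "circ_val (Suc k + Suc l + n) (w (Suc k) (Suc l) n)" for n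
    using new[of n] circ_val_parity[of "Suc k + Suc l + n" "k + l + n"] by simp
  then show ?case using cube h12 by simp
qed

lemma w_val: "circ_val (k + l + n) (w k l n)"
  using w_main[of k l] by simp

lemma w_nz: "w k l n \<noteq> 0"
  by (rule circ_val_nz[OF w_val])

lemma w_face12: "hir v1 v2 (w k l n) (w (Suc k) l n) (w k (Suc l) n) (w (Suc k) (Suc l) n)"
  using w_main[of "Suc k" "Suc l"] by simp

lemma w_face13: "hir v1 v3 (w k l n) (w (Suc k) l n) (w k l (Suc n)) (w (Suc k) l (Suc n))"
  using w_main[of "Suc k" l] by simp

lemma w_face23: "hir v2 v3 (w k l n) (w k (Suc l) n) (w k l (Suc n)) (w k (Suc l) (Suc n))"
  using w_main[of k "Suc l"] by simp

lemma w_even: "even (k + l + n) \<Longrightarrow> circ_val 0 (w k l n)"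
  by (rule iffD1[OF circ_val_parity w_val]) simp

lemma w_even_sum: "even (k + l + n) \<Longrightarrow> even (k' + l' + n') \<Longrightarrow> w k l n + w k' l' n' \<noteq> 0"
  by (rule circ_val_even_add[OF even_zero w_even w_even])

text \<open>At odd points one moves to a parallel line of radii, one step back in either of the
  other directions; only the axis itself has none and is covered by the quarter plane.\<close>

lemma w_sum1: "w (Suc (Suc k)) l n + w k l n \<noteq> 0"
proof (cases "even (k + l + n)")
  case True
  then show ?thesis by (intro w_even_sum) auto
next
  case odd: False
  consider "l = 0" "n = 0" | l' where "l = Suc l'" | n' where "n = Suc n'"
    by (cases l; cases n) auto
  then show ?thesis
  proof cases
    case 1
    then show ?thesis using pattern2.sum_nz[OF pattern13[of "2 * Suc k"], of k 0] by simp
  next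
    case 2
    show ?thesis unfolding 2
      by (rule sum_nonzero[OF w_face12[of "Suc k" l' n] w_face12[of k l' n] w_nz w_nz w_even_sum v_sq(3)])
        (use odd 2 in auto)
  next
    case 3
    show ?thesis unfolding 3
      by (rule sum_nonzero[OF w_face13[of "Suc k" l n'] w_face13[of k l n'] w_nz w_nz w_even_sum v_sq(1)])
        (use odd 3 in auto)
  qed
qed

lemma w_sum2: "w k (Suc (Suc l)) n + w k l n \<noteq> 0"
proof (cases "even (k + l + n)")
  case True
  then show ?thesis by (intro w_even_sum) auto
next
  case odd: False
  note f12 = w_face12[THEN hir_swap[THEN iffD1]]
  consider "k = 0" "n = 0" | k' where "k = Suc k'" | n' where "n = Suc n'"
    by (cases k; cases n) auto
  then show ?thesis
  proof cases
    case 1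
    then show ?thesis
      using pattern2.sum_nz[OF pattern2.swapped[OF pattern32[of "2 * Suc l"]], of l 0] by simp
  next
    case 2
    show ?thesis unfolding 2
      by (rule sum_nonzero[OF f12[of k' "Suc l" n] f12[of k' l n] w_nz w_nz w_even_sum v_sq(3)[symmetric]])
        (use odd 2 in auto)
  next
    case 3
    show ?thesis unfolding 3
      by (rule sum_nonzero[OF w_face23[of k "Suc l" n'] w_face23[of k l n'] w_nz w_nz w_even_sum v_sq(2)[symmetric]])
        (use odd 3 in auto)
  qed
qed

lemma w_sum3: "w k l (Suc (Suc n)) + w k l n \<noteq> 0"
proof (cases "even (k + l + n)")
  case True
  then show ?thesis by (intro w_even_sum) auto
next
  case odd: False
  note f13 = w_face13[THEN hir_swap[THEN iffD1]]
  note f23 = w_face23[THEN hir_swap[THEN iffD1]]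
  consider "k = 0" "l = 0" | k' where "k = Suc k'" | l' where "l = Suc l'"
    by (cases k; cases l) auto
  then show ?thesis
  proof cases
    case 1
    then show ?thesis
      using pattern2.sum_nz[OF pattern32[of "2 * Suc n"], of n 0] by (simp add: plane_common)
  next
    case 2
    show ?thesis unfolding 2
      by (rule sum_nonzero[OF f13[of k' l "Suc n"] f13[of k' l n] w_nz w_nz w_even_sum v_sq(1)[symmetric]])
        (use odd 2 in auto)
  next
    case 3
    show ?thesis unfolding 3
      by (rule sum_nonzero[OF f23[of k l' "Suc n"] f23[of k l' n] w_nz w_nz w_even_sum v_sq(2)])
        (use odd 3 in auto)
  qed
qed

sublocale lattice3 v1 v2 v3 w
  by unfold_locales (rule w_face12 w_face13 w_face23 w_sum1 w_sum2 w_sum3)+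

text \<open>The two given planes carry it already, and the faces in directions 1 and 2 spread it
  over each layer.\<close>

lemma constraint3: "con3 w k l n = (if even (k + l + n) then 0 else of_real (c - 1))"
proof (induction k l rule: nat2_induct)
  case (left k)
  have "con2 plane13 k n = (if even (k + n) then 0 else of_real (c - 1))"
    by (rule pattern2.constraint[OF pattern13[of "2 * (k + n)"]]) auto
  then show ?case by (simp add: con3_def con2_def)
next
  case (right l)
  have "con2 plane32 n (Suc l) = (if even (n + Suc l) then 0 else of_real (c - 1))"
    by (rule pattern2.constraint[OF pattern32[of "2 * (n + Suc l)"]]) auto
  then show ?case by (simp add: con3_def con2_def add.commute del: of_nat_Suc)
next
  case (step k l)
  have "con3 w (Suc k) (Suc l) n = con3 w k l n"
  proof (rule face_closing[OF edge1 edge2 edge2 edge1 face12])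
    show "con3 w k l n + con3 w (Suc k) l n + 1 = of_real c" "con3 w k (Suc l) n = con3 w (Suc k) l n"
      using step by auto
    show "v2 * w (Suc k) l n \<noteq> v1 * w k (Suc l) n"
      by (rule hir_nondeg[OF face12 v_sq(3)]) (use w_nz in auto)
  qed (rule w_nz)
  then show ?case using step by simp
qed

lemma pos3_edges:
  "pos3 v1 v2 v3 w (Suc k) l n - pos3 v1 v2 v3 w k l n = of_real c * v1 * w k l n * w (Suc k) l n"
  "pos3 v1 v2 v3 w k (Suc l) n - pos3 v1 v2 v3 w k l n = of_real c * v2 * w k l n * w k (Suc l) n"
  "pos3 v1 v2 v3 w k l (Suc n) - pos3 v1 v2 v3 w k l n = of_real c * v3 * w k l n * w k l (Suc n)"
  unfolding edge1 edge2 edge3 constraint3 by (auto simp: algebra_simps)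

text \<open>The layer n = 0 is a quarter plane of angle t1 + t2 whose radii are positive as values
  of the octant; positivity of the whole pattern brings its angle back to the recursion.\<close>

lemma good_angles_add: "x1 + x2 \<in> good_angles c (t1 + t2)"
proof -
  define d x where "d = t1 + t2" "x = x1 + x2"
  \<comment> \<open>A square root of \<open>e1 * e2\<close>; dividing the odd values by it makes the
    axis values conjugate to each other, as in \<open>wdiag\<close>.\<close>
  define e where "e = cis ((t1 - t2) / 2 + x2 - x1)"
  have xs: "0 < x1" "x1 < t1" "0 < x2" "x2 < t2" using x1 x2 good_anglesD by auto
  have eqs: "cis ((t2 - t1) / 2) * cis (- d / 2) = v1" "cis ((t2 - t1) / 2) * cis (d / 2) = v2"
    "e * cis (d / 2 - x) = e1" "e * cis (x - d / 2) = e2"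
    unfolding cis_mult d_x_def e_def by (rule arg_cong[of _ _ cis], simp add: field_simps)+
  have "(\<lambda>k. plane13 k 0) = axis_val c e1" by (rule ext) (simp add: plane13_def)
  moreover have "(\<lambda>l. plane32 0 l) = axis_val c e2" by (rule ext) (simp add: plane32_def fill_0_left)
  ultimately have "w a b 0 = (if even (a + b) then 1 else e) * wdiag c d x a b" for a b
    using plane_gauge[of "cis ((t2 - t1) / 2)" e d c x a b] unfolding eqs w_def by (simp add: e_def)
  then have "circ_val 0 (wdiag c d x a b)" if "even (a + b)" for a b
    using w_val[of a b 0] that circ_val_parity[of "a + b" 0] by simp
  then show ?thesis
    unfolding d_x_def[symmetric] by (intro positive_good_angles) (use c t xs in \<open>auto simp: d_x_def\<close>)
qed

end

section \<open>Halving the angle\<close>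

lemma good_angles_pow2:
  assumes c: "0 < c" "c < 2" and d: "0 < d" "d < pi"
  shows "x \<in> good_angles c (d / 2 ^ n) \<Longrightarrow> 2 ^ n * x \<in> good_angles c d"
proof (induction n arbitrary: x)
  case (Suc n)
  define t where "t = d / 2 ^ Suc n"
  have "(1::real) \<le> 2 ^ n" by simp
  then have "d / 2 ^ n \<le> d" using d by (simp add: divide_simps)
  moreover have "t + t = d / 2 ^ n" by (simp add: t_def)
  ultimately have t: "0 < t" "t + t < pi"
    using d by (auto simp: t_def)
  have "sector3 c t t x x" using c t Suc.prems by unfold_locales (auto simp: t_def)
  then have "x + x \<in> good_angles c (t + t)" by (rule sector3.good_angles_add)
  also have "t + t = d / 2 ^ n" by (simp add: t_def)
  finally have "2 ^ n * (x + x) \<in> good_angles c d" by (rule Suc.IH)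
  then show ?case by (simp add: algebra_simps)
qed simp

text \<open>Turns the bounds on sin x into bounds on x by x cos h \<le> sin x \<le> x on (0, h); the
  two sides agree asymptotically as h tends to 0.\<close>

lemma sandwich_good_angle:
  assumes c: "0 < c" "c < 2" and h: "0 < h" "h < pi / 2" and T: "(tan (h / 2))\<^sup>2 < 1"
    and x: "x \<in> good_angles c h"
  shows "c / 2 * sin h \<le> x"
    and "x \<le> c / 2 * sin h * ((1 + (tan (h / 2))\<^sup>2) / ((1 - (tan (h / 2))\<^sup>2) * cos h))"
proof -
  define T where "T = (tan (h / 2))\<^sup>2"
  have hp: "h < pi" using h pi_gt_zero by linarith
  have xh: "0 < x" "x < h" using x good_anglesD by auto
  note b = good_angle_bounds[OF c h(1) hp x, folded T_def]
  have "sin x \<le> x" using xh by (intro sin_x_le_x) auto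
  then show "c / 2 * sin h \<le> x" using b(1) by simp
  have cosh: "cos h > 0" using h by (intro cos_gt_zero) auto
  obtain z where z: "0 < z" "z < x" "sin x - sin 0 = (x - 0) * cos z"
    using MVT2[of 0 x sin cos] xh DERIV_sin by blast
  have "cos h \<le> cos z" using z xh hp by (intro cos_monotone_0_pi_le) auto
  then have "x * cos h \<le> sin x" using z xh by simp
  moreover have "2 * sin x * (1 - T) \<le> c * sin h * (1 + T)" using b(2) by (simp add: algebra_simps)
  moreover have "1 - T > 0" using T by (simp add: T_def)
  ultimately have "2 * (x * cos h) * (1 - T) \<le> c * sin h * (1 + T)"
    by (meson mult_left_mono mult_right_mono order_trans less_imp_le zero_le_numeral)
  then show "x \<le> c / 2 * sin h * ((1 + (tan (h / 2))\<^sup>2) / ((1 - (tan (h / 2))\<^sup>2) * cos h))"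
    unfolding T_def[symmetric] using \<open>1 - T > 0\<close> cosh by (simp add: pos_le_divide_eq algebra_simps)
qed

lemma half_in_good_angles:
  assumes c: "0 < c" "c < 2" and d: "0 < d" "d < pi"
  shows "c * d / 2 \<in> good_angles c d"
proof -
  define h where "h n = d / 2 ^ n" for n :: nat
  have h: "0 < h n" "h n < pi" for n
  proof -
    show "0 < h n" using d by (simp add: h_def)
    have "(1::real) \<le> 2 ^ n" by simp
    then have "h n \<le> d" using d by (simp add: h_def divide_simps)
    then show "h n < pi" using d by simp
  qed
  have "\<exists>x. x \<in> good_angles c (h n)" for n
    using ex_good_angle[OF c h] by blast
  then obtain X where X: "\<And>n. X n \<in> good_angles c (h n)" by metis
  \<comment> \<open>The good angles at the small scales are arbitrary; doubling n times brings them
    to the fixed angle d, where their limit can be taken.\<close>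
  define Y where "Y n = 2 ^ n * X n" for n
  have Y: "Y n \<in> good_angles c d" for n
    unfolding Y_def using good_angles_pow2[OF c d] X unfolding h_def by blast
  have h0: "h \<longlonglongrightarrow> 0"
    unfolding h_def using LIMSEQ_divide_realpow_zero[of 2 d] by simp
  then have "filterlim h (at 0) sequentially"
    unfolding filterlim_at using h(1) by (auto intro!: always_eventually simp: less_imp_neq[symmetric])
  moreover have "((\<lambda>t::real. sin t / t) \<longlongrightarrow> 1) (at 0)"
    using DERIV_sin[of "0::real"] by (simp add: DERIV_def)
  ultimately have s: "(\<lambda>n. sin (h n) / h n) \<longlonglongrightarrow> 1"
    by (rule filterlim_compose[rotated])
  have lo: "(\<lambda>n. c * d / 2 * (sin (h n) / h n)) \<longlonglongrightarrow> c * d / 2"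
    using tendsto_mult[OF tendsto_const s, of "c * d / 2"] by simp
  have T0: "(\<lambda>n. (tan (h n / 2))\<^sup>2) \<longlonglongrightarrow> 0"
  proof -
    have "(\<lambda>n. h n / 2) \<longlonglongrightarrow> 0" using tendsto_divide[OF h0 tendsto_const[of 2]] by simp
    then have "(\<lambda>n. tan (h n / 2)) \<longlonglongrightarrow> 0"
      using isCont_tendsto_compose[of 0 tan "\<lambda>n. h n / 2"] by simp
    from tendsto_power[OF this, of 2] show ?thesis by simp
  qed
  have "(\<lambda>n. (1 + (tan (h n / 2))\<^sup>2) / ((1 - (tan (h n / 2))\<^sup>2) * cos (h n))) \<longlonglongrightarrow> (1 + 0) / ((1 - 0) * cos 0)"
    by (intro tendsto_intros T0 h0) auto
  then have hi: "(\<lambda>n. c * d / 2 * (sin (h n) / h n) * ((1 + (tan (h n / 2))\<^sup>2) / ((1 - (tan (h n / 2))\<^sup>2) * cos (h n)))) \<longlonglongrightarrow> c * d / 2"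
    using tendsto_mult[OF lo] by fastforce
  have ev: "\<forall>\<^sub>F n in sequentially. h n < pi / 2 \<and> (tan (h n / 2))\<^sup>2 < 1"
    using order_tendstoD(2)[OF h0, of "pi / 2"] order_tendstoD(2)[OF T0, of 1] by (auto intro: eventually_conj)
  \<comment> \<open>Since \<open>2 ^ n * h n = d\<close>, bounds for \<open>X n\<close> at scale
    \<open>h n\<close> become bounds for \<open>Y n\<close> independent of n up to factors tending
    to 1.\<close>
  have sc: "c * d / 2 * (sin (h n) / h n) = 2 ^ n * (c / 2 * sin (h n))" for n
    using d by (simp add: h_def)
  have "Y \<longlonglongrightarrow> c * d / 2"
  proof (rule tendsto_sandwich[OF _ _ lo hi])
    show "\<forall>\<^sub>F n in sequentially. c * d / 2 * (sin (h n) / h n) \<le> Y n"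
      using ev
    proof eventually_elim
      case (elim n)
      then show ?case unfolding sc Y_def using sandwich_good_angle(1)[OF c h(1) _ _ X] by simp
    qed
    show "\<forall>\<^sub>F n in sequentially. Y n \<le> c * d / 2 * (sin (h n) / h n) * ((1 + (tan (h n / 2))\<^sup>2) / ((1 - (tan (h n / 2))\<^sup>2) * cos (h n)))"
      using ev
    proof eventually_elim
      case (elim n)
      show ?case unfolding sc Y_def mult.assoc
        by (intro mult_left_mono) (use sandwich_good_angle(2)[OF c h(1) _ _ X] elim in \<open>auto simp: mult.assoc\<close>)
    qed
  qed
  then show ?thesis
    by (rule good_angles_limit[OF c d Y]) (use c d in auto)
qed

section \<open>The map on Q\<close>

lemma hir_scale: "hir u v w w1 w2 w12 \<Longrightarrow> hir (l * u) (l * v) w w1 w2 w12"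
  unfolding hir_def by algebra

text \<open>Every corner value occurs equally often above and below in q, so only the directions
  survive. The two diagonals are nonzero because u^2 and v^2 differ.\<close>

lemma hir_q_eq:
  assumes h: "hir u v w w1 w2 w12" and e: "z1 - z = u * w * w1" "z2 - z = v * w * w2"
    "z12 - z1 = v * w1 * w12" "z12 - z2 = u * w2 * w12"
    and nz: "w \<noteq> 0" "w1 \<noteq> 0" "w2 \<noteq> 0" "w12 \<noteq> 0" "u \<noteq> 0" "v \<noteq> 0" and uv: "u\<^sup>2 \<noteq> v\<^sup>2"
  shows "q_eq z z1 z12 z2 (u\<^sup>2 / v\<^sup>2)"
proof -
  have "u * w + v * w12 \<noteq> 0"
  proof
    assume a: "u * w + v * w12 = 0"
    then have "w2 * (v * w + u * w12) = 0" using h unfolding hir_def by simp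
    then have "v * w + u * w12 = 0" using nz by simp
    then have "(u\<^sup>2 - v\<^sup>2) * w = 0" using a by algebra
    then show False using uv nz by simp
  qed
  moreover have "z12 - z = w1 * (u * w + v * w12)" using e(1,3) by algebra
  ultimately have d1: "z12 \<noteq> z" using nz by auto
  have "v * w1 - u * w2 \<noteq> 0" using hir_nondeg[OF h uv] nz by simp
  moreover have "w12 * (v * w1 - u * w2) = w * (v * w2 - u * w1)" using h unfolding hir_def by algebra
  ultimately have "v * w2 - u * w1 \<noteq> 0" using nz by (metis mult_eq_0_iff)
  moreover have "z2 - z1 = w * (v * w2 - u * w1)" using e(1,2) by algebra
  ultimately have d2: "z1 \<noteq> z2" using nz by auto
  have d3: "z \<noteq> z1" "z \<noteq> z2" "z1 \<noteq> z12" "z12 \<noteq> z2" using e nz by auto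
  have f: "z - z1 = - (u * w * w1)" "z1 - z12 = - (v * w1 * w12)" using e by (metis minus_diff_eq)+
  have "qfun z z1 z12 z2 = u\<^sup>2 / v\<^sup>2"
    unfolding qfun_def f e(2,4) using nz by (simp add: power2_eq_square)
  then show ?thesis unfolding q_eq_def using d1 d2 d3 by auto
qed

lemma q_eq_rotate: "q_eq a b x d q \<Longrightarrow> q_eq b x d a (1 / q)"
  unfolding q_eq_def qfun_def by (auto simp: divide_simps) (simp add: algebra_simps)

lemma q_eq_unique:
  assumes "q_eq a b x d q" "q_eq a b x' d q" "q \<noteq> 0"
  shows "x = x'"
proof (rule ccontr)
  assume ne: "x \<noteq> x'"
  have d: "a \<noteq> b" "b \<noteq> d" "d \<noteq> a" "b \<noteq> x" "b \<noteq> x'"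
    and e: "(a - b) * (x - d) / ((b - x) * (d - a)) = q" "(a - b) * (x' - d) / ((b - x') * (d - a)) = q"
    using assms unfolding q_eq_def qfun_def by auto
  have "(a - b) * (x - d) = q * ((b - x) * (d - a))" "(a - b) * (x' - d) = q * ((b - x') * (d - a))"
    using e d by (auto simp: divide_simps)
  then have "(x - x') * (a - b) * (b - d) = 0" by algebra
  then show False using ne d by simp
qed

text \<open>Cleared of its denominator, the equation is linear in \<open>a\<close> with leading
  coefficient \<open>c z - n (z - d)\<close>. If that vanished, \<open>c z (z - d) = 0\<close> would
  follow, hence z = 0 and then z = d.\<close>

lemma axis_next_unique:
  fixes c z d a a' n :: complex
  assumes "c \<noteq> 0" "n \<noteq> 0" "z \<noteq> d" "a \<noteq> d" "a' \<noteq> d"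
    and "c * z = n * ((a - z) * (z - d) / (a - d))" "c * z = n * ((a' - z) * (z - d) / (a' - d))"
  shows "a = a'"
proof (rule ccontr)
  assume ne: "a \<noteq> a'"
  have "c * z * (a - d) = n * ((a - z) * (z - d) / (a - d)) * (a - d)"
    "c * z * (a' - d) = n * ((a' - z) * (z - d) / (a' - d)) * (a' - d)"
    using assms(6,7) by metis+
  then have e: "c * z * (a - d) = n * ((a - z) * (z - d))" "c * z * (a' - d) = n * ((a' - z) * (z - d))"
    using assms(4,5) by simp_all
  then have "(a - a') * (c * z - n * (z - d)) = 0" by algebra
  then have p: "c * z = n * (z - d)" using ne by simp
  then have "c * z * (z - d) = 0" using e by algebra
  then have "z = 0" using assms by simp
  then show False using p assms by simp
qed

lemma cterm_hmean:
  assumes e: "p - z = v * w * wp" "z - m = v * wm * w" and nz: "v \<noteq> 0" "w \<noteq> 0" "wp + wm \<noteq> 0"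
  shows "p \<noteq> m" "(p - z) * (z - m) / (p - m) = v * w * hmean wp wm"
proof -
  have d: "p - m = v * w * (wp + wm)" using e by algebra
  then show "p \<noteq> m" using nz by auto
  show "(p - z) * (z - m) / (p - m) = v * w * hmean wp wm"
    unfolding d e hmean_def using nz by (simp add: divide_simps)
qed

locale hex_power =
  fixes a1 a2 a3 c :: real
  assumes a_pos: "a1 > 0" "a2 > 0" "a3 > 0" and a_sum: "a1 + a2 + a3 = pi"
    and c_range: "0 < c" "c < 2"

text \<open>The plane (1,3) takes the angle a3 and (3,2) the angle a2; the plane (1,2) then opens by
  a2 + a3 = pi - a1. The initial data prescribe the angles c a3 and c a2 at the origin, twice the
  good angles.\<close>

sublocale hex_power \<subseteq> sector3 c a3 a2 "c * a3 / 2" "c * a2 / 2"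
  by unfold_locales (use a_pos a_sum c_range in \<open>auto intro!: half_in_good_angles\<close>)

context hex_power
begin

text \<open>In the sector the first point of axis 1 has argument - c a3; the rotation moves it to
  1.\<close>

definition V1 :: complex where "V1 = cis (c * a3) * v1"
definition V2 :: complex where "V2 = cis (c * a3) * v2"
definition V3 :: complex where "V3 = cis (c * a3) * v3"

lemma V_nz: "V1 \<noteq> 0" "V2 \<noteq> 0" "V3 \<noteq> 0"
  by (simp_all add: V1_def V2_def V3_def)

lemma V_sq: "V1\<^sup>2 \<noteq> V3\<^sup>2" "V3\<^sup>2 \<noteq> V2\<^sup>2" "V1\<^sup>2 \<noteq> V2\<^sup>2"
  using v_sq by (simp_all add: V1_def V2_def V3_def power_mult_distrib del: cis_zero)

lemma V_faces:
  "hir V1 V2 (w k l n) (w (Suc k) l n) (w k (Suc l) n) (w (Suc k) (Suc l) n)"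
  "hir V1 V3 (w k l n) (w (Suc k) l n) (w k l (Suc n)) (w (Suc k) l (Suc n))"
  "hir V2 V3 (w k l n) (w k (Suc l) n) (w k l (Suc n)) (w k (Suc l) (Suc n))"
  unfolding V1_def V2_def V3_def by (rule hir_scale w_face12 w_face13 w_face23)+

text \<open>\<open>pos3\<close> is c times the position, so dividing by c produces a map whose edges
  have the required form, and the constraint holds by construction.\<close>

definition Z :: "nat \<Rightarrow> nat \<Rightarrow> nat \<Rightarrow> complex" where
  "Z k l n = cis (c * a3) / of_real c * pos3 v1 v2 v3 w k l n"

lemma Z_edges:
  "Z (Suc k) l n - Z k l n = V1 * w k l n * w (Suc k) l n"
  "Z k (Suc l) n - Z k l n = V2 * w k l n * w k (Suc l) n"
  "Z k l (Suc n) - Z k l n = V3 * w k l n * w k l (Suc n)"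
proof -
  have "cis (c * a3) / of_real c * x - cis (c * a3) / of_real c * y = cis (c * a3) / of_real c * (x - y)" for x y
    by (rule right_diff_distrib[symmetric])
  then show "Z (Suc k) l n - Z k l n = V1 * w k l n * w (Suc k) l n"
    "Z k (Suc l) n - Z k l n = V2 * w k l n * w k (Suc l) n"
    "Z k l (Suc n) - Z k l n = V3 * w k l n * w k l (Suc n)"
    unfolding Z_def pos3_edges V1_def V2_def V3_def using c by (simp_all only: pos3_edges) simp_all
qed

lemma Z_quads:
  "q_eq (Z k l n) (Z (Suc k) l n) (Z (Suc k) (Suc l) n) (Z k (Suc l) n) (V1\<^sup>2 / V2\<^sup>2)"
  "q_eq (Z k l n) (Z (Suc k) l n) (Z (Suc k) l (Suc n)) (Z k l (Suc n)) (V1\<^sup>2 / V3\<^sup>2)"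
  "q_eq (Z k l n) (Z k l (Suc n)) (Z k (Suc l) (Suc n)) (Z k (Suc l) n) (V3\<^sup>2 / V2\<^sup>2)"
  by (rule hir_q_eq[OF V_faces(1) Z_edges(1) Z_edges(2) Z_edges(2) Z_edges(1)],
      (rule w_nz V_nz V_sq)+)
    (rule hir_q_eq[OF V_faces(2) Z_edges(1) Z_edges(3) Z_edges(3) Z_edges(1)],
      (rule w_nz V_nz V_sq)+,
     rule hir_q_eq[OF V_faces(3)[THEN hir_swap[THEN iffD1]] Z_edges(3) Z_edges(2) Z_edges(2) Z_edges(3)],
      (rule w_nz V_nz V_sq)+)

lemma V_ratio: "V2\<^sup>2 / V1\<^sup>2 = cis (- 2 * a1)" "V3\<^sup>2 / V2\<^sup>2 = cis (- 2 * a2)" "V1\<^sup>2 / V3\<^sup>2 = cis (- 2 * a3)"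
proof -
  have r: "(cis (c * a3) * cis s)\<^sup>2 / (cis (c * a3) * cis t)\<^sup>2 = cis (2 * (s - t))" for s t
    by (simp add: power_mult_distrib Complex.DeMoivre cis_divide algebra_simps)
  \<comment> \<open>Here a2 + a3 = pi - a1, so the exponent differs from - 2 a1 by a full
    turn.\<close>
  have "cis (2 * (a2 - - a3)) = cis (- 2 * a1 + 2 * pi)"
    using a_sum by (intro arg_cong[of _ _ cis]) (simp add: algebra_simps)
  also have "\<dots> = cis (- 2 * a1)" using cis_mult[of "- 2 * a1" "2 * pi"] by simp
  finally show "V2\<^sup>2 / V1\<^sup>2 = cis (- 2 * a1)" unfolding V1_def V2_def r .
  show "V3\<^sup>2 / V2\<^sup>2 = cis (- 2 * a2)" "V1\<^sup>2 / V3\<^sup>2 = cis (- 2 * a3)"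
    unfolding V1_def V2_def V3_def r by (intro arg_cong[of _ _ cis], simp)+
qed

text \<open>One step outside Q, \<open>nat\<close> repeats the boundary value, in agreement with the
  truncated \<open>k - 1\<close> of \<open>pos3\<close>; the coefficient is 0 there.\<close>

definition zc :: "pt \<Rightarrow> complex" where
  "zc p = (case p of (k, l, m) \<Rightarrow> Z (nat k) (nat l) (nat (- m)))"

lemma zc_eq: "zc (int k, int l, - int n) = Z k l n"
  by (simp add: zc_def)

lemma zc_initial: "Zc_initial a1 a2 a3 c zc"
proof -
  have z0: "Z 0 0 0 = 0" by (simp add: Z_def pos3_def)
  have w0: "w 0 0 0 = 1" "w (Suc 0) 0 0 = e1" "w 0 (Suc 0) 0 = e2" "w 0 0 (Suc 0) = e3"
    by (simp_all add: plane13_def plane32_def fill_0_left)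
  have "Z (Suc 0) 0 0 = V1 * e1" "Z 0 (Suc 0) 0 = V2 * e2" "Z 0 0 (Suc 0) = V3 * e3"
    using Z_edges[of 0 0 0] unfolding z0 w0 by simp_all
  moreover have "V1 * e1 = 1" unfolding V1_def cis_mult by simp
  moreover have "V2 * e2 = cis (c * (a2 + a3))" unfolding V2_def cis_mult by (simp add: algebra_simps)
  moreover have "V3 * e3 = cis (c * a3)" by (simp add: V3_def)
  ultimately show ?thesis unfolding Zc_initial_def zc_def by simp
qed

lemma Z_constraint:
  "of_real c * Z k l n =
    of_nat (2 * k) * (V1 * w k l n * hmean (w (Suc k) l n) (w (k - 1) l n)) +
    of_nat (2 * l) * (V2 * w k l n * hmean (w k (Suc l) n) (w k (l - 1) n)) +
    of_nat (2 * n) * (V3 * w k l n * hmean (w k l (Suc n)) (w k l (n - 1)))"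
  unfolding Z_def pos3_def V1_def V2_def V3_def using c by (simp add: algebra_simps)

lemma cterm_zc:
  shows "k \<noteq> 0 \<Longrightarrow> zc (int k + 1, int l, - int n) \<noteq> zc (int k - 1, int l, - int n)"
    and "cterm (int k) (zc (int k + 1, int l, - int n)) (zc (int k, int l, - int n)) (zc (int k - 1, int l, - int n))
      = of_nat (2 * k) * (V1 * w k l n * hmean (w (Suc k) l n) (w (k - 1) l n))"
    and "l \<noteq> 0 \<Longrightarrow> zc (int k, int l + 1, - int n) \<noteq> zc (int k, int l - 1, - int n)"
    and "cterm (int l) (zc (int k, int l + 1, - int n)) (zc (int k, int l, - int n)) (zc (int k, int l - 1, - int n))
      = of_nat (2 * l) * (V2 * w k l n * hmean (w k (Suc l) n) (w k (l - 1) n))"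
    and "n \<noteq> 0 \<Longrightarrow> zc (int k, int l, - int n + 1) \<noteq> zc (int k, int l, - int n - 1)"
    and "cterm (- int n) (zc (int k, int l, - int n + 1)) (zc (int k, int l, - int n)) (zc (int k, int l, - int n - 1))
      = of_nat (2 * n) * (V3 * w k l n * hmean (w k l (Suc n)) (w k l (n - 1)))"
proof -
  have zk: "zc (int k + 1, int l, - int n) = Z (Suc k) l n" "zc (int k - 1, int l, - int n) = Z (k - 1) l n"
    "zc (int k, int l + 1, - int n) = Z k (Suc l) n" "zc (int k, int l - 1, - int n) = Z k (l - 1) n"
    "zc (int k, int l, - int n + 1) = Z k l (n - 1)" "zc (int k, int l, - int n - 1) = Z k l (Suc n)"
    "zc (int k, int l, - int n) = Z k l n"
    by (simp_all add: zc_def nat_diff_distrib' nat_add_distrib)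
  have k: "Z (Suc k) l n \<noteq> Z (k - 1) l n \<and> (Z (Suc k) l n - Z k l n) * (Z k l n - Z (k - 1) l n) / (Z (Suc k) l n - Z (k - 1) l n)
     = V1 * w k l n * hmean (w (Suc k) l n) (w (k - 1) l n)" if "k \<noteq> 0"
    using that cterm_hmean[of "Z (Suc k) l n" "Z k l n" V1 "w k l n" "w (Suc k) l n" "Z (k - 1) l n" "w (k - 1) l n"]
      Z_edges(1)[of k l n] Z_edges(1)[of "k - 1" l n] V_nz w_nz w_sum1[of "k - 1" l n] by simp
  have l: "Z k (Suc l) n \<noteq> Z k (l - 1) n \<and> (Z k (Suc l) n - Z k l n) * (Z k l n - Z k (l - 1) n) / (Z k (Suc l) n - Z k (l - 1) n)
     = V2 * w k l n * hmean (w k (Suc l) n) (w k (l - 1) n)" if "l \<noteq> 0"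
    using cterm_hmean[of "Z k (Suc l) n" "Z k l n" V2 "w k l n" "w k (Suc l) n" "Z k (l - 1) n" "w k (l - 1) n"]
      Z_edges(2)[of k l n] Z_edges(2)[of k "l - 1" n] V_nz w_nz w_sum2[of k "l - 1" n] that by simp
  have n: "Z k l (Suc n) \<noteq> Z k l (n - 1) \<and> (Z k l (Suc n) - Z k l n) * (Z k l n - Z k l (n - 1)) / (Z k l (Suc n) - Z k l (n - 1))
     = V3 * w k l n * hmean (w k l (Suc n)) (w k l (n - 1))" if "n \<noteq> 0"
    using cterm_hmean[of "Z k l (Suc n)" "Z k l n" V3 "w k l n" "w k l (Suc n)" "Z k l (n - 1)" "w k l (n - 1)"]
      Z_edges(3)[of k l n] Z_edges(3)[of k l "n - 1"] V_nz w_nz w_sum3[of k l "n - 1"] that by simp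
  \<comment> \<open>Since n = -m, forward and backward neighbours in the third direction trade
    places; this sign cancels that of the coefficient 2 m.\<close>
  have flip: "(Z k l (n - 1) - Z k l n) * (Z k l n - Z k l (Suc n)) / (Z k l (n - 1) - Z k l (Suc n))
    = - ((Z k l (Suc n) - Z k l n) * (Z k l n - Z k l (n - 1)) / (Z k l (Suc n) - Z k l (n - 1)))"
  proof -
    have "(Z k l (n - 1) - Z k l n) * (Z k l n - Z k l (Suc n)) = (Z k l (Suc n) - Z k l n) * (Z k l n - Z k l (n - 1))"
      by algebra
    then show ?thesis by (metis minus_diff_eq divide_minus_right)
  qed
  show "k \<noteq> 0 \<Longrightarrow> zc (int k + 1, int l, - int n) \<noteq> zc (int k - 1, int l, - int n)"
    "l \<noteq> 0 \<Longrightarrow> zc (int k, int l + 1, - int n) \<noteq> zc (int k, int l - 1, - int n)"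
    "n \<noteq> 0 \<Longrightarrow> zc (int k, int l, - int n + 1) \<noteq> zc (int k, int l, - int n - 1)"
    unfolding zk using k l n by metis+
  show "cterm (int k) (zc (int k + 1, int l, - int n)) (zc (int k, int l, - int n)) (zc (int k - 1, int l, - int n))
      = of_nat (2 * k) * (V1 * w k l n * hmean (w (Suc k) l n) (w (k - 1) l n))"
    unfolding zk cterm_def using k by auto
  show "cterm (int l) (zc (int k, int l + 1, - int n)) (zc (int k, int l, - int n)) (zc (int k, int l - 1, - int n))
      = of_nat (2 * l) * (V2 * w k l n * hmean (w k (Suc l) n) (w k (l - 1) n))"
    unfolding zk cterm_def using l by auto
  show "cterm (- int n) (zc (int k, int l, - int n + 1)) (zc (int k, int l, - int n)) (zc (int k, int l, - int n - 1))
      = of_nat (2 * n) * (V3 * w k l n * hmean (w k l (Suc n)) (w k l (n - 1)))"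
    unfolding zk cterm_def flip using n by auto
qed

lemma inQ_nat:
  assumes "inQ (k, l, m)"
  obtains K L N where "k = int K" "l = int L" "m = - int N"
proof -
  have "k = int (nat k)" "l = int (nat l)" "m = - int (nat (- m))" using assms by (auto simp: inQ_def)
  then show ?thesis using that by blast
qed

lemma zc_solution: "is_solution a1 a2 a3 c zc"
  unfolding is_solution_def
proof (intro conjI allI impI)
  fix k l m
  assume "inQ (k,l,m) \<and> inQ (k,l+1,m) \<and> inQ (k-1,l+1,m) \<and> inQ (k-1,l,m)"
  then have "inQ (k - 1, l, m)" by simp
  then obtain K L N where K: "k - 1 = int K" "l = int L" "m = - int N" by (rule inQ_nat)
  then have e: "k = int (Suc K)" "l + 1 = int (Suc L)" by auto
  have "q_eq (Z (Suc K) L N) (Z (Suc K) (Suc L) N) (Z K (Suc L) N) (Z K L N) (1 / (V1\<^sup>2 / V2\<^sup>2))"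
    by (rule q_eq_rotate[OF Z_quads(1)])
  then show "q_eq (zc (k,l,m)) (zc (k,l+1,m)) (zc (k-1,l+1,m)) (zc (k-1,l,m)) (cis (-2 * a1))"
    unfolding K(1) e(2) unfolding e(1) K(2,3) zc_eq V_ratio(1)[symmetric] by simp
next
  fix k l m
  assume "inQ (k,l,m) \<and> inQ (k,l,m-1) \<and> inQ (k,l+1,m-1) \<and> inQ (k,l+1,m)"
  then have "inQ (k, l, m)" by simp
  then obtain K L N where K: "k = int K" "l = int L" "m = - int N" by (rule inQ_nat)
  then have e: "m - 1 = - int (Suc N)" "l + 1 = int (Suc L)" by auto
  show "q_eq (zc (k,l,m)) (zc (k,l,m-1)) (zc (k,l+1,m-1)) (zc (k,l+1,m)) (cis (-2 * a2))"
    unfolding e unfolding K zc_eq V_ratio(2)[symmetric] by (rule Z_quads(3))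
next
  fix k l m
  assume "inQ (k,l,m) \<and> inQ (k+1,l,m) \<and> inQ (k+1,l,m-1) \<and> inQ (k,l,m-1)"
  then have "inQ (k, l, m)" by simp
  then obtain K L N where K: "k = int K" "l = int L" "m = - int N" by (rule inQ_nat)
  then have e: "m - 1 = - int (Suc N)" "k + 1 = int (Suc K)" by auto
  show "q_eq (zc (k,l,m)) (zc (k+1,l,m)) (zc (k+1,l,m-1)) (zc (k,l,m-1)) (cis (-2 * a3))"
    unfolding e unfolding K zc_eq V_ratio(3)[symmetric] by (rule Z_quads(2))
next
  fix k l m
  assume "inQ (k,l,m)"
  then obtain K L N where K: "k = int K" "l = int L" "m = - int N" by (rule inQ_nat)
  show "k \<noteq> 0 \<Longrightarrow> zc (k+1,l,m) \<noteq> zc (k-1,l,m)" "l \<noteq> 0 \<Longrightarrow> zc (k,l+1,m) \<noteq> zc (k,l-1,m)"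
    "m \<noteq> 0 \<Longrightarrow> zc (k,l,m+1) \<noteq> zc (k,l,m-1)"
    unfolding K by (intro cterm_zc; simp)+
  show "of_real c * zc (k,l,m) =
          cterm k (zc (k+1,l,m)) (zc (k,l,m)) (zc (k-1,l,m)) +
          cterm l (zc (k,l+1,m)) (zc (k,l,m)) (zc (k,l-1,m)) +
          cterm m (zc (k,l,m+1)) (zc (k,l,m)) (zc (k,l,m-1))"
    unfolding K cterm_zc by (simp only: zc_eq Z_constraint)
qed

end

section \<open>Uniqueness\<close>

lemma axis_recursion_unique:
  fixes f g :: "nat \<Rightarrow> complex"
  assumes "f 0 = g 0" "f 1 = g 1" "c \<noteq> 0" "\<And>k. n k \<noteq> 0"
    and f: "\<And>k. f (Suc (Suc k)) \<noteq> f k \<and> f (Suc k) \<noteq> f k \<and>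
      c * f (Suc k) = n k * ((f (Suc (Suc k)) - f (Suc k)) * (f (Suc k) - f k) / (f (Suc (Suc k)) - f k))"
    and g: "\<And>k. g (Suc (Suc k)) \<noteq> g k \<and> g (Suc k) \<noteq> g k \<and>
      c * g (Suc k) = n k * ((g (Suc (Suc k)) - g (Suc k)) * (g (Suc k) - g k) / (g (Suc (Suc k)) - g k))"
  shows "f k = g k"
proof -
  have "f k = g k \<and> f (Suc k) = g (Suc k)"
  proof (induction k)
    case (Suc k)
    have "f (Suc (Suc k)) = g (Suc (Suc k))"
    proof (rule axis_next_unique[of c "n k" "f (Suc k)" "f k"])
      show "g (Suc (Suc k)) \<noteq> f k"
        "c * f (Suc k) = n k * ((g (Suc (Suc k)) - f (Suc k)) * (f (Suc k) - f k) / (g (Suc (Suc k)) - f k))"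
        using g[of k] Suc by auto
    qed (use f assms in blast)+
    then show ?case using Suc by simp
  qed (use assms in simp)
  then show ?thesis by simp
qed

context
  fixes a1 a2 a3 c :: real and z :: "pt \<Rightarrow> complex"
  assumes sol: "is_solution a1 a2 a3 c z" and ini: "Zc_initial a1 a2 a3 c z" and c: "c \<noteq> 0"
begin

lemma sol_face12: "q_eq (z (int (Suc k), int l, - int n)) (z (int (Suc k), int (Suc l), - int n))
    (z (int k, int (Suc l), - int n)) (z (int k, int l, - int n)) (cis (- 2 * a1))"
  using sol[unfolded is_solution_def, THEN conjunct1, rule_format, of "int (Suc k)" "int l" "- int n"]
  by (simp add: inQ_def add.commute)

lemma sol_face32: "q_eq (z (int k, int l, - int n)) (z (int k, int l, - int (Suc n)))
    (z (int k, int (Suc l), - int (Suc n))) (z (int k, int (Suc l), - int n)) (cis (- 2 * a2))"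
proof -
  have "- int (Suc n) = - int n - 1" by simp
  then show ?thesis
    using sol[unfolded is_solution_def, THEN conjunct1, rule_format, of "int k" "int l" "- int n"]
    unfolding inQ_def by (simp only:) (simp add: add.commute)
qed

lemma sol_face13: "q_eq (z (int k, int l, - int n)) (z (int (Suc k), int l, - int n))
    (z (int (Suc k), int l, - int (Suc n))) (z (int k, int l, - int (Suc n))) (cis (- 2 * a3))"
proof -
  have "- int (Suc n) = - int n - 1" by simp
  then show ?thesis
    using sol[unfolded is_solution_def, THEN conjunct1, rule_format, of "int k" "int l" "- int n"]
    unfolding inQ_def by (simp only:) (simp add: add.commute)
qed

lemmas sol_constraint = sol[unfolded is_solution_def, THEN conjunct2, rule_format]

lemma sol_origin: "z (0, 0, 0) = 0"
  using sol_constraint[of 0 0 0] c by (simp add: inQ_def cterm_def)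

lemma sol_axis1:
  defines "f \<equiv> \<lambda>k. z (int k, 0, 0)"
  shows "f (Suc (Suc k)) \<noteq> f k \<and> f (Suc k) \<noteq> f k \<and>
    of_real c * f (Suc k) = of_nat (2 * Suc k) * ((f (Suc (Suc k)) - f (Suc k)) * (f (Suc k) - f k) / (f (Suc (Suc k)) - f k))"
proof -
  have "inQ (int (Suc k), 0, 0)" by (simp add: inQ_def)
  from sol_constraint[OF this] sol_face12[of k 0 0]
  show ?thesis unfolding f_def q_eq_def by (auto simp: cterm_def add.commute)
qed

lemma sol_axis2:
  defines "f \<equiv> \<lambda>k. z (0, int k, 0)"
  shows "f (Suc (Suc k)) \<noteq> f k \<and> f (Suc k) \<noteq> f k \<and>
    of_real c * f (Suc k) = of_nat (2 * Suc k) * ((f (Suc (Suc k)) - f (Suc k)) * (f (Suc k) - f k) / (f (Suc (Suc k)) - f k))"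
proof -
  have "inQ (0, int (Suc k), 0)" by (simp add: inQ_def)
  from sol_constraint[OF this] sol_face12[of 0 k 0]
  show ?thesis unfolding f_def q_eq_def by (auto simp: cterm_def add.commute)
qed

lemma sol_axis3:
  defines "f \<equiv> \<lambda>k. z (0, 0, - int k)"
  shows "f (Suc (Suc k)) \<noteq> f k \<and> f (Suc k) \<noteq> f k \<and>
    of_real c * f (Suc k) = of_nat (2 * Suc k) * ((f (Suc (Suc k)) - f (Suc k)) * (f (Suc k) - f k) / (f (Suc (Suc k)) - f k))"
proof -
  have Q: "inQ (0, 0, - int (Suc k))" by (simp add: inQ_def)
  have i: "- int (Suc k) + 1 = - int k" "- int (Suc k) - 1 = - int (Suc (Suc k))" by auto
  have ne: "f (Suc (Suc k)) \<noteq> f k" "f (Suc k) \<noteq> f k"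
    using sol_constraint[OF Q] sol_face13[of 0 0 k] unfolding f_def q_eq_def i by auto
  have "of_real c * f (Suc k) = of_int (2 * - int (Suc k)) * ((f k - f (Suc k)) * (f (Suc k) - f (Suc (Suc k))) / (f k - f (Suc (Suc k))))"
    using sol_constraint[OF Q] unfolding f_def i by (simp add: cterm_def)
  also have "\<dots> = of_nat (2 * Suc k) * ((f (Suc (Suc k)) - f (Suc k)) * (f (Suc k) - f k) / (f (Suc (Suc k)) - f k))"
  proof -
    have "(f k - f (Suc k)) * (f (Suc k) - f (Suc (Suc k))) = (f (Suc (Suc k)) - f (Suc k)) * (f (Suc k) - f k)"
      by algebra
    moreover have "f k - f (Suc (Suc k)) = - (f (Suc (Suc k)) - f k)" by simp
    ultimately show ?thesis by (metis (no_types, opaque_lifting) divide_minus_right minus_mult_minus mult_minus_right of_int_minus of_int_of_nat_eq of_nat_Suc of_nat_mult of_nat_numeral)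
  qed
  finally show ?thesis using ne by blast
qed

end

text \<open>The constraint determines each axis from its first two points, the faces (3,2) and (1,3)
  then fill two coordinate planes, and the faces (1,2) fill every layer.\<close>

lemma solution_unique:
  assumes z: "is_solution a1 a2 a3 c z" "Zc_initial a1 a2 a3 c z"
    and z': "is_solution a1 a2 a3 c z'" "Zc_initial a1 a2 a3 c z'" and c: "c \<noteq> 0"
  shows "z (int k, int l, - int n) = z' (int k, int l, - int n)"
proof -
  note s = z(1) and s' = z'(1)
  have o: "z (0, 0, 0) = z' (0, 0, 0)" using sol_origin z z' c by metis
  have c': "complex_of_real c \<noteq> 0" using c by simp
  have n0: "complex_of_nat (2 * Suc k) \<noteq> 0" for k
    by (simp only: of_nat_eq_0_iff) simp
  have x1: "z (int k, 0, 0) = z' (int k, 0, 0)" for k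
    by (rule axis_recursion_unique[of "\<lambda>k. z (int k, 0, 0)" "\<lambda>k. z' (int k, 0, 0)" _ "\<lambda>k. of_nat (2 * Suc k)", OF _ _ c' n0 sol_axis1[OF z c] sol_axis1[OF z' c]])
      (use o z(2) z'(2) in \<open>auto simp: Zc_initial_def\<close>)
  have x2: "z (0, int k, 0) = z' (0, int k, 0)" for k
    by (rule axis_recursion_unique[of "\<lambda>k. z (0, int k, 0)" "\<lambda>k. z' (0, int k, 0)" _ "\<lambda>k. of_nat (2 * Suc k)", OF _ _ c' n0 sol_axis2[OF z c] sol_axis2[OF z' c]])
      (use o z(2) z'(2) in \<open>auto simp: Zc_initial_def\<close>)
  have x3: "z (0, 0, - int k) = z' (0, 0, - int k)" for k
    by (rule axis_recursion_unique[of "\<lambda>k. z (0, 0, - int k)" "\<lambda>k. z' (0, 0, - int k)" _ "\<lambda>k. of_nat (2 * Suc k)", OF _ _ c' n0 sol_axis3[OF z c] sol_axis3[OF z' c]])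
      (use o z(2) z'(2) in \<open>auto simp: Zc_initial_def\<close>)
  have k0: "z (0, int l, - int n) = z' (0, int l, - int n)" for l n
  proof (induction l n rule: nat2_induct)
    case (step l n)
    show ?case
      using q_eq_unique[OF sol_face32[OF z c, of 0 l n]] sol_face32[OF z' c, of 0 l n] step by simp
  qed (use x2 x3[of "Suc _"] in auto)
  have l0: "z (int k, 0, - int n) = z' (int k, 0, - int n)" for k n
  proof (induction k n rule: nat2_induct)
    case (step k n)
    show ?case
      using q_eq_unique[OF sol_face13[OF z c, of k 0 n]] sol_face13[OF z' c, of k 0 n] step by simp
  qed (use x1 x3[of "Suc _"] in auto)
  show ?thesis
  proof (induction k l rule: nat2_induct)
    case (step k l)
    \<comment> \<open>In the equation of the face (1,2) the unknown corner stands second; three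
      rotations bring it to the third place, as \<open>q_eq_unique\<close> expects.\<close>
    show ?case
      using q_eq_unique[OF q_eq_rotate[OF q_eq_rotate[OF q_eq_rotate[OF sol_face12[OF z c, of k l n]]]]]
        q_eq_rotate[OF q_eq_rotate[OF q_eq_rotate[OF sol_face12[OF z' c, of k l n]]]] step by simp
  qed (use l0 k0[of "Suc _"] in auto)
qed

section \<open>Kites in angular sectors\<close>

text \<open>The open sector on the left of the ray from p along d. The angle is an explicit
  parameter instead of an argument, since the opening may exceed pi.\<close>

definition lsect :: "complex \<Rightarrow> complex \<Rightarrow> real \<Rightarrow> complex set" where
  "lsect p d \<beta> = {p + of_real s * d * cis \<gamma> | s \<gamma>. 0 < s \<and> 0 < \<gamma> \<and> \<gamma> < \<beta>}"

definition rsect :: "complex \<Rightarrow> complex \<Rightarrow> real \<Rightarrow> complex set" where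
  "rsect p d \<beta> = {p + of_real s * d * cis (- \<gamma>) | s \<gamma>. 0 < s \<and> 0 < \<gamma> \<and> \<gamma> < \<beta>}"

text \<open>A common point would make \<gamma> + \<gamma>' a multiple of 2 pi lying strictly between
  0 and 2 pi.\<close>

lemma lsect_rsect_disjoint:
  assumes "d \<noteq> 0" "\<beta> + \<beta>' \<le> 2 * pi"
  shows "lsect p d \<beta> \<inter> rsect p d \<beta>' = {}"
proof (rule ccontr)
  assume "lsect p d \<beta> \<inter> rsect p d \<beta>' \<noteq> {}"
  then obtain s \<gamma> s' \<gamma>' where g: "0 < s" "0 < \<gamma>" "\<gamma> < \<beta>" "0 < s'" "0 < \<gamma>'" "\<gamma>' < \<beta>'"
    and e: "p + of_real s * d * cis \<gamma> = p + of_real s' * d * cis (- \<gamma>')"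
    unfolding lsect_def rsect_def by blast
  have e': "of_real s * cis \<gamma> = of_real s' * cis (- \<gamma>')" using e assms by simp
  then have "norm (of_real s * cis \<gamma>) = norm (of_real s' * cis (- \<gamma>'))" by simp
  then have "s = s'" using g by (simp add: norm_mult)
  then have "cis \<gamma> = cis (- \<gamma>')" using e' g by simp
  then have "cis (\<gamma> + \<gamma>') = 1" by (simp add: cis_mult[symmetric]) (simp add: cis_mult)
  then have "cos (\<gamma> + \<gamma>') = 1" by (simp add: complex_eq_iff)
  then obtain m :: int where m: "\<gamma> + \<gamma>' = of_int m * 2 * pi" unfolding cos_one_2pi_int by blast
  have "0 < of_int m * 2 * pi" "of_int m * 2 * pi < 2 * pi" using g assms m by linarith+
  then have "0 < (of_int m :: real)" "(of_int m :: real) < 1"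
    by (auto simp: zero_less_mult_iff)
  then show False by simp
qed

text \<open>The imaginary parts of the point and of its rotation by -A have opposite signs, which
  confines its argument to [0, A].\<close>

lemma cone_polar:
  assumes A: "0 < A" "A < pi" and ab: "0 \<le> a" "0 \<le> b" "0 < a + b"
  obtains \<rho> \<gamma> where "0 < \<rho>" "0 \<le> \<gamma>" "\<gamma> \<le> A" "0 < b \<Longrightarrow> 0 < \<gamma>" "0 < a \<Longrightarrow> \<gamma> < A"
    "of_real a + of_real b * cis A = of_real \<rho> * cis \<gamma>"
proof -
  define x where "x = of_real a + of_real b * cis A"
  define \<gamma> where "\<gamma> = Arg x"
  have sA: "sin A > 0" using A by (intro sin_gt_zero)
  have x: "x \<noteq> 0"
  proof
    assume "x = 0"
    then have "Im x = 0" "Re x = 0" by auto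
    then show False unfolding x_def using sA ab by auto
  qed
  have p: "x = of_real (cmod x) * cis \<gamma>" unfolding \<gamma>_def using rcis_cmod_Arg[of x] by (simp add: rcis_def)
  have "Im x = cmod x * sin \<gamma>" using arg_cong[OF p, of Im] by simp
  then have i1: "cmod x * sin \<gamma> = b * sin A" by (simp add: x_def)
  have "x * cis (- A) = of_real (cmod x) * cis (\<gamma> - A)" by (subst p) (simp add: cis_mult mult.assoc)
  then have "Im (x * cis (- A)) = cmod x * sin (\<gamma> - A)" by simp
  moreover have "x * cis (- A) = of_real a * cis (- A) + of_real b" unfolding x_def by (simp add: algebra_simps cis_mult)
  ultimately have i2: "cmod x * sin (\<gamma> - A) = - a * sin A" by simp
  have g: "- pi < \<gamma>" "\<gamma> \<le> pi" unfolding \<gamma>_def using Arg_bounded by auto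
  have n: "cmod x > 0" using x by simp
  have "\<gamma> \<ge> 0"
  proof (rule ccontr)
    assume "\<not> 0 \<le> \<gamma>"
    then have "sin (- \<gamma>) > 0" using g by (intro sin_gt_zero) auto
    then have "cmod x * sin \<gamma> < 0" using n by (simp add: mult_pos_neg)
    moreover have "b * sin A \<ge> 0" using ab sA by simp
    ultimately show False using i1 by simp
  qed
  moreover have "\<gamma> \<le> A"
  proof (rule ccontr)
    assume "\<not> \<gamma> \<le> A"
    then have "sin (\<gamma> - A) > 0" using g A by (intro sin_gt_zero) auto
    then have "cmod x * sin (\<gamma> - A) > 0" using n by simp
    moreover have "- a * sin A \<le> 0" using ab sA by simp
    ultimately show False using i2 by simp
  qed
  moreover have "\<gamma> \<noteq> 0" if "0 < b" using i1 that sA by auto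
  moreover have "\<gamma> \<noteq> A" if "0 < a" using i2 that sA by auto
  ultimately show ?thesis using that[of "cmod x" \<gamma>] n p unfolding x_def by fastforce
qed

text \<open>The ray from w away from p is connected, unbounded and misses B.\<close>

lemma ray_outside:
  fixes w p :: complex
  assumes w: "w \<noteq> p" and R: "\<And>t::real. t \<ge> 1 \<Longrightarrow> p + of_real t * (w - p) \<notin> B"
  shows "w \<in> outside B"
proof -
  define R where "R = (\<lambda>t::real. p + of_real t * (w - p)) ` {1..}"
  have RB: "R \<subseteq> - B" unfolding R_def using assms(2) by auto
  have wR: "w \<in> R" unfolding R_def by (rule image_eqI[of _ _ 1]) auto
  have "connected R" unfolding R_def
    by (intro connected_continuous_image connected_Ici continuous_intros)
  then have sub: "R \<subseteq> connected_component_set (- B) w"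
    by (rule connected_component_maximal[OF wR _ RB])
  have "\<not> bounded R"
  proof
    assume "bounded R"
    then obtain M where M: "\<And>x. x \<in> R \<Longrightarrow> norm x \<le> M" unfolding bounded_iff by blast
    define t where "t = max 1 ((M + norm p + 1) / norm (w - p))"
    have n: "norm (w - p) > 0" using w by simp
    have "(M + norm p + 1) / norm (w - p) \<le> t" by (simp add: t_def)
    then have "M + norm p + 1 \<le> t * norm (w - p)" using n by (simp add: pos_divide_le_eq)
    moreover have "t \<ge> 1" by (simp add: t_def)
    moreover have "norm (of_real t * (w - p)) \<le> norm (p + of_real t * (w - p)) + norm p"
      using norm_triangle_ineq4[of "p + of_real t * (w - p)" p] by simp
    moreover have "norm (p + of_real t * (w - p)) \<le> M" using \<open>t \<ge> 1\<close> by (intro M) (auto simp: R_def)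
    ultimately show False by (simp add: norm_mult)
  qed
  then have "\<not> bounded (connected_component_set (- B) w)" using sub bounded_subset by blast
  then show ?thesis unfolding outside_def using wR RB by auto
qed

text \<open>The ray from z0 through w must hit the boundary at or beyond w. A hit on a side through
  z0 would place w on that side; a hit elsewhere on the other two sides has an angle strictly
  between 0 and 2 A.\<close>

lemma kite_sector:
  assumes A: "0 < A" "A < pi" and r: "0 < r" "0 < s" "0 < r'"
    and B: "B = closed_segment z0 (z0 + of_real r * d) \<union> closed_segment (z0 + of_real r * d) (z0 + of_real s * d * cis A)
      \<union> closed_segment (z0 + of_real s * d * cis A) (z0 + of_real r' * d * cis (2 * A))
      \<union> closed_segment (z0 + of_real r' * d * cis (2 * A)) z0"
    and w: "w \<notin> B" "w \<notin> outside B"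
  shows "w \<in> lsect z0 d (2 * A)"
proof -
  have w0: "w \<noteq> z0" using w(1) unfolding B by auto
  obtain t :: real where t: "t \<ge> 1" "z0 + of_real t * (w - z0) \<in> B"
    using ray_outside[OF w0] w(2) by blast
  have scale: "w = z0 + of_real (x / t) * y" if "z0 + of_real t * (w - z0) = z0 + of_real x * y" for x y
  proof -
    have "of_real t * (w - z0) = of_real x * y" using that by simp
    then have "w - z0 = of_real (x / t) * y" using t(1) by (simp add: field_simps)
    then show ?thesis by (simp add: algebra_simps)
  qed
  have on_ray: False if b: "z0 + of_real t * (w - z0) \<in> closed_segment z0 q" and q: "closed_segment z0 q \<subseteq> B" for q
  proof -
    obtain u where u: "0 \<le> u" "u \<le> 1" "z0 + of_real t * (w - z0) = (1 - u) *\<^sub>R z0 + u *\<^sub>R q"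
      using b unfolding closed_segment_def by blast
    then have "z0 + of_real t * (w - z0) = z0 + of_real u * (q - z0)" by (simp add: scaleR_conv_of_real algebra_simps)
    from scale[OF this] have "w = (1 - u / t) *\<^sub>R z0 + (u / t) *\<^sub>R q"
      by (simp add: scaleR_conv_of_real algebra_simps diff_divide_distrib)
    moreover have "0 \<le> u / t" "u / t \<le> 1" using u t(1) by (auto simp: divide_simps)
    ultimately have "w \<in> closed_segment z0 q" unfolding closed_segment_def by blast
    then show False using q w by blast
  qed
  have inside: "w \<in> lsect z0 d (2 * A)"
    if "z0 + of_real t * (w - z0) = z0 + of_real \<rho> * (d * cis \<gamma>)" "0 < \<rho>" "0 < \<gamma>" "\<gamma> < 2 * A" for \<rho> \<gamma>
  proof -
    have "w = z0 + of_real (\<rho> / t) * d * cis \<gamma>" using scale[OF that(1)] by (simp add: mult.assoc)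
    moreover have "0 < \<rho> / t" using that t(1) by simp
    ultimately show ?thesis unfolding lsect_def using that by blast
  qed
  from t(2) consider "z0 + of_real t * (w - z0) \<in> closed_segment z0 (z0 + of_real r * d)"
    | "z0 + of_real t * (w - z0) \<in> closed_segment z0 (z0 + of_real r' * d * cis (2 * A))"
    | "z0 + of_real t * (w - z0) \<in> closed_segment (z0 + of_real r * d) (z0 + of_real s * d * cis A)"
    | "z0 + of_real t * (w - z0) \<in> closed_segment (z0 + of_real s * d * cis A) (z0 + of_real r' * d * cis (2 * A))"
    unfolding B using closed_segment_commute by blast
  then show ?thesis
  proof cases
    case 1
    have False by (rule on_ray[OF 1]) (auto simp: B)
    then show ?thesis ..
  next
    case 2
    have False by (rule on_ray[OF 2]) (use closed_segment_commute in \<open>auto simp: B\<close>)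
    then show ?thesis ..
  next
    case 3
    then obtain u where u: "0 \<le> u" "u \<le> 1"
      "z0 + of_real t * (w - z0) = (1 - u) *\<^sub>R (z0 + of_real r * d) + u *\<^sub>R (z0 + of_real s * d * cis A)"
      unfolding closed_segment_def by blast
    have e: "z0 + of_real t * (w - z0) = z0 + d * (of_real ((1 - u) * r) + of_real (u * s) * cis A)"
      unfolding u(3) by (simp add: scaleR_conv_of_real algebra_simps)
    show ?thesis
    proof (cases "u = 0")
      case True
      then have "z0 + of_real t * (w - z0) \<in> closed_segment z0 (z0 + of_real r * d)" using u(3) by simp
      from on_ray[OF this] show ?thesis by (auto simp: B)
    next
      case False
      have "0 \<le> (1 - u) * r" "0 < u * s" using u False r by auto
      then obtain \<rho> \<gamma> where "0 < \<rho>" "0 < \<gamma>" "\<gamma> \<le> A"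
        "of_real ((1 - u) * r) + of_real (u * s) * cis A = of_real \<rho> * cis \<gamma>"
        using cone_polar[OF A, of "(1 - u) * r" "u * s"] by (metis add_nonneg_pos less_imp_le)
      then show ?thesis using inside[of \<rho> \<gamma>] e A by (simp add: algebra_simps)
    qed
  next
    case 4
    then obtain u where u: "0 \<le> u" "u \<le> 1"
      "z0 + of_real t * (w - z0) = (1 - u) *\<^sub>R (z0 + of_real s * d * cis A) + u *\<^sub>R (z0 + of_real r' * d * cis (2 * A))"
      unfolding closed_segment_def by blast
    \<comment> \<open>The second half is measured from the direction cis A, because 2 A may exceed
      pi and \<open>cone_polar\<close> handles only angles below pi.\<close>
    have c2: "cis (2 * A) = cis A * cis A" by (simp add: cis_mult)
    have e: "z0 + of_real t * (w - z0) = z0 + d * cis A * (of_real ((1 - u) * s) + of_real (u * r') * cis A)"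
      unfolding u(3) c2 by (simp add: scaleR_conv_of_real algebra_simps)
    show ?thesis
    proof (cases "u = 1")
      case True
      then have "z0 + of_real t * (w - z0) \<in> closed_segment z0 (z0 + of_real r' * d * cis (2 * A))" using u(3) by simp
      moreover have "closed_segment z0 (z0 + of_real r' * d * cis (2 * A)) \<subseteq> B"
        unfolding B using closed_segment_commute by blast
      ultimately show ?thesis using on_ray by blast
    next
      case False
      have "0 < (1 - u) * s" "0 \<le> u * r'" using u False r by auto
      then obtain \<rho> \<gamma> where g: "0 < \<rho>" "0 \<le> \<gamma>" "\<gamma> < A"
        "of_real ((1 - u) * s) + of_real (u * r') * cis A = of_real \<rho> * cis \<gamma>"
        using cone_polar[OF A, of "(1 - u) * s" "u * r'"] by (metis add_pos_nonneg less_imp_le)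
      have "d * cis A * (of_real \<rho> * cis \<gamma>) = of_real \<rho> * (d * cis (A + \<gamma>))"
        by (simp add: cis_mult[symmetric])
      then show ?thesis using inside[of \<rho> "A + \<gamma>"] e g A by simp
    qed
  qed
qed

lemma quad_interiorD:
  assumes "w \<in> quad_interior a b c d"
  shows "w \<notin> closed_segment a b \<union> closed_segment b c \<union> closed_segment c d \<union> closed_segment d a"
    and "w \<notin> outside (closed_segment a b \<union> closed_segment b c \<union> closed_segment c d \<union> closed_segment d a)"
proof -
  have im: "path_image (quad_path a b c d) = closed_segment a b \<union> closed_segment b c \<union> closed_segment c d \<union> closed_segment d a"
    unfolding quad_path_def by (simp add: path_image_join Un_assoc)
  have "path (quad_path a b c d)" "pathfinish (quad_path a b c d) = pathstart (quad_path a b c d)"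
    unfolding quad_path_def by auto
  then show "w \<notin> closed_segment a b \<union> closed_segment b c \<union> closed_segment c d \<union> closed_segment d a"
    "w \<notin> outside (closed_segment a b \<union> closed_segment b c \<union> closed_segment c d \<union> closed_segment d a)"
    using assms winding_number_zero_in_outside[of "quad_path a b c d" w] unfolding quad_interior_def im by auto
qed

text \<open>Seen from the centre z0 the kite has half-angle A, the argument of r + r' cis \<delta>,
  and A < \<delta> as both radii are positive. The Hirota relation makes zb - z0 the rotation of za
  - z0 by 2 A.\<close>

lemma kite_sectors:
  assumes h: "hir u v r Wa Wb r'" and r: "circ_val 0 r" "circ_val 0 r'"
    and W: "norm Wa = 1" "norm Wb = 1" and u: "u \<noteq> 0" and v: "v = u * cis \<delta>" and d: "0 < \<delta>" "\<delta> < pi"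
    and e: "za - z0 = u * r * Wa" "zb - z0 = v * r * Wb" "z1 - z0 = Wa * (u * r + v * r')"
    and B: "B = closed_segment z0 za \<union> closed_segment za z1 \<union> closed_segment z1 zb \<union> closed_segment zb z0"
    and w: "w \<notin> B" "w \<notin> outside B"
  shows "w \<in> lsect z0 (za - z0) (2 * \<delta>)" "w \<in> rsect z0 (zb - z0) (2 * \<delta>)"
proof -
  obtain x y where xy: "x > 0" "y > 0" "r = of_real x" "r' = of_real y"
    using r circ_val_even by (metis even_zero)
  obtain s A where s: "0 < s" "0 < A" "A < \<delta>" and q: "of_real x + of_real y * cis \<delta> = of_real s * cis A"
    using cone_polar[OF d, of x y] xy by (metis add_pos_pos less_imp_le)
  have "cnj (of_real x + of_real y * cis \<delta>) * cis \<delta> = of_real s * cis (\<delta> - A)"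
    unfolding q by (simp add: cis_cnj cis_mult)
  moreover have "cnj (of_real x + of_real y * cis \<delta>) * cis \<delta> = of_real x * cis \<delta> + of_real y"
    by (simp add: algebra_simps cis_cnj cis_mult)
  ultimately have q': "of_real x * cis \<delta> + of_real y = of_real s * cis (\<delta> - A)" by simp
  have "u * (Wa * (of_real x + of_real y * cis \<delta>)) = u * (Wb * (of_real x * cis \<delta> + of_real y))"
    using h unfolding hir_def v xy by (simp add: algebra_simps)
  then have "Wa * (of_real s * cis A) = Wb * (of_real s * cis (\<delta> - A))" using u unfolding q q' by simp
  then have "of_real s * (Wa * cis A) = of_real s * (Wb * cis (\<delta> - A))" by (simp add: mult.left_commute)
  then have "Wa * cis A = Wb * cis (\<delta> - A)" using s by simp
  then have "Wa * cis A * cis (A - \<delta>) = Wb * (cis (\<delta> - A) * cis (A - \<delta>))" by (simp add: mult.assoc)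
  then have Wb: "Wb = Wa * cis (2 * A - \<delta>)" unfolding mult.assoc cis_mult by (simp add: algebra_simps)
  define D where "D = u * Wa"
  have za: "za = z0 + of_real x * D" using e(1) by (simp add: D_def xy algebra_simps)
  have "v * Wb = D * cis (2 * A)"
    unfolding v Wb D_def by (simp add: mult.assoc) (simp add: mult.left_commute[of "cis \<delta>"] cis_mult)
  then have "zb - z0 = of_real x * (D * cis (2 * A))" using e(2) by (simp add: xy mult.left_commute mult.commute)
  then have zb: "zb = z0 + of_real x * D * cis (2 * A)" by (simp add: algebra_simps)
  have "z1 - z0 = D * (of_real x + of_real y * cis \<delta>)" using e(3) by (simp add: D_def v xy algebra_simps)
  then have z1: "z1 = z0 + of_real s * D * cis A" unfolding q by (simp add: algebra_simps)
  have "A < pi" using s d by simp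
  have "w \<in> lsect z0 D (2 * A)"
    by (rule kite_sector[OF s(2) \<open>A < pi\<close> xy(1) s(1) xy(1) B[unfolded za zb z1] w])
  then obtain t \<gamma> where t: "0 < t" "0 < \<gamma>" "\<gamma> < 2 * A" "w = z0 + of_real t * D * cis \<gamma>"
    unfolding lsect_def by blast
  have "w = z0 + of_real (t / x) * (za - z0) * cis \<gamma>" using t(4) xy(1) by (simp add: za)
  moreover have "\<gamma> < 2 * \<delta>" "0 < t / x" using t s xy by auto
  ultimately show "w \<in> lsect z0 (za - z0) (2 * \<delta>)" unfolding lsect_def using t(2) by blast
  have "w = z0 + of_real (t / x) * (zb - z0) * cis (- (2 * A - \<gamma>))"
    using t(4) xy(1) by (simp add: zb mult.assoc cis_mult)
  moreover have "0 < 2 * A - \<gamma>" "2 * A - \<gamma> < 2 * \<delta>" using t s by auto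
  ultimately show "w \<in> rsect z0 (zb - z0) (2 * \<delta>)" unfolding rsect_def using \<open>0 < t / x\<close> by blast
qed

section \<open>Adjacent kites\<close>

text \<open>The centres are the base and the far corner. The latter sees the same kite with the
  directions negated and the two intersection points exchanged.\<close>

lemma even_face_sectors:
  assumes h: "hir u v w w1 w2 w12" and r: "circ_val 0 w" "circ_val 0 w12"
    and W: "norm w1 = 1" "norm w2 = 1" and u: "u \<noteq> 0" and v: "v = u * cis \<delta>" and d: "0 < \<delta>" "\<delta> < pi"
    and e: "z1 - z = u * w * w1" "z2 - z = v * w * w2" "z12 - z1 = v * w1 * w12" "z12 - z2 = u * w2 * w12"
    and B: "B = closed_segment z z1 \<union> closed_segment z1 z12 \<union> closed_segment z12 z2 \<union> closed_segment z2 z"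
    and x: "x \<notin> B" "x \<notin> outside B"
  shows "x \<in> lsect z (z1 - z) (2 * \<delta>)" "x \<in> rsect z (z2 - z) (2 * \<delta>)"
    and "x \<in> lsect z12 (z2 - z12) (2 * \<delta>)" "x \<in> rsect z12 (z1 - z12) (2 * \<delta>)"
proof -
  have "z12 - z = w1 * (u * w + v * w12)" using e by algebra
  note K = kite_sectors[OF h r W u v d e(1,2) this B x]
  show "x \<in> lsect z (z1 - z) (2 * \<delta>)" "x \<in> rsect z (z2 - z) (2 * \<delta>)" by (rule K)+
  have h': "hir (- u) (- v) w12 w2 w1 w" using h unfolding hir_def by algebra
  have u': "- u \<noteq> 0" "- v = - u * cis \<delta>" using u v by simp_all
  have e': "z2 - z12 = - u * w12 * w2" "z1 - z12 = - v * w12 * w1" "z - z12 = w2 * (- u * w12 + - v * w)"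
    using e by algebra+
  have B': "B = closed_segment z12 z2 \<union> closed_segment z2 z \<union> closed_segment z z1 \<union> closed_segment z1 z12"
    unfolding B by blast
  note K = kite_sectors[OF h' r(2,1) W(2,1) u' d e' B' x]
  show "x \<in> lsect z12 (z2 - z12) (2 * \<delta>)" "x \<in> rsect z12 (z1 - z12) (2 * \<delta>)" by (rule K)+
qed

text \<open>The centres are now the two middle corners. At the first of them the edges leave in the
  directions v and -u, so the relevant angle is the one from v to -u.\<close>

lemma odd_face_sectors:
  assumes h: "hir u v w w1 w2 w12" and r: "circ_val 0 w1" "circ_val 0 w2"
    and W: "norm w = 1" "norm w12 = 1" and u: "u \<noteq> 0" and v: "- u = v * cis \<delta>" and d: "0 < \<delta>" "\<delta> < pi"
    and e: "z1 - z = u * w * w1" "z2 - z = v * w * w2" "z12 - z1 = v * w1 * w12" "z12 - z2 = u * w2 * w12"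
    and B: "B = closed_segment z z1 \<union> closed_segment z1 z12 \<union> closed_segment z12 z2 \<union> closed_segment z2 z"
    and x: "x \<notin> B" "x \<notin> outside B"
  shows "x \<in> lsect z1 (z12 - z1) (2 * \<delta>)" "x \<in> rsect z1 (z - z1) (2 * \<delta>)"
    and "x \<in> lsect z2 (z - z2) (2 * \<delta>)" "x \<in> rsect z2 (z12 - z2) (2 * \<delta>)"
proof -
  have v0: "v \<noteq> 0" "- v \<noteq> 0" using u v by auto
  have h1: "hir v (- u) w1 w12 w w2" using h unfolding hir_def by algebra
  have e1: "z12 - z1 = v * w1 * w12" "z - z1 = - u * w1 * w" "z2 - z1 = w12 * (v * w1 + - u * w2)"
    using e by algebra+
  have B1: "B = closed_segment z1 z12 \<union> closed_segment z12 z2 \<union> closed_segment z2 z \<union> closed_segment z z1"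
    unfolding B by blast
  note K = kite_sectors[OF h1 r W(2,1) v0(1) v d e1 B1 x]
  show "x \<in> lsect z1 (z12 - z1) (2 * \<delta>)" "x \<in> rsect z1 (z - z1) (2 * \<delta>)" by (rule K)+
  have h2: "hir (- v) u w2 w w12 w1" using h unfolding hir_def by algebra
  have v2: "u = - v * cis \<delta>" using arg_cong[OF v, of uminus] by simp
  have e2: "z - z2 = - v * w2 * w" "z1 - z2 = w * (- v * w2 + u * w1)"
    using e by algebra+
  have B2: "B = closed_segment z2 z \<union> closed_segment z z1 \<union> closed_segment z1 z12 \<union> closed_segment z12 z2"
    unfolding B by blast
  note K = kite_sectors[OF h2 r(2,1) W v0(2) v2 d e2(1) e(4) e2(2) B2 x]
  show "x \<in> lsect z2 (z - z2) (2 * \<delta>)" "x \<in> rsect z2 (z12 - z2) (2 * \<delta>)" by (rule K)+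
qed

text \<open>
  Here q is a circle centre and r an intersection point: the quadrilateral (p, i, j) has the edge
  from q to r and lies to its left (right).
\<close>

definition left_of :: "pt \<Rightarrow> nat \<Rightarrow> nat \<Rightarrow> pt \<Rightarrow> pt \<Rightarrow> bool" where
  "left_of p i j q r \<longleftrightarrow> (case p of (k, l, m) \<Rightarrow>
     i = 1 \<and> j = 2 \<and> (q = (k+1,l,m) \<and> r = (k+1,l+1,m) \<or> q = (k,l+1,m) \<and> r = (k,l,m)) \<or>
     i = 1 \<and> j = 3 \<and> (q = (k,l,m+1) \<and> r = (k+1,l,m+1) \<or> q = (k+1,l,m) \<and> r = (k,l,m)) \<or>
     i = 2 \<and> j = 3 \<and> (q = (k,l,m+1) \<and> r = (k,l,m) \<or> q = (k,l+1,m) \<and> r = (k,l+1,m+1)))"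

definition right_of :: "pt \<Rightarrow> nat \<Rightarrow> nat \<Rightarrow> pt \<Rightarrow> pt \<Rightarrow> bool" where
  "right_of p i j q r \<longleftrightarrow> (case p of (k, l, m) \<Rightarrow>
     i = 1 \<and> j = 2 \<and> (q = (k+1,l,m) \<and> r = (k,l,m) \<or> q = (k,l+1,m) \<and> r = (k+1,l+1,m)) \<or>
     i = 1 \<and> j = 3 \<and> (q = (k,l,m+1) \<and> r = (k,l,m) \<or> q = (k+1,l,m) \<and> r = (k+1,l,m+1)) \<or>
     i = 2 \<and> j = 3 \<and> (q = (k,l,m+1) \<and> r = (k,l+1,m+1) \<or> q = (k,l+1,m) \<and> r = (k,l,m)))"

lemma quad_verts_12: "quad_verts (k, l, m) 1 2 = [(k,l,m), (k+1,l,m), (k+1,l+1,m), (k,l+1,m)]"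
  and quad_verts_13: "quad_verts (k, l, m) 1 3 = [(k,l,m), (k+1,l,m), (k+1,l,m+1), (k,l,m+1)]"
  and quad_verts_23: "quad_verts (k, l, m) 2 3 = [(k,l,m), (k,l+1,m), (k,l+1,m+1), (k,l,m+1)]"
  by (simp_all add: quad_verts_def padd_def ebas_def)

text \<open>The coordinate sums of the vertices are s, s + 1, s + 1, s + 2; all of them lie in
  [-1, 1] only if s = -1.\<close>

lemma elem_quad_cases:
  assumes "elem_quad (k, l, m) i j"
  obtains "i = 1" "j = 2" "k \<ge> 0" "l \<ge> 0" "m \<le> 0" "k + l + m = -1"
  | "i = 1" "j = 3" "k \<ge> 0" "l \<ge> 0" "m + 1 \<le> 0" "k + l + m = -1"
  | "i = 2" "j = 3" "k \<ge> 0" "l \<ge> 0" "m + 1 \<le> 0" "k + l + m = -1"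
proof -
  have "i = 1 \<and> j = 2 \<or> i = 1 \<and> j = 3 \<or> i = 2 \<and> j = 3" using assms unfolding elem_quad_def by auto
  then show ?thesis
  proof (elim disjE conjE)
    assume ij: "i = 1" "j = 2"
    show ?thesis using assms that(1)[OF ij] unfolding ij elem_quad_def quad_verts_12
      by (auto simp: inQH_def inQ_def inH_def)
  next
    assume ij: "i = 1" "j = 3"
    show ?thesis using assms that(2)[OF ij] unfolding ij elem_quad_def quad_verts_13
      by (auto simp: inQH_def inQ_def inH_def)
  next
    assume ij: "i = 2" "j = 3"
    show ?thesis using assms that(3)[OF ij] unfolding ij elem_quad_def quad_verts_23
      by (auto simp: inQH_def inQ_def inH_def)
  qed
qed

text \<open>Level 0 marks the circle centres; each edge has exactly one, and this gives it a
  canonical orientation.\<close>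

definition level :: "pt \<Rightarrow> int" where
  "level p = (case p of (k, l, m) \<Rightarrow> k + l + m)"

lemma edge_side:
  assumes "elem_quad p i j" "e \<in> quad_edges (quad_verts p i j)"
  shows "\<exists>q r. e = {q, r} \<and> level q = 0 \<and> level r \<noteq> 0 \<and> (left_of p i j q r \<or> right_of p i j q r)"
proof -
  obtain k l m where p: "p = (k, l, m)" by (cases p)
  have D: ?thesis if "level q = 0" "level r \<noteq> 0" "e = {q, r} \<or> e = {r, q}" "left_of p i j q r \<or> right_of p i j q r" for q r
  proof (intro exI conjI)
    show "e = {q, r}" using that(3) by blast
  qed (use that in blast)+
  from assms(1)[unfolded p] show ?thesis
  proof (cases rule: elem_quad_cases)
    case 1
    have "e = {(k,l,m), (k+1,l,m)} \<or> e = {(k+1,l,m), (k+1,l+1,m)} \<or> e = {(k+1,l+1,m), (k,l+1,m)} \<or> e = {(k,l+1,m), (k,l,m)}"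
      using assms(2) unfolding p 1(1,2) quad_verts_12 by (simp add: quad_edges_def)
    then show ?thesis
    proof (elim disjE)
      assume "e = {(k,l,m), (k+1,l,m)}"
      then show ?thesis by (intro D[of "(k+1,l,m)" "(k,l,m)"]) (use 1 in \<open>auto simp: p level_def right_of_def\<close>)
    next
      assume "e = {(k+1,l,m), (k+1,l+1,m)}"
      then show ?thesis by (intro D[of "(k+1,l,m)" "(k+1,l+1,m)"]) (use 1 in \<open>auto simp: p level_def left_of_def\<close>)
    next
      assume "e = {(k+1,l+1,m), (k,l+1,m)}"
      then show ?thesis by (intro D[of "(k,l+1,m)" "(k+1,l+1,m)"]) (use 1 in \<open>auto simp: p level_def right_of_def\<close>)
    next
      assume "e = {(k,l+1,m), (k,l,m)}"
      then show ?thesis by (intro D[of "(k,l+1,m)" "(k,l,m)"]) (use 1 in \<open>auto simp: p level_def left_of_def\<close>)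
    qed
  next
    case 2
    have "e = {(k,l,m), (k+1,l,m)} \<or> e = {(k+1,l,m), (k+1,l,m+1)} \<or> e = {(k+1,l,m+1), (k,l,m+1)} \<or> e = {(k,l,m+1), (k,l,m)}"
      using assms(2) unfolding p 2(1,2) quad_verts_13 by (simp add: quad_edges_def)
    then show ?thesis
    proof (elim disjE)
      assume "e = {(k,l,m), (k+1,l,m)}"
      then show ?thesis by (intro D[of "(k+1,l,m)" "(k,l,m)"]) (use 2 in \<open>auto simp: p level_def left_of_def\<close>)
    next
      assume "e = {(k+1,l,m), (k+1,l,m+1)}"
      then show ?thesis by (intro D[of "(k+1,l,m)" "(k+1,l,m+1)"]) (use 2 in \<open>auto simp: p level_def right_of_def\<close>)
    next
      assume "e = {(k+1,l,m+1), (k,l,m+1)}"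
      then show ?thesis by (intro D[of "(k,l,m+1)" "(k+1,l,m+1)"]) (use 2 in \<open>auto simp: p level_def left_of_def\<close>)
    next
      assume "e = {(k,l,m+1), (k,l,m)}"
      then show ?thesis by (intro D[of "(k,l,m+1)" "(k,l,m)"]) (use 2 in \<open>auto simp: p level_def right_of_def\<close>)
    qed
  next
    case 3
    have "e = {(k,l,m), (k,l+1,m)} \<or> e = {(k,l+1,m), (k,l+1,m+1)} \<or> e = {(k,l+1,m+1), (k,l,m+1)} \<or> e = {(k,l,m+1), (k,l,m)}"
      using assms(2) unfolding p 3(1,2) quad_verts_23 by (simp add: quad_edges_def)
    then show ?thesis
    proof (elim disjE)
      assume "e = {(k,l,m), (k,l+1,m)}"
      then show ?thesis by (intro D[of "(k,l+1,m)" "(k,l,m)"]) (use 3 in \<open>auto simp: p level_def right_of_def\<close>)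
    next
      assume "e = {(k,l+1,m), (k,l+1,m+1)}"
      then show ?thesis by (intro D[of "(k,l+1,m)" "(k,l+1,m+1)"]) (use 3 in \<open>auto simp: p level_def left_of_def\<close>)
    next
      assume "e = {(k,l+1,m+1), (k,l,m+1)}"
      then show ?thesis by (intro D[of "(k,l,m+1)" "(k,l+1,m+1)"]) (use 3 in \<open>auto simp: p level_def right_of_def\<close>)
    next
      assume "e = {(k,l,m+1), (k,l,m)}"
      then show ?thesis by (intro D[of "(k,l,m+1)" "(k,l,m)"]) (use 3 in \<open>auto simp: p level_def left_of_def\<close>)
    qed
  qed
qed

lemma left_of_unique: "left_of p i j q r \<Longrightarrow> left_of p' i' j' q r \<Longrightarrow> (p, i, j) = (p', i', j')"
  by (cases p; cases p') (auto simp: left_of_def)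

lemma right_of_unique: "right_of p i j q r \<Longrightarrow> right_of p' i' j' q r \<Longrightarrow> (p, i, j) = (p', i', j')"
  by (cases p; cases p') (auto simp: right_of_def)

lemma left_right_types:
  "left_of p i j q r \<Longrightarrow> right_of p' i' j' q r \<Longrightarrow> (i, j) \<noteq> (i', j')"
  by (cases p; cases p') (auto simp: left_of_def right_of_def)

context hex_power
begin

definition quad_angle :: "nat \<Rightarrow> nat \<Rightarrow> real" where
  "quad_angle i j = (if j = 2 then a1 else if i = 1 then a3 else a2)"

text \<open>Counterclockwise the directions V1, V3, V2, -V1 follow each other at the angles a3, a2,
  a1, which fill a half turn.\<close>

lemma V_turn: "V3 = V1 * cis a3" "V2 = V3 * cis a2" "- V1 = V2 * cis a1"
proof -
  show "V3 = V1 * cis a3" "V2 = V3 * cis a2"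
    unfolding V1_def V2_def V3_def mult.assoc cis_mult by simp_all
  have "V2 * cis a1 = cis (c * a3 - a3 + pi)"
    unfolding V2_def cis_mult by (rule arg_cong[of _ _ cis]) (use a_sum in linarith)
  also have "\<dots> = - cis (c * a3 - a3)" using cis_mult[of "c * a3 - a3" pi] by simp
  finally show "- V1 = V2 * cis a1" unfolding V1_def cis_mult by simp
qed

lemma angle_range: "0 < a1" "a1 < pi" "0 < a2" "a2 < pi" "0 < a3" "a3 < pi"
  using a_pos a_sum by auto

lemma w_unit: "odd (k + l + n) \<Longrightarrow> norm (w k l n) = 1"
  using w_val[of k l n] circ_val_odd by blast

lemma quad_sectors:
  assumes "elem_quad p i j" "x \<in> quad_image_interior zc (quad_verts p i j)"
  shows "left_of p i j q r \<Longrightarrow> zc r \<noteq> zc q \<and> x \<in> lsect (zc q) (zc r - zc q) (2 * quad_angle i j)"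
    and "right_of p i j q r \<Longrightarrow> zc r \<noteq> zc q \<and> x \<in> rsect (zc q) (zc r - zc q) (2 * quad_angle i j)"
proof -
  obtain k l m where p: "p = (k, l, m)" by (cases p)
  have ne: "Z (Suc K) L N \<noteq> Z K L N" "Z K (Suc L) N \<noteq> Z K L N" "Z K L (Suc N) \<noteq> Z K L N" for K L N
    using Z_edges[of K L N] V_nz w_nz by (metis mult_eq_0_iff right_minus_eq)+
  have "(left_of p i j q r \<longrightarrow> zc r \<noteq> zc q \<and> x \<in> lsect (zc q) (zc r - zc q) (2 * quad_angle i j)) \<and>
    (right_of p i j q r \<longrightarrow> zc r \<noteq> zc q \<and> x \<in> rsect (zc q) (zc r - zc q) (2 * quad_angle i j))"
    using assms(1)[unfolded p]
  proof (cases rule: elem_quad_cases)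
    case 1
    define K L N where "K = nat k" "L = nat l" "N = nat (- m)"
    have K: "k = int K" "l = int L" "m = - int N" using 1 by (auto simp: K_L_N_def)
    have odd: "odd (K + L + N)" using 1(6) unfolding K by presburger
    have zv: "zc (k,l,m) = Z K L N" "zc (k+1,l,m) = Z (Suc K) L N" "zc (k+1,l+1,m) = Z (Suc K) (Suc L) N" "zc (k,l+1,m) = Z K (Suc L) N"
      unfolding K by (simp_all add: zc_def nat_add_distrib)
    have x: "x \<in> quad_interior (Z K L N) (Z (Suc K) L N) (Z (Suc K) (Suc L) N) (Z K (Suc L) N)"
      using assms(2) unfolding p 1(1,2) quad_verts_12 quad_image_interior_def by (simp add: zv)
    note F = odd_face_sectors[OF V_faces(1) w_even w_even w_unit w_unit V_nz(1) V_turn(3) angle_range(1,2)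
        Z_edges(1) Z_edges(2) Z_edges(2) Z_edges(1) refl quad_interiorD[OF x]]
    have F: "x \<in> lsect (Z (Suc K) L N) (Z (Suc K) (Suc L) N - Z (Suc K) L N) (2 * a1)"
      "x \<in> rsect (Z (Suc K) L N) (Z K L N - Z (Suc K) L N) (2 * a1)"
      "x \<in> lsect (Z K (Suc L) N) (Z K L N - Z K (Suc L) N) (2 * a1)"
      "x \<in> rsect (Z K (Suc L) N) (Z (Suc K) (Suc L) N - Z K (Suc L) N) (2 * a1)"
      by (rule F; use odd in simp)+
    show ?thesis
      using F ne[of K L N] ne[of "Suc K" L N] ne[of K "Suc L" N] 1(1,2)
      by (auto simp: p left_of_def right_of_def zv quad_angle_def)
  next
    case 2
    \<comment> \<open>The third coordinate is reversed: in natural coordinates the face starts at p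
      + e3, a centre, so it is an even face. A face in directions 1 and 2 starts at p itself, an
      intersection point.\<close>
    define K L N where "K = nat k" "L = nat l" "N = nat (- m - 1)"
    have K: "k = int K" "l = int L" "m = - int (Suc N)" using 2 by (auto simp: K_L_N_def)
    have even: "even (K + L + N)" using 2(6) unfolding K by presburger
    have zv: "zc (k,l,m) = Z K L (Suc N)" "zc (k+1,l,m) = Z (Suc K) L (Suc N)" "zc (k+1,l,m+1) = Z (Suc K) L N" "zc (k,l,m+1) = Z K L N"
      unfolding K by (simp_all add: zc_def nat_add_distrib)
    have x: "x \<in> quad_interior (Z K L (Suc N)) (Z (Suc K) L (Suc N)) (Z (Suc K) L N) (Z K L N)"
      using assms(2) unfolding p 2(1,2) quad_verts_13 quad_image_interior_def by (simp add: zv)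
    have B: "closed_segment (Z K L (Suc N)) (Z (Suc K) L (Suc N)) \<union> closed_segment (Z (Suc K) L (Suc N)) (Z (Suc K) L N)
        \<union> closed_segment (Z (Suc K) L N) (Z K L N) \<union> closed_segment (Z K L N) (Z K L (Suc N))
      = closed_segment (Z K L N) (Z (Suc K) L N) \<union> closed_segment (Z (Suc K) L N) (Z (Suc K) L (Suc N))
        \<union> closed_segment (Z (Suc K) L (Suc N)) (Z K L (Suc N)) \<union> closed_segment (Z K L (Suc N)) (Z K L N)"
      unfolding closed_segment_commute[of "Z K L (Suc N)" "Z (Suc K) L (Suc N)"] closed_segment_commute[of "Z (Suc K) L N" "Z (Suc K) L (Suc N)"]
        closed_segment_commute[of "Z K L N" "Z (Suc K) L N"] closed_segment_commute[of "Z K L (Suc N)" "Z K L N"] by blast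
    note F = even_face_sectors[OF V_faces(2) w_even w_even w_unit w_unit V_nz(1) V_turn(1) angle_range(5,6)
        Z_edges(1) Z_edges(3) Z_edges(3) Z_edges(1) B quad_interiorD[OF x]]
    have F: "x \<in> lsect (Z K L N) (Z (Suc K) L N - Z K L N) (2 * a3)"
      "x \<in> rsect (Z K L N) (Z K L (Suc N) - Z K L N) (2 * a3)"
      "x \<in> lsect (Z (Suc K) L (Suc N)) (Z K L (Suc N) - Z (Suc K) L (Suc N)) (2 * a3)"
      "x \<in> rsect (Z (Suc K) L (Suc N)) (Z (Suc K) L N - Z (Suc K) L (Suc N)) (2 * a3)"
      by (rule F; use even in simp)+
    show ?thesis
      using F ne[of K L N] ne[of "Suc K" L N] ne[of K L "Suc N"] 2(1,2)
      by (auto simp: p left_of_def right_of_def zv quad_angle_def)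
  next
    case 3
    define K L N where "K = nat k" "L = nat l" "N = nat (- m - 1)"
    have K: "k = int K" "l = int L" "m = - int (Suc N)" using 3 by (auto simp: K_L_N_def)
    have even: "even (K + L + N)" using 3(6) unfolding K by presburger
    have zv: "zc (k,l,m) = Z K L (Suc N)" "zc (k,l+1,m) = Z K (Suc L) (Suc N)" "zc (k,l+1,m+1) = Z K (Suc L) N" "zc (k,l,m+1) = Z K L N"
      unfolding K by (simp_all add: zc_def nat_add_distrib)
    have x: "x \<in> quad_interior (Z K L (Suc N)) (Z K (Suc L) (Suc N)) (Z K (Suc L) N) (Z K L N)"
      using assms(2) unfolding p 3(1,2) quad_verts_23 quad_image_interior_def by (simp add: zv)
    have B: "closed_segment (Z K L (Suc N)) (Z K (Suc L) (Suc N)) \<union> closed_segment (Z K (Suc L) (Suc N)) (Z K (Suc L) N)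
        \<union> closed_segment (Z K (Suc L) N) (Z K L N) \<union> closed_segment (Z K L N) (Z K L (Suc N))
      = closed_segment (Z K L N) (Z K L (Suc N)) \<union> closed_segment (Z K L (Suc N)) (Z K (Suc L) (Suc N))
        \<union> closed_segment (Z K (Suc L) (Suc N)) (Z K (Suc L) N) \<union> closed_segment (Z K (Suc L) N) (Z K L N)"
      by blast
    note F = even_face_sectors[OF V_faces(3)[THEN hir_swap[THEN iffD1]] w_even w_even w_unit w_unit V_nz(3) V_turn(2) angle_range(3,4)
        Z_edges(3) Z_edges(2) Z_edges(2) Z_edges(3) B quad_interiorD[OF x]]
    have F: "x \<in> lsect (Z K L N) (Z K L (Suc N) - Z K L N) (2 * a2)"
      "x \<in> rsect (Z K L N) (Z K (Suc L) N - Z K L N) (2 * a2)"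
      "x \<in> lsect (Z K (Suc L) (Suc N)) (Z K (Suc L) N - Z K (Suc L) (Suc N)) (2 * a2)"
      "x \<in> rsect (Z K (Suc L) (Suc N)) (Z K L (Suc N) - Z K (Suc L) (Suc N)) (2 * a2)"
      by (rule F; use even in simp)+
    show ?thesis
      using F ne[of K L N] ne[of K "Suc L" N] ne[of K L "Suc N"] 3(1,2)
      by (auto simp: p left_of_def right_of_def zv quad_angle_def)
  qed
  then show "left_of p i j q r \<Longrightarrow> zc r \<noteq> zc q \<and> x \<in> lsect (zc q) (zc r - zc q) (2 * quad_angle i j)"
    "right_of p i j q r \<Longrightarrow> zc r \<noteq> zc q \<and> x \<in> rsect (zc q) (zc r - zc q) (2 * quad_angle i j)" by blast+
qed

text \<open>The two quadrilaterals at an edge are of different types, so their angles are two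
  different ones among a1, a2, a3 and sum to less than pi; the doubled openings fit around the
  centre.\<close>

lemma left_right_disjoint:
  assumes "elem_quad p i j" "elem_quad p' i' j'" "left_of p i j q r" "right_of p' i' j' q r"
  shows "quad_image_interior zc (quad_verts p i j) \<inter> quad_image_interior zc (quad_verts p' i' j') = {}"
proof (rule ccontr)
  assume "\<not> ?thesis"
  then obtain x where x: "x \<in> quad_image_interior zc (quad_verts p i j)" "x \<in> quad_image_interior zc (quad_verts p' i' j')"
    by blast
  have "(i, j) \<noteq> (i', j')" using left_right_types[OF assms(3,4)] .
  moreover have "(i, j) \<in> {(1,2), (1,3), (2,3)}" "(i', j') \<in> {(1,2), (1,3), (2,3)}"
    using assms(3,4) by (cases p; cases p'; auto simp: left_of_def right_of_def)+
  ultimately have "quad_angle i j + quad_angle i' j' \<le> pi"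
    using a_pos a_sum by (auto simp: quad_angle_def)
  then have "lsect (zc q) (zc r - zc q) (2 * quad_angle i j) \<inter> rsect (zc q) (zc r - zc q) (2 * quad_angle i' j') = {}"
    using quad_sectors(1)[OF assms(1) x(1) assms(3)] by (intro lsect_rsect_disjoint) auto
  then show False
    using quad_sectors(1)[OF assms(1) x(1) assms(3)] quad_sectors(2)[OF assms(2) x(2) assms(4)] by blast
qed

lemma zc_immersion: "immersion_QH zc"
  unfolding immersion_QH_def
proof (intro allI impI, elim conjE)
  fix p i j p' i' j'
  assume q: "elem_quad p i j" "elem_quad p' i' j'" "(p, i, j) \<noteq> (p', i', j')"
    and "quad_edges (quad_verts p i j) \<inter> quad_edges (quad_verts p' i' j') \<noteq> {}"
  then obtain e where e: "e \<in> quad_edges (quad_verts p i j)" "e \<in> quad_edges (quad_verts p' i' j')" by blast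
  obtain o1 r1 where 1: "e = {o1, r1}" "level o1 = 0" "level r1 \<noteq> 0" "left_of p i j o1 r1 \<or> right_of p i j o1 r1"
    using edge_side[OF q(1) e(1)] by blast
  obtain o2 r2 where 2: "e = {o2, r2}" "level o2 = 0" "level r2 \<noteq> 0" "left_of p' i' j' o2 r2 \<or> right_of p' i' j' o2 r2"
    using edge_side[OF q(2) e(2)] by blast
  \<comment> \<open>The level tells the centre of the common edge from its other end, so both
    quadrilaterals orient the edge alike.\<close>
  have eq: "o2 = o1" "r2 = r1" using 1 2 by (metis doubleton_eq_iff)+
  consider "left_of p i j o1 r1" "left_of p' i' j' o1 r1" | "right_of p i j o1 r1" "right_of p' i' j' o1 r1"
    | "left_of p i j o1 r1" "right_of p' i' j' o1 r1" | "left_of p' i' j' o1 r1" "right_of p i j o1 r1"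
    using 1(4) 2(4) unfolding eq by blast
  then show "quad_image_interior zc (quad_verts p i j) \<inter> quad_image_interior zc (quad_verts p' i' j') = {}"
  proof cases
    case 1
    then show ?thesis using left_of_unique q(3) by blast
  next
    case 2
    then show ?thesis using right_of_unique q(3) by blast
  next
    case 3
    then show ?thesis by (rule left_right_disjoint[OF q(1,2)])
  next
    case 4
    then show ?thesis using left_right_disjoint[OF q(2,1)] by blast
  qed
qed

end

lemma immersion_QH_cong:
  assumes "\<And>p. inQ p \<Longrightarrow> z p = z' p" "immersion_QH z'"
  shows "immersion_QH z"
proof -
  have "quad_image_interior z (quad_verts p i j) = quad_image_interior z' (quad_verts p i j)" if "elem_quad p i j" for p i j
  proof -
    have "z v = z' v" if "v \<in> set (quad_verts p i j)" for v
      using that \<open>elem_quad p i j\<close> assms(1) unfolding elem_quad_def inQH_def by blast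
    then show ?thesis by (simp add: quad_image_interior_def quad_verts_def)
  qed
  then show ?thesis using assms(2) unfolding immersion_QH_def by (metis (no_types, lifting))
qed

text \<open>Existence keeps the universal statement from being vacuous; immersion carries over to
  any solution because all of them agree on Q.\<close>

theorem theorem1:
  fixes a1 a2 a3 c :: real
  assumes "a1 > 0" "a2 > 0" "a3 > 0" "a1 + a2 + a3 = pi"
    and "0 < c" "c < 2"
  shows "(\<exists>z. is_solution a1 a2 a3 c z \<and> Zc_initial a1 a2 a3 c z) \<and>
         (\<forall>z. is_solution a1 a2 a3 c z \<and> Zc_initial a1 a2 a3 c z \<longrightarrow> immersion_QH z)"
proof -
  interpret hex_power a1 a2 a3 c using assms by unfold_locales
  show ?thesis
  proof (intro conjI allI impI)
    show "\<exists>z. is_solution a1 a2 a3 c z \<and> Zc_initial a1 a2 a3 c z"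
      using zc_solution zc_initial by blast
  next
    fix z assume z: "is_solution a1 a2 a3 c z \<and> Zc_initial a1 a2 a3 c z"
    show "immersion_QH z"
    proof (rule immersion_QH_cong[OF _ zc_immersion])
      fix p assume p: "inQ p"
      obtain k l m where klm: "p = (k, l, m)" by (cases p)
      from p[unfolded klm] obtain K L N where "k = int K" "l = int L" "m = - int N" by (rule inQ_nat)
      then show "z p = zc p"
        unfolding klm using solution_unique[of a1 a2 a3 c z zc K L N] z zc_solution zc_initial assms(5) by simp
    qed
  qed
qed

end
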